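(* Let $2<p\le\infty$ and let $X$ be a rearrangement-invariant space of sequences indexed by $\mathbb Z$. Then the following are equivalent (each inequality with some finite constant independent of $f$, respectively $b$): (i) for every $f\in L^1(\mathbb T)$, $$\big\|(\widehat f(n))_{n\in\mathbb Z}\big\|_X\lesssim\big\||x|^{\frac1{p^\sharp}}f(x)\big\|_{L^p(\mathbb T)};$$ (ii) for every $f\in L^1(\mathbb T)$, $$\big\|(\widehat f(n))_{n\in\mathbb Z}\big\|_X\lesssim\|f\|_{L^{2,p}(\mathbb T)};$$ (iii) for every sequence $b$, $$\|b\|_X\lesssim_p\|b\|_{\Theta_{2,p}}:=\Big(\sum_{n=1}^\infty\Big(\sum_{j=1}^n b_j^{*,2}\Big)^{\frac p2}\frac1{n\log^{\frac p2}(n+1)}\Big)^{\frac1p}.$$ In consequence, $\Theta_{2,p}$ is the smallest rearrangement-invariant space which contains the Fourier coefficients of every function in $L^{2,p}(\mathbb T)$ for $p>2$.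
   Context: $\mathbb T$ is identified with $[-\frac12,\frac12]$ with Lebesgue measure, and $\widehat f(n)=\int_{-1/2}^{1/2}f(x)e^{-2\pi i nx}dx$. $\frac1{p^\sharp}=|\frac12-\frac1p|$. For a function $f$ on $\mathbb T$, $f^*$ is its non-increasing rearrangement on $(0,1)$ and $f^{**}(t)=\frac1t\int_0^tf^*$; the Lorentz norm is $\|f\|_{L^{2,p}}=\big(\int_0^1(t^{1/2}f^{**}(t))^p\frac{dt}t\big)^{1/p}$ (for $p=\infty$: $\sup_{0<t<1}t^{1/2}f^{**}(t)$). For a sequence $b=(b_n)_{n\in\mathbb Z}$, $(b_j^* )_{j\ge1}$ is the non-increasing rearrangement of $(|b_n|)_{n\in\mathbb Z}$, and $b_j^{*,2}=(b_j^* )^2$. For $p=\infty$, $\|b\|_{\Theta_{2,\infty}}=\sup_{n\ge1}\log^{-1/2}(n+1)\big(\sum_{j=1}^nb_j^{*,2}\big)^{1/2}$. A rearrangement-invariant space is a Banach function (sequence) space in the usual sense (lattice norm with the Fatou property) whose norm depends only on the rearrangement $b^*$. "Smallest" means: $\Theta_{2,p}$ satisfies (ii), and whenever a rearrangement-invariant $X$ satisfies (ii), $\|\cdot\|_X\lesssim\|\cdot\|_{\Theta_{2,p}}$. *)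

theory Defs
  imports "HOL-Probability.Essential_Supremum"
begin

text \<open>All norms below take values in \<open>[0,\<infinity>]\<close>, the value \<open>\<infinity>\<close> meaning that the function or sequence
  does not belong to the space. Exponents \<open>p\<close> of type \<^typ>\<open>ennreal\<close> include \<open>p = \<infinity>\<close>.\<close>

text \<open>Only used with a positive exponent \<open>a\<close>, for which \<open>\<infinity>\<^sup>a = \<infinity>\<close>.\<close>

definition epowr :: "ennreal \<Rightarrow> real \<Rightarrow> ennreal" where
  "epowr x a = (if x = \<infinity> then \<infinity> else ennreal (enn2real x powr a))"

definition Lp_norm :: "'a measure \<Rightarrow> ennreal \<Rightarrow> ('a \<Rightarrow> complex) \<Rightarrow> ennreal" where
  "Lp_norm M p f =
     (if p = \<infinity> then esssup M (\<lambda>x. ennreal (norm (f x)))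
      else epowr (\<integral>\<^sup>+ x. epowr (ennreal (norm (f x))) (enn2real p) \<partial>M) (1 / enn2real p))"

text \<open>The non-increasing rearrangement \<open>f\<^sup>*(t) = inf {s \<ge> 0. \<mu>{f > s} \<le> t}\<close>, \<open>t \<ge> 0\<close>.\<close>

definition rearr :: "'a measure \<Rightarrow> ('a \<Rightarrow> ennreal) \<Rightarrow> real \<Rightarrow> ennreal" where
  "rearr M f t = Inf {s. emeasure M {x \<in> space M. s < f x} \<le> ennreal t}"

text \<open>For counting measure \<open>b\<^sup>*\<close> is constant on each interval \<open>[j - 1, j)\<close>; its value there is the
  \<open>j\<close>-th term of the rearranged sequence, numbered from \<open>j = 1\<close>.\<close>

definition seq_rearr :: "('i \<Rightarrow> ennreal) \<Rightarrow> nat \<Rightarrow> ennreal" where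
  "seq_rearr b j = rearr (count_space UNIV) b (real j - 1)"

abbreviation torus :: "real measure" where
  "torus \<equiv> lebesgue_on {-1/2..1/2}"

definition fourier_coeff :: "(real \<Rightarrow> complex) \<Rightarrow> int \<Rightarrow> complex" where
  "fourier_coeff f n = (\<integral>x. f x * exp (- 2 * of_real pi * \<i> * of_int n * of_real x) \<partial>torus)"

definition fun_rearr :: "(real \<Rightarrow> complex) \<Rightarrow> real \<Rightarrow> ennreal" where
  "fun_rearr f = rearr torus (\<lambda>x. ennreal (norm (f x)))"

definition max_rearr :: "(real \<Rightarrow> complex) \<Rightarrow> real \<Rightarrow> ennreal" where
  "max_rearr f t = ennreal (1 / t) * (\<integral>\<^sup>+ u \<in> {0<..<t}. fun_rearr f u \<partial>lborel)"

definition lorentz_norm :: "real \<Rightarrow> ennreal \<Rightarrow> (real \<Rightarrow> complex) \<Rightarrow> ennreal" where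
  "lorentz_norm r p f =
     (if p = \<infinity> then (SUP t \<in> {0<..<1}. ennreal (t powr (1 / r)) * max_rearr f t)
      else epowr
        (\<integral>\<^sup>+ t \<in> {0<..<1}.
           epowr (ennreal (t powr (1 / r)) * max_rearr f t) (enn2real p) * ennreal (1 / t) \<partial>lborel)
        (1 / enn2real p))"

text \<open>\<open>1 / p\<^sup>\<sharp> = \<bar>1/2 - 1/p\<bar>\<close>; note that \<open>1 / \<infinity> = 0\<close> in \<^typ>\<open>ennreal\<close>.\<close>

definition inv_sharp :: "ennreal \<Rightarrow> real" where
  "inv_sharp p = \<bar>1 / 2 - enn2real (1 / p)\<bar>"

definition weighted_Lp_norm :: "ennreal \<Rightarrow> (real \<Rightarrow> complex) \<Rightarrow> ennreal" where
  "weighted_Lp_norm p f = Lp_norm torus p (\<lambda>x. of_real (\<bar>x\<bar> powr inv_sharp p) * f x)"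

text \<open>The sum over \<open>n \<ge> 1\<close> is indexed by \<open>n = Suc m\<close>.\<close>

definition Theta_norm :: "ennreal \<Rightarrow> ('i \<Rightarrow> ennreal) \<Rightarrow> ennreal" where
  "Theta_norm p b =
     (if p = \<infinity> then
        (SUP n \<in> {1..}. ennreal (ln (real n + 1) powr (- 1 / 2)) *
                        epowr (\<Sum>j = 1..n. seq_rearr b j ^ 2) (1 / 2))
      else epowr
        (\<Sum>m. let n = Suc m in
           epowr (\<Sum>j = 1..n. seq_rearr b j ^ 2) (enn2real p / 2) *
           ennreal (1 / (real n * ln (real n + 1) powr (enn2real p / 2))))
        (1 / enn2real p))"

text \<open>Banach function norms in the sense of Bennett and Sharpley over a set with counting measure,
  defined on the cone of \<open>[0,\<infinity>]\<close>-valued sequences; the space itself consists of the complex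
  sequences \<open>b\<close> with \<open>\<rho> \<bar>b\<bar> < \<infinity>\<close>.\<close>

locale ri_sequence_norm =
  fixes \<rho> :: "('i \<Rightarrow> ennreal) \<Rightarrow> ennreal"
  assumes zero_iff: "\<rho> b = 0 \<longleftrightarrow> (\<forall>i. b i = 0)"
    and homogeneous: "c \<ge> 0 \<Longrightarrow> \<rho> (\<lambda>i. ennreal c * b i) = ennreal c * \<rho> b"
    and triangle: "\<rho> (\<lambda>i. b i + d i) \<le> \<rho> b + \<rho> d"
    and lattice: "(\<And>i. b i \<le> d i) \<Longrightarrow> \<rho> b \<le> \<rho> d"
    and Fatou: "(\<And>i. incseq (\<lambda>n. B n i)) \<Longrightarrow> \<rho> (\<lambda>i. SUP n. B n i) = (SUP n::nat. \<rho> (B n))"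
    and finite_indicator: "finite E \<Longrightarrow> \<rho> (indicator E) < \<infinity>"
    and local_l1: "finite E \<Longrightarrow> \<exists>C::real. \<forall>b. (\<Sum>i\<in>E. b i) \<le> ennreal C * \<rho> b"
    and rearrangement_invariant: "(\<And>j. j \<ge> 1 \<Longrightarrow> seq_rearr b j = seq_rearr d j) \<Longrightarrow> \<rho> b = \<rho> d"

definition fourier_bounded ::
    "((int \<Rightarrow> ennreal) \<Rightarrow> ennreal) \<Rightarrow> ((real \<Rightarrow> complex) \<Rightarrow> ennreal) \<Rightarrow> bool" where
  "fourier_bounded \<rho> N \<longleftrightarrow>
     (\<exists>C::real. C > 0 \<and> (\<forall>f. integrable torus f \<longrightarrow>
        \<rho> (\<lambda>n. ennreal (norm (fourier_coeff f n))) \<le> ennreal C * N f))"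

definition norm_dominated ::
    "((int \<Rightarrow> ennreal) \<Rightarrow> ennreal) \<Rightarrow> ((int \<Rightarrow> ennreal) \<Rightarrow> ennreal) \<Rightarrow> bool" where
  "norm_dominated \<rho> \<sigma> \<longleftrightarrow>
     (\<exists>C::real. C > 0 \<and> (\<forall>b::int \<Rightarrow> complex.
        \<rho> (\<lambda>n. ennreal (norm (b n))) \<le> ennreal C * \<sigma> (\<lambda>n. ennreal (norm (b n)))))"

end

theory Submission
  imports Defs "HOL-Probability.Probability_Measure"
begin

text \<open>
  Write \<open>N n b\<close> for the \<open>\<ell>\<^sup>2\<close> norm of the \<open>n\<close> largest terms of \<open>b\<close> (\<open>top_l2\<close> below). Since the weights
  \<open>1 / (n log\<^sup>p\<^sup>/\<^sup>2 n)\<close> have mass about \<open>m\<^sup>-\<^sup>p\<^sup>/\<^sup>2\<close> on the block \<open>2\<^sup>m \<le> n < 2\<^sup>m\<^sup>+\<^sup>1\<close> and \<open>N\<close> increases with \<open>n\<close>, the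
  Theta norm is comparable to the \<open>\<ell>\<^sup>p\<close> norm of the sequence \<open>N (2\<^sup>m) b / \<surd>(m + 1)\<close>
  (\<open>Theta_norm_le_dyadic\<close>, \<open>dyadic_le_Theta_norm\<close>). All estimates are made in this form, which treats
  \<open>p = \<infinity>\<close> and \<open>p < \<infinity>\<close> alike. As \<open>N n b\<close> is also the supremum of the \<open>\<ell>\<^sup>2\<close> norms of \<open>b\<close> over all sets of
  \<open>n\<close> indices, the Theta norm inherits the axioms of a rearrangement-invariant norm from \<open>\<ell>\<^sup>2\<close> and \<open>\<ell>\<^sup>p\<close>.
  The equivalence is a cycle (iii) \<open>\<Longrightarrow>\<close> (ii) \<open>\<Longrightarrow>\<close> (i) \<open>\<Longrightarrow>\<close> (iii); minimality of the Theta space is the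
  implication from (ii) to (iii).

  For (iii) \<open>\<Longrightarrow>\<close> (ii) one bounds the Theta norm of the coefficients by the Lorentz norm
  (\<open>fourier_bounded_Theta\<close>). Split \<open>f\<close> at the height \<open>f\<^sup>*(2\<^sup>-\<^sup>m)\<close>; Bessel's inequality for the low part and the
  trivial \<open>L\<^sup>1\<close> bound for the high part give
  \<open>N (2\<^sup>m) f\<^sup>^ \<le> C (a\<^sub>0\<^sup>2 + \<dots> + a\<^sub>m\<^sup>2)\<^sup>1\<^sup>/\<^sup>2\<close> with \<open>a\<^sub>i = 2\<^sup>-\<^sup>i\<^sup>/\<^sup>2 f\<^sup>*\<^sup>*(2\<^sup>-\<^sup>i)\<close>. The \<open>\<ell>\<^sup>p\<close> norm of \<open>a\<close> is at most a multiple of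
  the Lorentz norm, and Hardy's inequality with exponent \<open>p / 2 > 1\<close> removes the averages.

  For (ii) \<open>\<Longrightarrow>\<close> (i) the Lorentz norm is bounded by the weighted norm (\<open>lorentz_le_weighted\<close>): \<open>\<bar>f\<bar>\<close> is compared
  with the threshold \<open>\<kappa> min(\<bar>x\<bar>, t)\<^sup>-\<^sup>1\<^sup>/\<^sup>2\<close>, the constant \<open>\<kappa>\<close> is optimised for each \<open>t\<close>, and the resulting
  pointwise bound for \<open>t\<^sup>1\<^sup>/\<^sup>2 f\<^sup>*\<^sup>*(t)\<close> is integrated in \<open>t\<close> with Tonelli's theorem.

  For (i) \<open>\<Longrightarrow>\<close> (iii) one needs functions of small weighted norm with many large coefficients
  (\<open>ri_norm_le_Theta_norm\<close>). Let \<open>\<bar>f\<bar> = (2\<^sup>l v\<^sub>l)\<^sup>1\<^sup>/\<^sup>2\<close> on the annulus \<open>2\<^sup>-\<^sup>l\<^sup>-\<^sup>1 \<le> x < 2\<^sup>-\<^sup>l\<close>, and give \<open>f\<close> arbitrary signs on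
  cells of length about \<open>16\<^sup>-\<^sup>\<phi>\<^sup>(\<^sup>l\<^sup>)\<close>. The weighted norm does not see the signs and is at most the \<open>\<ell>\<^sup>p\<close> norm of
  \<open>v\<^sub>l\<^sup>1\<^sup>/\<^sup>2\<close>. Averaged over all signs, \<open>\<bar>f\<^sup>^(n)\<bar>\<close> is by Khinchin's inequality at least a multiple of
  \<open>(16\<^sup>-\<^sup>m v)\<^sup>1\<^sup>/\<^sup>2\<close> for \<open>\<bar>n\<bar> < 16\<^sup>m\<^sup>+\<^sup>1\<close>, where \<open>v\<close> is the sum of the \<open>v\<^sub>l\<close> with \<open>\<phi>(l) = m\<close>. An average suffices, because
  the norm of \<open>X\<close> obeys the triangle inequality, so no single choice of signs has to be good for all \<open>n\<close>.
  It remains to distribute the energies \<open>d\<^sub>m = 16\<^sup>m (b\<^sup>*(16\<^sup>m))\<^sup>2\<close> to annuli \<open>l \<le> 4 m + 3\<close> such that \<open>v\<^sub>l\<close> is at most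
  a multiple of the average \<open>(d\<^sub>0 + \<dots> + d\<^sub>l\<^sub>-\<^sub>1) / l\<close>; this combinatorial step is \<open>energy_transport\<close>.
  Rearrangement invariance and the Fatou property reduce the general \<open>b\<close> to truncations of \<open>b\<^sup>*\<close>.
\<close>

section \<open>Powers of extended non-negative reals\<close>

lemma epowr_ennreal: "0 \<le> x \<Longrightarrow> epowr (ennreal x) a = ennreal (x powr a)"
  by (simp add: epowr_def)

lemma epowr_top [simp]: "epowr top a = top"
  by (simp add: epowr_def)

lemma epowr_0 [simp]: "epowr 0 a = 0"
  by (simp add: epowr_def)

lemma epowr_mono: "0 \<le> a \<Longrightarrow> x \<le> y \<Longrightarrow> epowr x a \<le> epowr y a"
  by (cases x; cases y) (auto simp: epowr_ennreal top_unique intro!: ennreal_leI powr_mono2)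

lemma epowr_mult: "epowr (x * y) a = epowr x a * epowr y a" if "0 < a"
proof (cases x; cases y)
  fix r s assume "x = ennreal r" "0 \<le> r" "y = ennreal s" "0 \<le> s"
  then show ?thesis
    by (simp add: epowr_ennreal powr_mult flip: ennreal_mult)
qed (use that in \<open>auto simp: epowr_ennreal ennreal_mult_top ennreal_top_mult\<close>)

lemma epowr_epowr: "epowr (epowr x a) b = epowr x (a * b)"
  by (cases x) (auto simp: epowr_ennreal powr_powr)

lemma epowr_1 [simp]: "epowr x 1 = x"
  by (cases x) (auto simp: epowr_ennreal)

lemma epowr_2: "epowr x 2 = x ^ 2"
  by (cases x) (auto simp: epowr_ennreal ennreal_power)

lemma epowr_half_square [simp]: "(epowr x (1 / 2))\<^sup>2 = x"
  using epowr_epowr[of x "1/2" 2] by (simp add: epowr_2)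

lemma epowr_square_half [simp]: "epowr (x\<^sup>2) (1 / 2) = x"
  using epowr_epowr[of x 2 "1/2"] by (simp add: epowr_2)

lemma epowr_eq_0_iff [simp]: "epowr x a = 0 \<longleftrightarrow> x = 0"
  by (cases x) (auto simp: epowr_ennreal)

text \<open>Raising to a positive power is an order isomorphism of \<open>[0,\<infinity>]\<close>, and this adjunction lets it commute with all suprema.\<close>

lemma epowr_le_iff: "0 < a \<Longrightarrow> epowr x a \<le> y \<longleftrightarrow> x \<le> epowr y (1 / a)"
  using epowr_mono[of "1/a" "epowr x a" y] epowr_mono[of a x "epowr y (1/a)"]
  by (auto simp: epowr_epowr)

lemma epowr_SUP: "0 < a \<Longrightarrow> epowr (SUP i\<in>I. f i) a = (SUP i\<in>I. epowr (f i) a)"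
proof (rule antisym)
  assume a: "0 < a"
  show "epowr (SUP i\<in>I. f i) a \<le> (SUP i\<in>I. epowr (f i) a)"
    unfolding epowr_le_iff[OF a]
    by (rule SUP_least) (auto simp flip: epowr_le_iff[OF a] intro: SUP_upper)
qed (auto intro!: SUP_least epowr_mono SUP_upper)

lemma epowr_measurable [measurable]: "(\<lambda>x. epowr x a) \<in> borel_measurable borel"
  unfolding epowr_def by measurable

section \<open>Norms of p-th power summable sequences\<close>

definition seq_norm :: "ennreal \<Rightarrow> (nat \<Rightarrow> ennreal) \<Rightarrow> ennreal" where
  "seq_norm p a =
     (if p = \<infinity> then (SUP i. a i)
      else epowr (\<Sum>i. epowr (a i) (enn2real p)) (1 / enn2real p))"

lemma enn2real_gt_2: "2 < p \<Longrightarrow> p \<noteq> \<infinity> \<Longrightarrow> 2 < enn2real p"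
  by (cases p) auto

lemma seq_norm_mono: "(\<And>i. a i \<le> b i) \<Longrightarrow> seq_norm p a \<le> seq_norm p b"
  unfolding seq_norm_def
  by (auto intro!: SUP_mono' epowr_mono suminf_le)

lemma seq_norm_eq_0_iff: "seq_norm p a = 0 \<longleftrightarrow> (\<forall>i. a i = 0)"
proof -
  have "(\<Sum>i. f i) = 0 \<longleftrightarrow> (\<forall>i. f i = 0)" for f :: "nat \<Rightarrow> ennreal"
    using suminf_eq_zero_iff[of f] by (auto)
  moreover have "(SUP i. a i) = 0 \<longleftrightarrow> (\<forall>i. a i = 0)"
    using SUP_bot_conv(1)[of a UNIV] by (auto simp: bot_ennreal)
  ultimately show ?thesis
    by (auto simp: seq_norm_def)
qed

lemma seq_norm_cmult:
  assumes "2 < p" shows "seq_norm p (\<lambda>i. c * a i) = c * seq_norm p a"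
proof (cases "p = \<infinity>")
  case False
  then have "2 < enn2real p" using assms by (rule enn2real_gt_2[rotated])
  then show ?thesis using False
    by (simp add: seq_norm_def epowr_mult epowr_epowr)
qed (simp add: seq_norm_def SUP_mult_left_ennreal)

lemma seq_norm_SUP:
  fixes B :: "nat \<Rightarrow> nat \<Rightarrow> ennreal"
  assumes p: "2 < p" and inc: "\<And>i. incseq (\<lambda>n. B n i)"
  shows "seq_norm p (\<lambda>i. SUP n. B n i) = (SUP n. seq_norm p (B n))"
proof (cases "p = \<infinity>")
  case True
  then show ?thesis by (simp add: seq_norm_def) (rule SUP_commute)
next
  case False
  then have *: "2 < enn2real p" using p by (rule enn2real_gt_2[rotated])
  have "(\<Sum>i. SUP n. epowr (B n i) (enn2real p)) = (SUP n. \<Sum>i. epowr (B n i) (enn2real p))"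
    by (rule ennreal_suminf_SUP_eq)
      (use * inc in \<open>auto simp: incseq_def intro!: epowr_mono\<close>)
  with False * show ?thesis
    by (simp add: seq_norm_def epowr_SUP)
qed

lemma seq_norm_upper: "2 < p \<Longrightarrow> a i \<le> seq_norm p a"
proof (cases "p = \<infinity>")
  case False
  assume "2 < p"
  then have *: "2 < enn2real p" using False by (rule enn2real_gt_2)
  have "epowr (a i) (enn2real p) \<le> (\<Sum>i. epowr (a i) (enn2real p))"
    using sum_le_suminf[of "\<lambda>i. epowr (a i) (enn2real p)" "{i}"] by simp
  then show ?thesis using False * epowr_le_iff[of "enn2real p" "a i"]
    by (simp add: seq_norm_def)
qed (auto simp: seq_norm_def intro: SUP_upper)

text \<open>The map \<open>g\<close> selects distinct terms of \<open>z\<close>; terms of \<open>c\<close> outside \<open>S\<close> vanish. Used for shifts and for sampling every fourth term.\<close>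

lemma seq_norm_subsequence_le:
  assumes p: "2 < p" and inj: "inj_on g S"
    and le: "\<And>l. l \<in> S \<Longrightarrow> c l \<le> z (g l)" and zero: "\<And>l. l \<notin> S \<Longrightarrow> c l = 0"
  shows "seq_norm p c \<le> seq_norm p z"
proof (cases "p = \<infinity>")
  case True
  have "c l \<le> (SUP i. z i)" for l
  proof (cases "l \<in> S")
    case True
    then show ?thesis by (rule order_trans[OF le]) (rule SUP_upper, simp)
  qed (simp add: zero)
  then show ?thesis using True by (auto simp: seq_norm_def intro!: SUP_least)
next
  case False
  let ?q = "enn2real p"
  have q: "2 < ?q" using enn2real_gt_2[OF p False] .
  have "(\<Sum>l<n. epowr (c l) ?q) \<le> (\<Sum>i. epowr (z i) ?q)" for n
  proof -
    have "(\<Sum>l<n. epowr (c l) ?q) = (\<Sum>l\<in>{..<n} \<inter> S. epowr (c l) ?q)"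
      by (rule sum.mono_neutral_right) (auto simp: zero)
    also have "\<dots> \<le> (\<Sum>l\<in>{..<n} \<inter> S. epowr (z (g l)) ?q)"
      using q by (intro sum_mono epowr_mono le) auto
    also have "\<dots> = (\<Sum>i\<in>g ` ({..<n} \<inter> S). epowr (z i) ?q)"
      using inj by (subst sum.reindex) (auto intro: inj_on_subset)
    also have "\<dots> \<le> (\<Sum>i. epowr (z i) ?q)" by (rule sum_le_suminf) auto
    finally show ?thesis .
  qed
  then have "(\<Sum>l. epowr (c l) ?q) \<le> (\<Sum>i. epowr (z i) ?q)" by (intro suminf_le_const) auto
  then show ?thesis using False q by (auto simp: seq_norm_def intro!: epowr_mono)
qed

text \<open>Minkowski's inequality in the form that avoids dividing by norms that may vanish: the norms are
  replaced by positive upper bounds \<open>a\<close> and \<open>b\<close>, and convexity is applied to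
  \<open>(x + y) / (a + b) = a / (a + b) \<cdot> x / a + b / (a + b) \<cdot> y / b\<close>.\<close>

lemma sum_powr_add_le:
  fixes x y :: "nat \<Rightarrow> real"
  assumes p: "1 \<le> p" and nonneg: "\<And>i. 0 \<le> x i" "\<And>i. 0 \<le> y i" and ab: "0 < a" "0 < b"
    and x: "(\<Sum>i<n. x i powr p) \<le> a powr p" and y: "(\<Sum>i<n. y i powr p) \<le> b powr p"
  shows "(\<Sum>i<n. (x i + y i) powr p) \<le> (a + b) powr p"
proof -
  let ?s = "a / (a + b)" and ?t = "b / (a + b)"
  have st: "0 \<le> ?s" "0 \<le> ?t" "?s + ?t = 1"
    using ab by (simp_all flip: add_divide_distrib)
  then have st: "1 - ?t = ?s" "?s + ?t = 1" "0 \<le> ?s" "0 \<le> ?t" by linarith+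
  have convex: "(r * u + t * v) powr p \<le> r * u powr p + t * v powr p"
    if rt: "1 - t = r" "0 \<le> r" "0 \<le> t" "0 \<le> u" "0 \<le> v" for r t u v :: real
  proof -
    have shrink: "(r * u) powr p \<le> r * u powr p" if "0 \<le> r" "r \<le> 1" "0 \<le> u" for r u :: real
      using mult_right_mono[of "r powr p" r "u powr p"] powr_mono'[of 1 p r] that p
      by (simp add: powr_mult)
    consider "u = 0" | "v = 0" | "0 < u" "0 < v" using rt by linarith
    then show ?thesis
    proof cases
      case 3
      then show ?thesis using convex_onD[OF powr_convex[OF p], of t u v] rt by simp
    qed (use shrink[of r u] shrink[of t v] rt in simp_all)
  qed
  have "((x i + y i) / (a + b)) powr p \<le> ?s * (x i / a) powr p + ?t * (y i / b) powr p" for i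
  proof -
    have eq: "(x i + y i) / (a + b) = ?s * (x i / a) + ?t * (y i / b)"
      using ab by (simp add: add_divide_distrib)
    show ?thesis unfolding eq
      by (rule convex) (use st nonneg ab in \<open>auto intro: divide_nonneg_pos\<close>)
  qed
  then have "(\<Sum>i<n. ((x i + y i) / (a + b)) powr p)
      \<le> (\<Sum>i<n. ?s * (x i / a) powr p + ?t * (y i / b) powr p)"
    by (rule sum_mono)
  also have "\<dots> = ?s * ((\<Sum>i<n. x i powr p) / a powr p) + ?t * ((\<Sum>i<n. y i powr p) / b powr p)"
    using ab nonneg by (simp add: sum.distrib powr_divide flip: sum_distrib_left sum_divide_distrib)
  also have "\<dots> \<le> ?s * 1 + ?t * 1"
    by (intro add_mono mult_left_mono) (use ab x y in \<open>auto simp: divide_le_eq_1\<close>)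
  finally have "(\<Sum>i<n. ((x i + y i) / (a + b)) powr p) \<le> 1" using st by simp
  moreover have "(\<Sum>i<n. ((x i + y i) / (a + b)) powr p) = (\<Sum>i<n. (x i + y i) powr p) / (a + b) powr p"
    unfolding sum_divide_distrib by (rule sum.cong) (use ab nonneg in \<open>auto simp: powr_divide\<close>)
  moreover have "0 < (a + b) powr p" using ab by simp
  ultimately show ?thesis
    by (metis divide_le_eq_1_pos)
qed

lemma seq_norm_triangle:
  assumes "2 < p" shows "seq_norm p (\<lambda>i. a i + b i) \<le> seq_norm p a + seq_norm p b"
proof (cases "p = \<infinity>")
  case True
  then show ?thesis
    by (auto simp: seq_norm_def intro!: SUP_least add_mono SUP_upper)
next
  case False
  then have p: "2 < enn2real p" using assms by (rule enn2real_gt_2[rotated])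
  let ?p = "enn2real p"
  have "seq_norm p (\<lambda>i. a i + b i) \<le> seq_norm p a + seq_norm p b"
    if fin: "seq_norm p a < top" "seq_norm p b < top"
  proof (rule ennreal_le_epsilon)
    fix e :: real assume e: "0 < e"
    define x where "x i = enn2real (a i)" for i
    define y where "y i = enn2real (b i)" for i
    have real: "c i = ennreal (enn2real (c i))" if "seq_norm p c < top" for c i
      using le_less_trans[OF seq_norm_upper[OF assms, of c i] that] by simp
    have x: "a i = ennreal (x i)" and y: "b i = ennreal (y i)" for i
      unfolding x_def y_def by (rule real[OF fin(1)], rule real[OF fin(2)])
    have xy0: "0 \<le> x i" "0 \<le> y i" for i by (simp_all add: x_def y_def)
    define A where "A = enn2real (seq_norm p a) + e / 2"
    define B where "B = enn2real (seq_norm p b) + e / 2"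
    have AB: "0 < A" "0 < B" "seq_norm p a \<le> ennreal A" "seq_norm p b \<le> ennreal B"
      using e fin by (auto simp: A_def B_def add_nonneg_pos less_top_ennreal)
    have bound: "(\<Sum>i<n. z i powr ?p) \<le> C powr ?p"
      if "\<And>i. c i = ennreal (z i)" "\<And>i. 0 \<le> z i" "seq_norm p c \<le> ennreal C" "0 < C" for c z C n
    proof -
      have "ennreal (\<Sum>i<n. z i powr ?p) = (\<Sum>i<n. epowr (c i) ?p)"
        using that by (simp add: epowr_ennreal)
      also have "\<dots> \<le> (\<Sum>i. epowr (c i) ?p)"
        by (rule sum_le_suminf) auto
      also have "\<dots> \<le> epowr (ennreal C) ?p"
        using that(3) False p epowr_le_iff[of "1/?p"] by (simp add: seq_norm_def)
      also have "\<dots> = ennreal (C powr ?p)" using that by (simp add: epowr_ennreal)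
      finally show ?thesis by (simp)
    qed
    have "(\<Sum>i<n. epowr (a i + b i) ?p) \<le> ennreal ((A + B) powr ?p)" for n
    proof -
      have "(\<Sum>i<n. epowr (a i + b i) ?p) = ennreal (\<Sum>i<n. (x i + y i) powr ?p)"
        using xy0 by (simp add: x y epowr_ennreal flip: ennreal_plus)
      also have "\<dots> \<le> ennreal ((A + B) powr ?p)"
        by (intro ennreal_leI sum_powr_add_le bound[of a x] bound[of b y])
          (use p AB xy0 x y in auto)
      finally show ?thesis .
    qed
    then have "(\<Sum>i. epowr (a i + b i) ?p) \<le> ennreal ((A + B) powr ?p)"
      by (intro suminf_le_const) auto
    then have "seq_norm p (\<lambda>i. a i + b i) \<le> ennreal (A + B)"
      using p AB False
      by (simp add: seq_norm_def epowr_le_iff epowr_ennreal powr_powr del: ennreal_plus)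
    also have "\<dots> = seq_norm p a + seq_norm p b + ennreal e"
      using fin e by (simp add: A_def B_def ennreal_plus add_ac)
    finally show "seq_norm p (\<lambda>i. a i + b i) \<le> seq_norm p a + seq_norm p b + ennreal e" .
  qed
  then show ?thesis
    by (cases "seq_norm p a = top \<or> seq_norm p b = top") (auto simp: less_top)
qed

section \<open>Rearrangements\<close>

text \<open>The distribution function \<open>s \<mapsto> \<mu>{f > s}\<close> is right-continuous, so the infimum in the definition of
  the rearrangement is attained. Every property of rearrangements used below is read off from this
  equivalence.\<close>

lemma less_rearr_iff:
  assumes f [measurable]: "f \<in> borel_measurable M"
  shows "s < rearr M f t \<longleftrightarrow> ennreal t < emeasure M {x \<in> space M. s < f x}"
proof -
  let ?D = "\<lambda>s. emeasure M {x \<in> space M. s < f x}"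
  have anti: "?D r \<le> ?D s" if "s \<le> r" for r s
    using that by (intro emeasure_mono) (auto intro: le_less_trans)
  have "rearr M f t \<le> s \<longleftrightarrow> ?D s \<le> ennreal t"
  proof
    assume *: "rearr M f t \<le> s"
    show "?D s \<le> ennreal t"
    proof (cases "s = top")
      case False
      have less: "s < s + ennreal (1 / real (Suc k))" for k
        using False ennreal_add_left_cancel_less[of s 0] by simp
      have D: "?D (s + ennreal (1 / real (Suc k))) \<le> ennreal t" for k
      proof -
        obtain r where "?D r \<le> ennreal t" "r < s + ennreal (1 / real (Suc k))"
          using le_less_trans[OF * less[of k]] unfolding rearr_def Inf_less_iff by auto
        then show ?thesis using anti[of r "s + ennreal (1 / real (Suc k))"] by (auto intro: order_trans less_imp_le)
      qed
      have eq: "{x \<in> space M. s < f x}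
          = (\<Union>k. {x \<in> space M. s + ennreal (1 / real (Suc k)) < f x})" (is "_ = (\<Union>k. ?A k)")
      proof (safe)
        fix x assume x: "x \<in> space M" "s < f x"
        have "(\<lambda>k. s + ennreal (1 / real (Suc k))) \<longlonglongrightarrow> s + ennreal 0"
          by (intro tendsto_add tendsto_const tendsto_ennrealI LIMSEQ_Suc[OF lim_1_over_n])
        then have "eventually (\<lambda>k. s + ennreal (1 / real (Suc k)) < f x) sequentially"
          using x by (intro order_tendstoD(2)) auto
        then show "x \<in> (\<Union>k. ?A k)"
          using x by (auto simp: eventually_sequentially)
      next
        fix x k assume "s + ennreal (1 / real (Suc k)) < f x"
        then show "s < f x" using less[of k] by (rule less_trans[rotated])
      qed
      have "incseq ?A"
        unfolding incseq_def
        by (auto intro!: add_left_mono ennreal_leI frac_le elim!: le_less_trans[rotated])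
      then have "?D s = (SUP k. emeasure M (?A k))"
        unfolding eq by (intro SUP_emeasure_incseq[symmetric]) auto
      with D show ?thesis by (auto intro: SUP_least)
    qed simp
  next
    assume "?D s \<le> ennreal t"
    then show "rearr M f t \<le> s" unfolding rearr_def by (intro Inf_lower) auto
  qed
  then show ?thesis by (simp add: not_le[symmetric])
qed

lemma less_seq_rearr_iff:
  assumes "1 \<le> j"
  shows "s < seq_rearr b j \<longleftrightarrow> (\<exists>E. finite E \<and> card E = j \<and> (\<forall>i\<in>E. s < b i))"
proof -
  have "s < seq_rearr b j \<longleftrightarrow> ennreal (real j - 1) < emeasure (count_space UNIV) {i. s < b i}"
    unfolding seq_rearr_def by (subst less_rearr_iff) auto
  also have "ennreal (real j - 1) = of_nat (j - 1)"
    using assms by (simp add: ennreal_of_nat_eq_real_of_nat of_nat_diff)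
  also have "of_nat (j - 1) < emeasure (count_space UNIV) {i. s < b i}
      \<longleftrightarrow> (infinite {i. s < b i} \<or> j \<le> card {i. s < b i})"
    using assms by (cases "finite {i. s < b i}") (auto simp: of_nat_less_top)
  also have "\<dots> \<longleftrightarrow> (\<exists>E. finite E \<and> card E = j \<and> (\<forall>i\<in>E. s < b i))"
  proof
    assume "infinite {i. s < b i} \<or> j \<le> card {i. s < b i}"
    then obtain E where "finite E" "card E = j" "E \<subseteq> {i. s < b i}"
      by (metis infinite_arbitrarily_large obtain_subset_with_card_n)
    then show "\<exists>E. finite E \<and> card E = j \<and> (\<forall>i\<in>E. s < b i)" by auto
  next
    assume "\<exists>E. finite E \<and> card E = j \<and> (\<forall>i\<in>E. s < b i)"
    then obtain E where "finite E" "card E = j" "E \<subseteq> {i. s < b i}" by auto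
    then show "infinite {i. s < b i} \<or> j \<le> card {i. s < b i}"
      by (metis card_mono)
  qed
  finally show ?thesis .
qed

lemma seq_rearr_antimono: "1 \<le> i \<Longrightarrow> i \<le> j \<Longrightarrow> seq_rearr b j \<le> seq_rearr b i"
  unfolding seq_rearr_def rearr_def
  by (intro Inf_superset_mono) (auto intro: order_trans ennreal_leI)

text \<open>Induction on the size of \<open>E\<close>: the smallest of \<open>k\<close> terms is at most the \<open>k\<close>-th term of the
  rearrangement, and the others are handled by the induction hypothesis.\<close>

lemma sum_le_sum_seq_rearr:
  assumes "finite E" "card E \<le> n"
  shows "(\<Sum>i\<in>E. (b i)\<^sup>2) \<le> (\<Sum>j=1..n. (seq_rearr b j)\<^sup>2)"
proof -
  have "(\<Sum>i\<in>E. (b i)\<^sup>2) \<le> (\<Sum>j=1..card E. (seq_rearr b j)\<^sup>2)"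
    using assms(1)
  proof (induction "card E" arbitrary: E)
    case (Suc k)
    then have "E \<noteq> {}" by auto
    then have "Min (b ` E) \<in> b ` E"
      using Suc.prems by (intro Min_in) auto
    then obtain e where e: "e \<in> E" "b e = Min (b ` E)" by auto
    then have least: "b e \<le> b i" if "i \<in> E" for i
      using that Suc.prems e(2) by simp
    have "b e \<le> seq_rearr b (Suc k)"
    proof (rule ccontr)
      assume "\<not> b e \<le> seq_rearr b (Suc k)"
      then have "\<forall>i\<in>E. seq_rearr b (Suc k) < b i" using least by (meson not_le less_le_trans)
      then have "seq_rearr b (Suc k) < seq_rearr b (Suc k)"
        using less_seq_rearr_iff[of "Suc k"] Suc by force
      then show False by simp
    qed
    moreover have "card (E - {e}) = k" using Suc e by simp
    then have "(\<Sum>i\<in>E - {e}. (b i)\<^sup>2) \<le> (\<Sum>j=1..k. (seq_rearr b j)\<^sup>2)"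
      using Suc.hyps(1)[of "E - {e}"] Suc.prems by simp
    ultimately have "(b e)\<^sup>2 + (\<Sum>i\<in>E - {e}. (b i)\<^sup>2) \<le> (seq_rearr b (Suc k))\<^sup>2 + (\<Sum>j=1..k. (seq_rearr b j)\<^sup>2)"
      by (intro add_mono power_mono_ennreal)
    moreover have "(\<Sum>i\<in>E. (b i)\<^sup>2) = (b e)\<^sup>2 + (\<Sum>i\<in>E - {e}. (b i)\<^sup>2)"
      using Suc.prems e by (intro sum.remove) auto
    ultimately show ?case
      by (simp add: Suc.hyps(2)[symmetric] add.commute)
  qed simp
  also have "\<dots> \<le> (\<Sum>j=1..n. (seq_rearr b j)\<^sup>2)"
    using assms by (intro sum_mono2) auto
  finally show ?thesis .
qed

text \<open>The terms of the rearrangement need not be values of \<open>b\<close>, for instance when the supremum is not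
  attained. Anything strictly below them is exceeded by values of \<open>b\<close>, at indices that can be chosen
  distinct one after the other, since at the \<open>j\<close>-th step there are at least \<open>j\<close> candidates.\<close>

lemma sum_below_seq_rearr_realised:
  assumes "\<And>j. j \<in> {1..n} \<Longrightarrow> c j = 0 \<or> c j < seq_rearr b j"
  obtains E where "finite E" "card E \<le> n" "(\<Sum>j=1..n. (c j)\<^sup>2) \<le> (\<Sum>i\<in>E. (b i)\<^sup>2)"
  using assms
proof (induction n arbitrary: thesis)
  case 0
  show ?case by (rule 0(1)[of "{}"]) auto
next
  case (Suc n)
  obtain E where E: "finite E" "card E \<le> n" "(\<Sum>j=1..n. (c j)\<^sup>2) \<le> (\<Sum>i\<in>E. (b i)\<^sup>2)"
    using Suc.IH Suc.prems(2) by (metis atLeastAtMost_iff le_SucI)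
  show ?case
  proof (cases "c (Suc n) = 0")
    case True
    with E show ?thesis by (intro Suc.prems(1)[of E]) auto
  next
    case False
    then have "c (Suc n) < seq_rearr b (Suc n)" using Suc.prems(2)[of "Suc n"] by simp
    then obtain F where F: "finite F" "card F = Suc n" "\<forall>i\<in>F. c (Suc n) < b i"
      unfolding less_seq_rearr_iff[of "Suc n", simplified] by auto
    then have "\<not> F \<subseteq> E" using E card_mono[of E F] by auto
    then obtain i where i: "i \<in> F" "i \<notin> E" by auto
    then have "(c (Suc n))\<^sup>2 \<le> (b i)\<^sup>2"
      using F by (intro power_mono_ennreal less_imp_le) auto
    then have "(c (Suc n))\<^sup>2 + (\<Sum>j=1..n. (c j)\<^sup>2) \<le> (b i)\<^sup>2 + (\<Sum>i\<in>E. (b i)\<^sup>2)"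
      using E by (intro add_mono)
    with E i show ?thesis
      by (intro Suc.prems(1)[of "insert i E"]) (auto simp: add.commute)
  qed
qed

text \<open>This formula makes the square sum of the largest terms accessible to the triangle inequality,
  which is not visible from the rearrangement.\<close>

lemma sum_seq_rearr_eq_SUP:
  "(\<Sum>j=1..n. (seq_rearr b j)\<^sup>2) = (SUP E\<in>{E. finite E \<and> card E \<le> n}. \<Sum>i\<in>E. (b i)\<^sup>2)"
    (is "?S = ?R")
proof (rule antisym)
  have realised: "(\<Sum>j=1..n. (c j)\<^sup>2) \<le> ?R"
    if "\<And>j. j \<in> {1..n} \<Longrightarrow> c j = 0 \<or> c j < seq_rearr b j" for c
    by (rule sum_below_seq_rearr_realised[OF that]) (auto intro: SUP_upper2)
  show "?S \<le> ?R"
  proof (cases "\<exists>j\<in>{1..n}. seq_rearr b j = top")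
    case True
    then obtain j where j: "j \<in> {1..n}" "seq_rearr b j = top" by auto
    have "of_nat k \<le> ?R" for k
    proof -
      have "(of_nat k :: ennreal) \<le> (of_nat k)\<^sup>2"
        by (cases k) (auto simp: power2_eq_square simp flip: of_nat_mult of_nat_Suc)
      also have "\<dots> = (\<Sum>i=1..n. (if i = j then of_nat k else 0)\<^sup>2)"
        using j by (simp add: if_distrib[of "\<lambda>x. x\<^sup>2"] cong: if_cong)
      also have "\<dots> \<le> ?R"
        using j by (intro realised) (auto simp: of_nat_less_top)
      finally show ?thesis .
    qed
    then have "?R = top"
      using SUP_least[of UNIV of_nat ?R] by (simp add: ennreal_SUP_of_nat_eq_top top_unique)
    then show ?thesis by (metis top_greatest)
  next
    case False
    show ?thesis
    proof (cases "?R")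
      case R: (real q)
      define r where "r j = enn2real (seq_rearr b j)" for j
      have r: "seq_rearr b j = ennreal (r j)" "0 \<le> r j" if "j \<in> {1..n}" for j
        using False that by (auto simp: r_def less_top)
      have "(\<Sum>j=1..n. (r j)\<^sup>2) \<le> q"
      proof (rule field_le_mult_one_interval)
        \<comment> \<open>Scaling by the factor \<open>\<surd>z < 1\<close> pushes all terms strictly below the rearrangement, where they are realised.\<close>
        fix z :: real assume z: "0 < z" "z < 1"
        have sz: "sqrt z < 1" using z by simp
        have "ennreal (\<Sum>j=1..n. (sqrt z * r j)\<^sup>2) = (\<Sum>j=1..n. (ennreal (sqrt z * r j))\<^sup>2)"
          using z r by (subst sum_ennreal[symmetric]) (auto simp: ennreal_power)
        also have "\<dots> \<le> ?R"
        proof (rule realised)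
          fix j assume j: "j \<in> {1..n}"
          have "r j = 0 \<or> sqrt z * r j < 1 * r j"
            using r(2)[OF j] sz by (auto simp: less_le)
          with z j show "ennreal (sqrt z * r j) = 0 \<or> ennreal (sqrt z * r j) < seq_rearr b j"
            using r[OF j] by (auto simp: ennreal_less_iff)
        qed
        finally have "(\<Sum>j=1..n. (sqrt z * r j)\<^sup>2) \<le> q"
          unfolding R(2) ennreal_le_iff[OF R(1)] .
        then show "z * (\<Sum>j=1..n. (r j)\<^sup>2) \<le> q"
          using z by (simp add: power_mult_distrib sum_distrib_left)
      qed
      then have "ennreal (\<Sum>j=1..n. (r j)\<^sup>2) \<le> ?R"
        unfolding R(2) by (rule ennreal_leI)
      also have "ennreal (\<Sum>j=1..n. (r j)\<^sup>2) = ?S"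
        using r by (simp add: sum_ennreal[symmetric] ennreal_power del: sum_ennreal)
      finally show ?thesis .
    next
      case top
      show ?thesis unfolding top by simp
    qed
  qed
  show "?R \<le> ?S" by (intro SUP_least sum_le_sum_seq_rearr) auto
qed

section \<open>The square sum of the largest terms\<close>

definition top_l2 :: "nat \<Rightarrow> ('i \<Rightarrow> ennreal) \<Rightarrow> ennreal" where
  "top_l2 n b = epowr (\<Sum>j=1..n. (seq_rearr b j)\<^sup>2) (1 / 2)"

abbreviation l2 :: "'i set \<Rightarrow> ('i \<Rightarrow> ennreal) \<Rightarrow> ennreal" where
  "l2 E b \<equiv> epowr (\<Sum>i\<in>E. (b i)\<^sup>2) (1 / 2)"

lemma top_l2_eq_SUP: "top_l2 n b = (SUP E\<in>{E. finite E \<and> card E \<le> n}. l2 E b)"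
  unfolding top_l2_def sum_seq_rearr_eq_SUP by (rule epowr_SUP) simp

lemma top_l2_mono: "(\<And>i. b i \<le> d i) \<Longrightarrow> top_l2 n b \<le> top_l2 n d"
  unfolding top_l2_eq_SUP by (intro SUP_mono' epowr_mono sum_mono power_mono_ennreal) auto

lemma top_l2_mono_n: "m \<le> n \<Longrightarrow> top_l2 m b \<le> top_l2 n b"
  unfolding top_l2_def by (intro epowr_mono sum_mono2) auto

lemma le_top_l2_1: "b i \<le> top_l2 1 b"
proof -
  have "l2 {i} b \<le> top_l2 1 b"
    unfolding top_l2_eq_SUP by (intro SUP_upper) auto
  then show ?thesis by simp
qed

lemma top_l2_indicator_le: 
  fixes E :: "'i set"
  assumes "finite E" shows "top_l2 n (indicator E) \<le> ennreal (sqrt (real (card E)))"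
  unfolding top_l2_eq_SUP
proof (rule SUP_least)
  fix F :: "'i set" assume "F \<in> {F. finite F \<and> card F \<le> n}"
  then have F: "finite F" by simp
  have "(\<Sum>i\<in>F. (indicator E i)\<^sup>2) = (\<Sum>i\<in>F. if i \<in> E then 1 else (0::ennreal))"
    by (rule sum.cong) (auto simp: indicator_def)
  also have "\<dots> = of_nat (card (F \<inter> E))"
    using F by (simp flip: sum.inter_restrict)
  also have "\<dots> \<le> of_nat (card E)"
    using assms by (intro of_nat_mono card_mono) auto
  finally have "l2 F (indicator E) \<le> epowr (of_nat (card E)) (1/2)"
    by (rule epowr_mono[rotated]) simp
  then show "l2 F (indicator E) \<le> ennreal (sqrt (real (card E)))"
    by (simp add: ennreal_of_nat_eq_real_of_nat epowr_ennreal powr_half_sqrt)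
qed

lemma top_l2_cmult: "top_l2 n (\<lambda>i. c * b i) = c * top_l2 n b"
proof -
  have "l2 E (\<lambda>i. c * b i) = c * l2 E b" for E
    by (simp add: power_mult_distrib epowr_mult flip: sum_distrib_left)
  then show ?thesis by (simp add: top_l2_eq_SUP SUP_mult_left_ennreal)
qed

lemma l2_triangle:
  assumes "finite E" shows "l2 E (\<lambda>i. b i + d i) \<le> l2 E b + l2 E d"
proof (cases "\<exists>i\<in>E. b i = top \<or> d i = top")
  case True
  then have "(\<Sum>i\<in>E. (b i)\<^sup>2) = top \<or> (\<Sum>i\<in>E. (d i)\<^sup>2) = top"
    using assms by (auto simp: power_eq_top_ennreal)
  then show ?thesis by auto
next
  case False
  define x where "x i = enn2real (b i)" for i
  define y where "y i = enn2real (d i)" for i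
  have xy: "b i = ennreal (x i)" "d i = ennreal (y i)" if "i \<in> E" for i
    using False that by (auto simp: x_def y_def less_top)
  have nonneg: "0 \<le> x i" "0 \<le> y i" for i by (simp_all add: x_def y_def)
  have l2: "l2 E c = ennreal (L2_set z E)" if "\<And>i. i \<in> E \<Longrightarrow> c i = ennreal (z i)" "\<And>i. 0 \<le> z i" for c z
    using that by (simp add: L2_set_def ennreal_power epowr_ennreal sum_nonneg powr_half_sqrt)
  have "l2 E (\<lambda>i. b i + d i) = ennreal (L2_set (\<lambda>i. x i + y i) E)"
    by (rule l2) (auto simp: xy nonneg)
  also have "\<dots> \<le> ennreal (L2_set x E + L2_set y E)"
    by (intro ennreal_leI L2_set_triangle_ineq)
  also have "\<dots> = l2 E b + l2 E d"
    using xy nonneg by (simp add: l2 L2_set_nonneg)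
  finally show ?thesis .
qed

lemma top_l2_triangle: "top_l2 n (\<lambda>i. b i + d i) \<le> top_l2 n b + top_l2 n d"
  unfolding top_l2_eq_SUP
  by (intro SUP_least order_trans[OF l2_triangle] add_mono SUP_upper) auto

lemma top_l2_SUP:
  assumes inc: "\<And>i. incseq (\<lambda>k. B k i)"
  shows "top_l2 n (\<lambda>i. SUP k::nat. B k i) = (SUP k. top_l2 n (B k))"
proof -
  have "l2 E (\<lambda>i. SUP k. B k i) = (SUP k. l2 E (B k))" for E
  proof -
    have "(SUP k. B k i)\<^sup>2 = (SUP k. (B k i)\<^sup>2)" for i
      using epowr_SUP[of 2 "\<lambda>k. B k i" UNIV] by (simp add: epowr_2)
    moreover have "(\<Sum>i\<in>E. SUP k. (B k i)\<^sup>2) = (SUP k. \<Sum>i\<in>E. (B k i)\<^sup>2)"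
      using inc by (intro ennreal_SUP_sum[symmetric]) (auto simp: incseq_def intro: power_mono_ennreal)
    ultimately show ?thesis by (simp add: epowr_SUP)
  qed
  then show ?thesis
    unfolding top_l2_eq_SUP by (simp add: SUP_commute[of _ UNIV])
qed

section \<open>Dyadic form of the Theta norm\<close>

text \<open>The index \<open>0\<close>, which lies in no dyadic block, is avoided by the shift on the left.\<close>

lemma suminf_dyadic_blocks:
  fixes g :: "nat \<Rightarrow> ennreal"
  shows "(\<Sum>n. g (Suc n)) = (\<Sum>m. \<Sum>n\<in>{2 ^ m..<2 ^ Suc m}. g n)"
proof -
  have partial: "(\<Sum>n<2 ^ M - 1. g (Suc n)) = (\<Sum>m<M. \<Sum>n\<in>{2 ^ m..<2 ^ Suc m}. g n)" for M
  proof -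
    have "(\<Sum>n<2 ^ M - 1. g (Suc n)) = (\<Sum>n\<in>{1..<2 ^ M}. g n)"
      by (rule sum.reindex_bij_witness[of _ "\<lambda>n. n - 1" Suc]) auto
    also have "\<dots> = (\<Sum>m<M. \<Sum>n\<in>{2 ^ m..<2 ^ Suc m}. g n)"
    proof (induction M)
      case (Suc M)
      have "{1..<2 ^ Suc M} = {1..<2 ^ M} \<union> {2 ^ M..<2 ^ Suc M :: nat}" by auto
      then have "(\<Sum>n\<in>{1..<2 ^ Suc M}. g n) = (\<Sum>n\<in>{1..<2 ^ M}. g n) + (\<Sum>n\<in>{2 ^ M..<2 ^ Suc M}. g n)"
        by (metis (no_types) sum.atLeastLessThan_concat one_le_numeral one_le_power
            power_increasing le_SucI order_refl)
      with Suc show ?case by simp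
    qed simp
    finally show ?thesis .
  qed
  show ?thesis
  proof (rule antisym)
    show "(\<Sum>n. g (Suc n)) \<le> (\<Sum>m. \<Sum>n\<in>{2 ^ m..<2 ^ Suc m}. g n)"
    proof (rule suminf_le_const)
      fix N :: nat
      have "N \<le> 2 ^ N - 1" using less_exp[of N] by linarith
      then have "(\<Sum>n<N. g (Suc n)) \<le> (\<Sum>n<2 ^ N - 1. g (Suc n))"
        by (intro sum_mono2) auto
      also have "\<dots> \<le> (\<Sum>m. \<Sum>n\<in>{2 ^ m..<2 ^ Suc m}. g n)"
        unfolding partial by (rule sum_le_suminf) auto
      finally show "(\<Sum>n<N. g (Suc n)) \<le> (\<Sum>m. \<Sum>n\<in>{2 ^ m..<2 ^ Suc m}. g n)" .
    qed simp
    show "(\<Sum>m. \<Sum>n\<in>{2 ^ m..<2 ^ Suc m}. g n) \<le> (\<Sum>n. g (Suc n))"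
      by (rule suminf_le_const) (auto simp: partial[symmetric] simp del: power_Suc intro: sum_le_suminf)
  qed
qed

lemma ex_dyadic_block:
  assumes "1 \<le> (n::nat)" obtains m where "2 ^ m \<le> n" "n < 2 ^ Suc m"
  using ex_power_ivl1[of 2 n] assms by auto

lemma epowr_dyadic_weight:
  assumes "0 < q"
  shows "of_nat (2 ^ m) * epowr (ennreal (2 powr (- (real m / q))) * z) q = epowr z q"
proof -
  have "of_nat (2 ^ m) * epowr (ennreal (2 powr (- (real m / q)))) q = ennreal (2 ^ m * 2 powr (- real m))"
    using assms by (simp add: epowr_ennreal powr_powr ennreal_of_nat_eq_real_of_nat flip: ennreal_mult)
  also have "\<dots> = 1" by (simp add: powr_minus powr_realpow)
  finally show ?thesis using assms by (simp add: epowr_mult flip: mult.assoc)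
qed

lemma card_dyadic_block: "card {2 ^ m..<2 ^ Suc m :: nat} = 2 ^ m"
  by simp

text \<open>A dyadic block with \<open>2\<^sup>m\<close> terms of size \<open>2\<^sup>-\<^sup>m\<^sup>/\<^sup>p z\<^sub>m\<close> contributes exactly \<open>z\<^sub>m\<^sup>p\<close>. For \<open>p = \<infinity>\<close> the exponent
  \<open>m / enn2real p\<close> is \<open>0\<close> by the conventions \<open>enn2real \<infinity> = 0\<close> and \<open>m / 0 = 0\<close>, which is the correct weight.\<close>

lemma seq_norm_dyadic_le:
  assumes p: "2 < p"
    and le: "\<And>m n. 2 ^ m \<le> Suc n \<Longrightarrow> Suc n < 2 ^ Suc m \<Longrightarrow>
      a n \<le> ennreal (2 powr (- (real m / enn2real p))) * z m"
  shows "seq_norm p a \<le> seq_norm p z"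
proof (cases "p = \<infinity>")
  case True
  have "a n \<le> (SUP m. z m)" for n
  proof -
    obtain m where m: "2 ^ m \<le> Suc n" "Suc n < 2 ^ Suc m"
      by (rule ex_dyadic_block[of "Suc n"]) auto
    then have "a n \<le> z m" using le[OF m] True by simp
    then show ?thesis by (rule order_trans) (rule SUP_upper, simp)
  qed
  with True show ?thesis by (auto simp: seq_norm_def intro!: SUP_least)
next
  case False
  let ?q = "enn2real p"
  have q: "2 < ?q" using enn2real_gt_2[OF p False] .
  define g where "g n = epowr (a (n - 1)) ?q" for n
  have "(\<Sum>n. epowr (a n) ?q) = (\<Sum>n. g (Suc n))" by (simp add: g_def)
  also have "\<dots> = (\<Sum>m. \<Sum>n\<in>{2 ^ m..<2 ^ Suc m}. g n)" by (rule suminf_dyadic_blocks)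
  also have "\<dots> \<le> (\<Sum>m. epowr (z m) ?q)"
  proof (rule suminf_le)
    fix m :: nat
    have "g n \<le> epowr (ennreal (2 powr (- (real m / ?q))) * z m) ?q" if "n \<in> {2 ^ m..<2 ^ Suc m}" for n
    proof -
      have "0 < n" using that by (auto intro: less_le_trans[of 0 "2 ^ m"])
      then show ?thesis
        using that le[of m "n - 1"] q unfolding g_def by (intro epowr_mono) auto
    qed
    then have "(\<Sum>n\<in>{2 ^ m..<2 ^ Suc m}. g n)
        \<le> (\<Sum>n\<in>{2 ^ m..<2 ^ Suc m :: nat}. epowr (ennreal (2 powr (- (real m / ?q))) * z m) ?q)"
      by (rule sum_mono)
    also have "\<dots> = epowr (z m) ?q"
      unfolding sum_constant card_dyadic_block using q by (intro epowr_dyadic_weight) auto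
    finally show "(\<Sum>n\<in>{2 ^ m..<2 ^ Suc m}. g n) \<le> epowr (z m) ?q" .
  qed auto
  finally show ?thesis using False q by (auto simp: seq_norm_def intro!: epowr_mono)
qed

lemma seq_norm_dyadic_ge:
  assumes p: "2 < p"
    and ge: "\<And>m n. 2 ^ m \<le> Suc n \<Longrightarrow> Suc n < 2 ^ Suc m \<Longrightarrow>
      ennreal (2 powr (- (real m / enn2real p))) * z m \<le> a n"
  shows "seq_norm p z \<le> seq_norm p a"
proof (cases "p = \<infinity>")
  case True
  have "z m \<le> (SUP n. a n)" for m
  proof -
    have "z m \<le> a (2 ^ m - 1)" using ge[of m "2 ^ m - 1"] True by simp
    then show ?thesis by (rule order_trans) (rule SUP_upper, simp)
  qed
  with True show ?thesis by (auto simp: seq_norm_def intro!: SUP_least)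
next
  case False
  let ?q = "enn2real p"
  have q: "2 < ?q" using enn2real_gt_2[OF p False] .
  define g where "g n = epowr (a (n - 1)) ?q" for n
  have "(\<Sum>m. epowr (z m) ?q) \<le> (\<Sum>m. \<Sum>n\<in>{2 ^ m..<2 ^ Suc m}. g n)"
  proof (rule suminf_le)
    fix m :: nat
    have "epowr (ennreal (2 powr (- (real m / ?q))) * z m) ?q \<le> g n" if "n \<in> {2 ^ m..<2 ^ Suc m}" for n
    proof -
      have "0 < n" using that by (auto intro: less_le_trans[of 0 "2 ^ m"])
      then show ?thesis
        using that ge[of m "n - 1"] q unfolding g_def by (intro epowr_mono) auto
    qed
    then have "(\<Sum>n\<in>{2 ^ m..<2 ^ Suc m :: nat}. epowr (ennreal (2 powr (- (real m / ?q))) * z m) ?q)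
        \<le> (\<Sum>n\<in>{2 ^ m..<2 ^ Suc m}. g n)"
      by (rule sum_mono)
    moreover have "(\<Sum>n\<in>{2 ^ m..<2 ^ Suc m :: nat}. epowr (ennreal (2 powr (- (real m / ?q))) * z m) ?q)
        = epowr (z m) ?q"
      unfolding sum_constant card_dyadic_block using q by (intro epowr_dyadic_weight) auto
    ultimately show "epowr (z m) ?q \<le> (\<Sum>n\<in>{2 ^ m..<2 ^ Suc m}. g n)" by simp
  qed auto
  also have "\<dots> = (\<Sum>n. g (Suc n))" by (rule suminf_dyadic_blocks[symmetric])
  also have "\<dots> = (\<Sum>n. epowr (a n) ?q)" by (simp add: g_def)
  finally show ?thesis using False q by (auto simp: seq_norm_def intro!: epowr_mono)
qed

text \<open>The \<open>p\<close>-th root of the weight in the Theta norm. Since \<open>1 / enn2real \<infinity> = 0\<close>, the same formula gives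
  the weight for \<open>p = \<infinity>\<close>.\<close>

definition Theta_weight :: "ennreal \<Rightarrow> nat \<Rightarrow> real" where
  "Theta_weight p m = real (Suc m) powr (- (1 / enn2real p)) * ln (real (Suc m) + 1) powr (- (1 / 2))"

lemma Theta_weight_pos: "0 < Theta_weight p m"
  by (simp add: Theta_weight_def)

lemma Theta_norm_eq_seq_norm:
  assumes "2 < p"
  shows "Theta_norm p b = seq_norm p (\<lambda>m. ennreal (Theta_weight p m) * top_l2 (Suc m) b)"
proof (cases "p = \<infinity>")
  case True
  have "{1..} = range Suc" by (auto simp: image_iff intro: Suc_le_D)
  then have "Theta_norm p b = (SUP m. ennreal (ln (real (Suc m) + 1) powr (- 1 / 2)) * top_l2 (Suc m) b)"
    using True by (simp add: Theta_norm_def top_l2_def image_image)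
  with True show ?thesis by (simp add: seq_norm_def Theta_weight_def)
next
  case False
  let ?q = "enn2real p"
  have q: "2 < ?q" using enn2real_gt_2[OF assms False] .
  have "epowr (ennreal (Theta_weight p m) * top_l2 (Suc m) b) ?q =
      epowr (\<Sum>j = 1..Suc m. seq_rearr b j ^ 2) (?q / 2) *
           ennreal (1 / (real (Suc m) * ln (real (Suc m) + 1) powr (?q / 2)))" for m
  proof -
    have "Theta_weight p m powr ?q = real (Suc m) powr (- 1) * ln (real (Suc m) + 1) powr (- (?q / 2))"
      using q by (simp add: Theta_weight_def powr_mult powr_powr)
    also have "\<dots> = 1 / (real (Suc m) * ln (real (Suc m) + 1) powr (?q / 2))"
      by (simp add: powr_minus_divide)
    finally show ?thesis
      using q Theta_weight_pos[of p m]
      by (simp add: epowr_mult epowr_ennreal top_l2_def epowr_epowr mult.commute)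
  qed
  then show ?thesis
    using False by (simp add: Theta_norm_def seq_norm_def Let_def)
qed

definition dyadic_mean :: "('i \<Rightarrow> ennreal) \<Rightarrow> nat \<Rightarrow> ennreal" where
  "dyadic_mean b m = ennreal (1 / sqrt (real (Suc m))) * top_l2 (2 ^ m) b"

text \<open>The shift from \<open>m\<close> to \<open>m + 2\<close> in the lower bound fits the use of \<open>top_l2 (2 ^ Suc m)\<close> as an upper bound on the block.\<close>

lemma ln_dyadic_bounds:
  assumes "2 ^ m \<le> n" "n < 2 ^ Suc m"
  shows "ln (real n + 1) \<le> real (Suc m)" "real (Suc (Suc m)) / 5 \<le> ln (real n + 1)"
proof -
  have "Suc n \<le> 2 ^ Suc m" using assms by simp
  then have n: "real n + 1 \<le> 2 ^ Suc m"
    by (metis of_nat_Suc of_nat_le_iff of_nat_numeral of_nat_power add.commute)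
  have l2: "ln (2::real) \<le> 1" "3 / 5 \<le> ln (2::real)" using ln2_ge_two_thirds ln_2_less_1 by auto
  have "ln (real n + 1) \<le> ln (2 ^ Suc m)" using n by (subst ln_le_cancel_iff) auto
  also have "\<dots> = real (Suc m) * ln 2" by (simp only: ln_realpow)
  also have "\<dots> \<le> real (Suc m) * 1" using l2 by (intro mult_left_mono) auto
  finally show "ln (real n + 1) \<le> real (Suc m)" by simp
  have n': "2 ^ m \<le> real n" using assms(1) by (metis of_nat_le_iff of_nat_numeral of_nat_power)
  show "real (Suc (Suc m)) / 5 \<le> ln (real n + 1)"
  proof (cases m)
    case 0
    have "ln 2 \<le> ln (real n + 1)" using n' 0 by (subst ln_le_cancel_iff) auto
    moreover have "real (Suc (Suc m)) / 5 = 2 / 5" using 0 by simp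
    ultimately show ?thesis using l2 by linarith
  next
    case (Suc k)
    have "real (Suc (Suc m)) / 5 \<le> real m * (3 / 5)" using Suc by simp
    also have "\<dots> \<le> real m * ln 2" using l2 by (intro mult_left_mono) auto
    also have "\<dots> = ln (2 ^ m)" by (simp only: ln_realpow)
    also have "\<dots> \<le> ln (real n + 1)"
      by (subst ln_le_cancel_iff) (simp, simp, rule order_trans[OF n'], simp)
    finally show ?thesis .
  qed
qed

lemma Theta_weight_bounds:
  assumes p: "2 < p" and n: "2 ^ m \<le> Suc n" "Suc n < 2 ^ Suc m"
  shows "Theta_weight p n \<le> 2 powr (- (real m / enn2real p)) * (sqrt 5 / sqrt (real (Suc (Suc m))))"
    and "2 powr (- (real m / enn2real p)) * (1 / 2 / sqrt (real (Suc m))) \<le> Theta_weight p n"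
proof -
  define q where "q = 1 / enn2real p"
  have q: "0 \<le> q" "q \<le> 1"
  proof -
    show "q \<le> 1"
    proof (cases "p = \<infinity>")
      case False
      then show ?thesis using enn2real_gt_2[OF p False] by (simp add: q_def)
    qed (simp add: q_def)
  qed (simp add: q_def)
  have n1: "2 ^ m \<le> real (Suc n)" using n(1) by (metis of_nat_le_iff of_nat_numeral of_nat_power)
  have n2: "real (Suc n) \<le> 2 ^ Suc m"
    using n(2) by (metis less_imp_le of_nat_le_iff of_nat_numeral of_nat_power)
  note ln = ln_dyadic_bounds[OF n]
  have ln_pos: "0 < ln (real (Suc n) + 1)" by simp
  have half: "x powr (- (1 / 2)) = 1 / sqrt x" if "0 < x" for x :: real
    using that by (simp add: powr_minus_divide powr_half_sqrt)
  have "real (Suc n) powr (- q) \<le> (2 ^ m) powr (- q)"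
    using q n1 by (intro powr_mono2') auto
  also have "\<dots> = 2 powr (- (real m * q))" by (simp add: powr_powr flip: powr_realpow)
  finally have 1: "real (Suc n) powr (- q) \<le> 2 powr (- (real m * q))" .
  have "2 powr (- (real m * q)) * (1 / 2) \<le> 2 powr (- (real m * q)) * 2 powr (- q)"
    using q powr_mono[of "-1" "-q" 2] by (intro mult_left_mono) (auto simp: powr_minus_divide)
  also have "\<dots> = (2 powr real (Suc m)) powr (- q)"
    unfolding powr_powr by (simp add: algebra_simps flip: powr_add)
  also have "\<dots> = (2 ^ Suc m) powr (- q)" by (subst powr_realpow) auto
  also have "\<dots> \<le> real (Suc n) powr (- q)"
    using q n2 by (intro powr_mono2') auto
  finally have 2: "2 powr (- (real m * q)) * (1 / 2) \<le> real (Suc n) powr (- q)" .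
  have "ln (real (Suc n) + 1) powr (- (1 / 2)) \<le> (real (Suc (Suc m)) / 5) powr (- (1 / 2))"
    using ln by (intro powr_mono2') auto
  also have "\<dots> = sqrt 5 / sqrt (real (Suc (Suc m)))" by (subst half) (auto simp: real_sqrt_divide)
  finally have 3: "ln (real (Suc n) + 1) powr (- (1 / 2)) \<le> sqrt 5 / sqrt (real (Suc (Suc m)))" .
  have "1 / sqrt (real (Suc m)) = real (Suc m) powr (- (1 / 2))" by (subst half) auto
  also have "\<dots> \<le> ln (real (Suc n) + 1) powr (- (1 / 2))"
    using ln ln_pos by (intro powr_mono2') auto
  finally have 4: "1 / sqrt (real (Suc m)) \<le> ln (real (Suc n) + 1) powr (- (1 / 2))" .
  have w: "Theta_weight p n = real (Suc n) powr (- q) * ln (real (Suc n) + 1) powr (- (1 / 2))"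
    by (simp add: Theta_weight_def q_def)
  have mq: "real m / enn2real p = real m * q" by (simp add: q_def)
  show "Theta_weight p n \<le> 2 powr (- (real m / enn2real p)) * (sqrt 5 / sqrt (real (Suc (Suc m))))"
    unfolding w mq by (intro mult_mono 1 3) auto
  have "2 powr (- (real m * q)) * (1 / 2) * (1 / sqrt (real (Suc m))) \<le> Theta_weight p n"
    unfolding w by (intro mult_mono 2 4) auto
  then show "2 powr (- (real m / enn2real p)) * (1 / 2 / sqrt (real (Suc m))) \<le> Theta_weight p n"
    unfolding mq by simp
qed

lemma ennreal_mult_divide:
  "0 \<le> x \<Longrightarrow> 0 \<le> y \<Longrightarrow> 0 \<le> z \<Longrightarrow> ennreal (x * (y / z)) = ennreal x * ennreal y * ennreal (1 / z)"
  by (simp flip: ennreal_mult)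

lemma Theta_norm_le_dyadic:
  assumes p: "2 < p"
  shows "Theta_norm p b \<le> ennreal (sqrt 5) * seq_norm p (dyadic_mean b)"
proof -
  have "Theta_norm p b \<le> seq_norm p (\<lambda>m. ennreal (sqrt 5) * dyadic_mean b (m + 1))"
    unfolding Theta_norm_eq_seq_norm[OF p]
  proof (rule seq_norm_dyadic_le[OF p])
    fix m n :: nat assume n: "2 ^ m \<le> Suc n" "Suc n < 2 ^ Suc m"
    have "ennreal (Theta_weight p n) * top_l2 (Suc n) b
      \<le> ennreal (2 powr (- (real m / enn2real p)) * (sqrt 5 / sqrt (real (Suc (Suc m))))) * top_l2 (2 ^ Suc m) b"
      using n by (intro mult_mono ennreal_leI Theta_weight_bounds[OF p] top_l2_mono_n) auto
    also have "\<dots> = ennreal (2 powr (- (real m / enn2real p))) * (ennreal (sqrt 5) * dyadic_mean b (m + 1))"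
      unfolding dyadic_mean_def by (subst ennreal_mult_divide) (auto simp: mult.assoc)
    finally show "ennreal (Theta_weight p n) * top_l2 (Suc n) b
      \<le> ennreal (2 powr (- (real m / enn2real p))) * (ennreal (sqrt 5) * dyadic_mean b (m + 1))" .
  qed
  also have "\<dots> \<le> ennreal (sqrt 5) * seq_norm p (dyadic_mean b)"
    unfolding seq_norm_cmult[OF p]
    by (intro mult_left_mono seq_norm_subsequence_le[OF p, of "\<lambda>m. m + 1" UNIV]) auto
  finally show ?thesis .
qed

lemma dyadic_le_Theta_norm:
  assumes p: "2 < p"
  shows "seq_norm p (dyadic_mean b) \<le> 2 * Theta_norm p b"
proof -
  have "seq_norm p (\<lambda>m. ennreal (1 / 2) * dyadic_mean b m) \<le> Theta_norm p b"
    unfolding Theta_norm_eq_seq_norm[OF p]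
  proof (rule seq_norm_dyadic_ge[OF p])
    fix m n :: nat assume n: "2 ^ m \<le> Suc n" "Suc n < 2 ^ Suc m"
    have "ennreal (2 powr (- (real m / enn2real p))) * (ennreal (1 / 2) * dyadic_mean b m)
      = ennreal (2 powr (- (real m / enn2real p)) * (1 / 2 / sqrt (real (Suc m)))) * top_l2 (2 ^ m) b"
      unfolding dyadic_mean_def by (subst ennreal_mult_divide) (auto simp: mult.assoc)
    also have "\<dots> \<le> ennreal (Theta_weight p n) * top_l2 (Suc n) b"
      using n by (intro mult_mono ennreal_leI Theta_weight_bounds[OF p] top_l2_mono_n) auto
    finally show "ennreal (2 powr (- (real m / enn2real p))) * (ennreal (1 / 2) * dyadic_mean b m)
      \<le> ennreal (Theta_weight p n) * top_l2 (Suc n) b" .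
  qed
  then have "2 * (ennreal (1 / 2) * seq_norm p (dyadic_mean b)) \<le> 2 * Theta_norm p b"
    unfolding seq_norm_cmult[OF p] by (rule mult_left_mono) simp
  moreover have "2 * ennreal (1 / 2) = 1"
    using ennreal_mult[of 2 "1/2"] by simp
  ultimately show ?thesis by (simp flip: mult.assoc)
qed

section \<open>The Theta norm is rearrangement invariant\<close>

lemma seq_norm_inverse_sqrt_finite:
  assumes p: "2 < p" shows "seq_norm p (\<lambda>m. ennreal (1 / sqrt (real (Suc m)))) < top"
proof (cases "p = \<infinity>")
  case True
  have "(SUP m. ennreal (1 / sqrt (real (Suc m)))) \<le> 1"
    by (rule SUP_least) simp
  with True show ?thesis by (auto simp: seq_norm_def intro: le_less_trans)
next
  case False
  let ?q = "enn2real p"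
  have q: "2 < ?q" using enn2real_gt_2[OF p False] .
  have "(1 / sqrt (real (Suc m))) powr ?q = real (Suc m) powr (- (?q / 2))" for m
    by (simp add: powr_divide powr_half_sqrt[symmetric] powr_powr powr_minus_divide)
  moreover have "summable (\<lambda>m. real (Suc m) powr (- (?q / 2)))"
    unfolding summable_Suc_iff[of "\<lambda>m. real m powr (- (?q / 2))"] summable_real_powr_iff using q by simp
  ultimately have "(\<Sum>m. epowr (ennreal (1 / sqrt (real (Suc m)))) ?q) \<noteq> top"
    by (simp add: epowr_ennreal ennreal_suminf_neq_top)
  then show ?thesis using False by (auto simp: seq_norm_def less_top epowr_def)
qed

text \<open>For \<open>p < \<infinity>\<close> the weights are \<open>p\<close>-summable precisely because \<open>p > 2\<close>; this is what makes indicators of finite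
  sets have finite norm.\<close>

theorem Theta_ri_sequence_norm:
  assumes p: "2 < p" shows "ri_sequence_norm (Theta_norm p :: ('i \<Rightarrow> ennreal) \<Rightarrow> ennreal)"
proof
  note Theta = Theta_norm_eq_seq_norm[OF p]
  have w: "1 \<le> Theta_weight p 0"
  proof -
    have "1 powr (- (1/2)) \<le> ln (2::real) powr (- (1 / 2))"
      using ln_2_less_1 by (intro powr_mono2') auto
    then show ?thesis by (simp add: Theta_weight_def)
  qed
  have upper: "b i \<le> Theta_norm p b" for b :: "'i \<Rightarrow> ennreal" and i
  proof -
    have "1 * b i \<le> ennreal (Theta_weight p 0) * top_l2 (Suc 0) b"
      using w le_top_l2_1[of b i] by (intro mult_mono) auto
    also have "\<dots> \<le> Theta_norm p b"
      unfolding Theta by (rule seq_norm_upper[OF p, of "\<lambda>m. ennreal (Theta_weight p m) * top_l2 (Suc m) b"])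
    finally show ?thesis by simp
  qed
  fix b d :: "'i \<Rightarrow> ennreal"
  show "Theta_norm p b = 0 \<longleftrightarrow> (\<forall>i. b i = 0)"
  proof
    assume "\<forall>i. b i = 0"
    then show "Theta_norm p b = 0" unfolding Theta by (auto simp: seq_norm_eq_0_iff top_l2_eq_SUP SUP_constant bot_ennreal)
  qed (use upper[of b] in auto)
  show "Theta_norm p (\<lambda>i. ennreal c * b i) = ennreal c * Theta_norm p b" for c
    by (simp add: Theta top_l2_cmult mult.left_commute[of _ "ennreal c"] seq_norm_cmult[OF p])
  show "Theta_norm p (\<lambda>i. b i + d i) \<le> Theta_norm p b + Theta_norm p d"
    unfolding Theta
    by (intro order_trans[OF seq_norm_mono seq_norm_triangle[OF p]])
      (auto simp flip: distrib_left intro!: mult_left_mono top_l2_triangle)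
  show "Theta_norm p b \<le> Theta_norm p d" if "\<And>i. b i \<le> d i"
    unfolding Theta by (intro seq_norm_mono mult_left_mono top_l2_mono that) auto
  show "Theta_norm p (\<lambda>i. SUP n. B n i) = (SUP n::nat. Theta_norm p (B n))"
    if inc: "\<And>i. incseq (\<lambda>n. B n i)" for B :: "nat \<Rightarrow> 'i \<Rightarrow> ennreal"
  proof -
    have "incseq (\<lambda>n. ennreal (Theta_weight p m) * top_l2 (Suc m) (B n))" for m
      using inc unfolding incseq_def by (intro allI impI mult_left_mono top_l2_mono) auto
    then show ?thesis
      unfolding Theta top_l2_SUP[OF inc] SUP_mult_left_ennreal by (rule seq_norm_SUP[OF p])
  qed
  show "Theta_norm p (indicator E :: 'i \<Rightarrow> ennreal) < \<infinity>" if "finite E" for E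
  proof -
    have "seq_norm p (dyadic_mean (indicator E :: 'i \<Rightarrow> ennreal))
        \<le> seq_norm p (\<lambda>m. ennreal (sqrt (real (card E))) * ennreal (1 / sqrt (real (Suc m))))"
      unfolding dyadic_mean_def
      by (intro seq_norm_mono) (subst mult.commute, intro mult_right_mono top_l2_indicator_le that, simp)
    also have "\<dots> < top"
      unfolding seq_norm_cmult[OF p] using seq_norm_inverse_sqrt_finite[OF p] by (simp add: ennreal_mult_less_top)
    finally have "ennreal (sqrt 5) * seq_norm p (dyadic_mean (indicator E :: 'i \<Rightarrow> ennreal)) < top"
      by (simp add: ennreal_mult_less_top)
    with Theta_norm_le_dyadic[OF p] show ?thesis by (metis infinity_ennreal_def le_less_trans)
  qed
  show "\<exists>C::real. \<forall>b. (\<Sum>i\<in>E. b i) \<le> ennreal C * Theta_norm p b" if "finite E" for E :: "'i set"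
  proof (intro exI allI)
    fix b :: "'i \<Rightarrow> ennreal"
    have "(\<Sum>i\<in>E. b i) \<le> (\<Sum>i\<in>E. Theta_norm p b)" by (intro sum_mono upper)
    then show "(\<Sum>i\<in>E. b i) \<le> ennreal (real (card E)) * Theta_norm p b"
      by (simp add: ennreal_of_nat_eq_real_of_nat)
  qed
  show "Theta_norm p b = Theta_norm p d" if "\<And>j. j \<ge> 1 \<Longrightarrow> seq_rearr b j = seq_rearr d j"
    unfolding Theta top_l2_def using that by simp
qed

section \<open>Hardy's inequality\<close>

text \<open>Elliott's proof of Hardy's inequality: for consecutive averages \<open>B\<close> and \<open>A\<close> of the first \<open>m\<close> and \<open>m + 1\<close> terms,
  Young's inequality bounds \<open>A\<^sup>q\<^sup>-\<^sup>1 B\<close>, and the left-hand side telescopes.\<close>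

lemma hardy_pointwise:
  fixes A B x :: real
  assumes q: "1 < q" and nonneg: "0 \<le> A" "0 \<le> B" "0 \<le> x" and avg: "(real m + 1) * A = real m * B + x"
  shows "(q - 1) * A powr q + (real m + 1) * A powr q - real m * B powr q \<le> q * (A powr (q - 1) * x)"
proof -
  have "A powr (q - 1) * B \<le> (A powr (q - 1)) powr (q / (q - 1)) / (q / (q - 1)) + B powr q / q"
    using q nonneg by (intro Youngs_inequality) (auto simp: field_simps)
  also have "(A powr (q - 1)) powr (q / (q - 1)) = A powr q"
    using q by (simp add: powr_powr)
  finally have "q * (A powr (q - 1) * B) \<le> (q - 1) * A powr q + B powr q"
    using q by (simp add: field_simps)
  then have young: "real m * (q * (A powr (q - 1) * B)) \<le> real m * ((q - 1) * A powr q + B powr q)"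
    by (rule mult_left_mono) simp
  have AA: "A powr (q - 1) * A = A powr q"
    using nonneg q powr_mult_base[of A "q - 1"] by (simp add: mult.commute)
  have "x = (real m + 1) * A - real m * B" using avg by simp
  then have "q * (A powr (q - 1) * x) = q * (real m + 1) * (A powr (q - 1) * A) - real m * (q * (A powr (q - 1) * B))"
    by (simp only:) (simp add: algebra_simps)
  also have "\<dots> \<ge> q * (real m + 1) * A powr q - real m * ((q - 1) * A powr q + B powr q)"
    unfolding AA using young by linarith
  finally show ?thesis by (simp add: algebra_simps)
qed

text \<open>This replaces Hoelder's inequality at the end of Elliott's proof: a small multiple of \<open>A\<^sup>q\<close> is
  absorbed on the left-hand side of the summed inequality.\<close>

lemma hardy_young:
  fixes A x e :: real
  assumes q: "1 < q" and "0 \<le> A" "0 \<le> x" "0 < e"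
  shows "A powr (q - 1) * x \<le> e * A powr q + e powr (1 - q) * x powr q"
proof (cases "x \<le> e * A")
  case True
  have "A powr (q - 1) * x \<le> A powr (q - 1) * (e * A)"
    using True by (rule mult_left_mono) simp
  also have "\<dots> = e * A powr q"
    using powr_mult_base[of A "q - 1"] assms by (simp add: mult_ac)
  finally show ?thesis using assms by (simp add: add_increasing2)
next
  case False
  then have "A \<le> x / e" using assms by (simp add: field_simps)
  then have "A powr (q - 1) * x \<le> (x / e) powr (q - 1) * x"
    using assms by (intro mult_right_mono powr_mono2) auto
  also have "\<dots> = e powr (1 - q) * x powr q"
    using powr_mult_base[of x "q - 1"] assms powr_minus_divide[of e "q - 1"]
    by (simp add: powr_divide mult_ac)
  finally show ?thesis using assms by (simp add: add_increasing)
qed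

lemma hardy_sum:
  fixes x :: "nat \<Rightarrow> real"
  assumes q: "1 < q" and nonneg: "\<And>i. 0 \<le> x i"
  defines "K \<equiv> 2 * q / (q - 1) * ((q - 1) / (2 * q)) powr (1 - q)"
  shows "(\<Sum>m<N. ((\<Sum>i<Suc m. x i) / real (Suc m)) powr q) \<le> K * (\<Sum>i<N. x i powr q)"
proof -
  define A where "A n = (\<Sum>i<n. x i) / real n" for n
  have A: "0 \<le> A n" for n using nonneg by (simp add: A_def sum_nonneg)
  have avg: "(real m + 1) * A (Suc m) = real m * A m + x m" for m
    by (cases "m = 0") (auto simp: A_def add.commute[of "real m" 1])
  have telescope: "(q - 1) * (\<Sum>m<N. A (Suc m) powr q) + real N * A N powr q
      \<le> q * (\<Sum>m<N. A (Suc m) powr (q - 1) * x m)" for N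
  proof (induction N)
    case (Suc N)
    have "(q - 1) * A (Suc N) powr q + (real N + 1) * A (Suc N) powr q - real N * A N powr q
        \<le> q * (A (Suc N) powr (q - 1) * x N)"
      using q A nonneg avg by (intro hardy_pointwise)
    with Suc show ?case by (simp add: algebra_simps)
  qed simp
  \<comment> \<open>With this \<open>e\<close> the absorbed term is half of the left-hand side.\<close>
  define e where "e = (q - 1) / (2 * q)"
  have e: "0 < e" using q by (simp add: e_def)
  let ?SA = "\<Sum>m<N. A (Suc m) powr q" and ?Sx = "\<Sum>i<N. x i powr q"
  have "(q - 1) * ?SA \<le> q * (\<Sum>m<N. A (Suc m) powr (q - 1) * x m)"
    using telescope[of N] A by (smt (verit) mult_nonneg_nonneg of_nat_0_le_iff powr_ge_zero)
  also have "\<dots> \<le> q * (\<Sum>m<N. e * A (Suc m) powr q + e powr (1 - q) * x m powr q)"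
    using q e A nonneg by (intro mult_left_mono sum_mono hardy_young) auto
  also have "\<dots> = q * e * ?SA + q * e powr (1 - q) * ?Sx"
    by (simp add: sum.distrib sum_distrib_left algebra_simps)
  also have "q * e = (q - 1) / 2" using q by (simp add: e_def)
  finally have "(q - 1) * ?SA \<le> (q - 1) / 2 * ?SA + q * e powr (1 - q) * ?Sx" .
  moreover have "(q - 1) * ?SA = (q - 1) / 2 * ?SA + (q - 1) / 2 * ?SA" by simp
  ultimately have "(q - 1) / 2 * ?SA \<le> q * e powr (1 - q) * ?Sx" by linarith
  then have "2 / (q - 1) * ((q - 1) / 2 * ?SA) \<le> 2 / (q - 1) * (q * e powr (1 - q) * ?Sx)"
    using q by (intro mult_left_mono) auto
  then show ?thesis using q by (simp add: K_def e_def A_def mult_ac)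
qed

definition quadratic_mean :: "(nat \<Rightarrow> ennreal) \<Rightarrow> nat \<Rightarrow> ennreal" where
  "quadratic_mean a m = ennreal (1 / sqrt (real (Suc m))) * epowr (\<Sum>i<Suc m. (a i)\<^sup>2) (1 / 2)"

text \<open>Hardy's inequality with exponent \<open>p / 2 > 1\<close>, applied to the squares of the terms. For \<open>p = \<infinity>\<close> an average is
  trivially at most the supremum.\<close>

lemma hardy_seq_norm:
  assumes p: "2 < p"
  obtains C :: real where "0 < C" "\<And>a. seq_norm p (quadratic_mean a) \<le> ennreal C * seq_norm p a"
proof (cases "p = \<infinity>")
  case True
  have "quadratic_mean a m \<le> (SUP i. a i)" for a m
  proof -
    let ?S = "SUP i. a i"
    have "(\<Sum>i<Suc m. (a i)\<^sup>2) \<le> (\<Sum>i<Suc m. ?S\<^sup>2)"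
      by (intro sum_mono power_mono_ennreal SUP_upper) auto
    also have "\<dots> = ennreal (real (Suc m)) * ?S\<^sup>2"
      unfolding sum_constant by (simp add: ennreal_of_nat_eq_real_of_nat)
    finally have "epowr (\<Sum>i<Suc m. (a i)\<^sup>2) (1/2) \<le> epowr (ennreal (real (Suc m)) * ?S\<^sup>2) (1 / 2)"
      by (rule epowr_mono[rotated]) simp
    also have "\<dots> = ennreal (sqrt (real (Suc m))) * ?S"
      by (subst epowr_mult) (auto simp: epowr_ennreal powr_half_sqrt simp del: ennreal_plus)
    finally have "quadratic_mean a m \<le> ennreal (1 / sqrt (real (Suc m))) * (ennreal (sqrt (real (Suc m))) * ?S)"
      unfolding quadratic_mean_def by (rule mult_left_mono) simp
    also have "\<dots> = ?S"
      by (simp flip: mult.assoc ennreal_mult)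
    finally show ?thesis .
  qed
  then have "seq_norm p (quadratic_mean a) \<le> ennreal 1 * seq_norm p a" for a
    using True by (auto simp: seq_norm_def intro!: SUP_least)
  then show ?thesis by (intro that[of 1]) auto
next
  case False
  let ?p = "enn2real p"
  have p2: "2 < ?p" using enn2real_gt_2[OF p False] .
  define q where "q = ?p / 2"
  have q: "1 < q" using p2 by (simp add: q_def)
  define K where "K = 2 * q / (q - 1) * ((q - 1) / (2 * q)) powr (1 - q)"
  have K: "0 < K" using q by (simp add: K_def)
  have "seq_norm p (quadratic_mean a) \<le> ennreal (K powr (1 / ?p)) * seq_norm p a" for a
  proof (cases "seq_norm p a = top")
    case True
    then show ?thesis using K by (simp add: ennreal_mult_top)
  next
    case fin: False
    define r where "r i = enn2real (a i)" for i
    have nonneg: "0 \<le> r i" for i by (simp add: r_def)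
    have r: "a i = ennreal (r i)" for i
      unfolding r_def using le_less_trans[OF seq_norm_upper[OF p, of a i]] fin by (simp add: less_top)
    have "epowr (quadratic_mean a m) ?p = ennreal (((\<Sum>i<Suc m. (r i)\<^sup>2) / real (Suc m)) powr q)" for m
    proof -
      have "epowr (\<Sum>i<Suc m. (a i)\<^sup>2) (1 / 2) = ennreal (sqrt (\<Sum>i<Suc m. (r i)\<^sup>2))"
        using nonneg
        by (simp add: r ennreal_power epowr_ennreal powr_half_sqrt sum_nonneg sum_ennreal del: sum.lessThan_Suc)
      then have "quadratic_mean a m = ennreal (((\<Sum>i<Suc m. (r i)\<^sup>2) / real (Suc m)) powr (1 / 2))"
        by (simp add: quadratic_mean_def powr_half_sqrt sum_nonneg real_sqrt_divide del: sum.lessThan_Suc flip: ennreal_mult)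
      then show ?thesis
        by (simp add: epowr_ennreal powr_powr q_def del: sum.lessThan_Suc)
    qed
    moreover have "epowr (a i) ?p = ennreal ((r i)\<^sup>2 powr q)" for i
      using nonneg[of i] powr_powr[of "r i" 2 q] by (simp add: r epowr_ennreal q_def)
    ultimately have "(\<Sum>m<N. epowr (quadratic_mean a m) ?p) \<le> ennreal K * (\<Sum>i<N. epowr (a i) ?p)" for N
      using hardy_sum[of q "\<lambda>i. (r i)\<^sup>2" N] q K unfolding K_def[symmetric]
      by (simp add: sum_nonneg del: sum.lessThan_Suc flip: ennreal_mult)
    then have "(\<Sum>m<N. epowr (quadratic_mean a m) ?p) \<le> ennreal K * (\<Sum>i. epowr (a i) ?p)" for N
      by (rule order_trans) (auto intro!: mult_left_mono sum_le_suminf)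
    then have "(\<Sum>m. epowr (quadratic_mean a m) ?p) \<le> ennreal K * (\<Sum>i. epowr (a i) ?p)"
      by (intro suminf_le_const) auto
    then have "seq_norm p (quadratic_mean a) \<le> epowr (ennreal K * (\<Sum>i. epowr (a i) ?p)) (1 / ?p)"
      using False p2 by (auto simp: seq_norm_def intro!: epowr_mono)
    also have "\<dots> = ennreal (K powr (1 / ?p)) * seq_norm p a"
      using False p2 K by (simp add: seq_norm_def epowr_mult epowr_ennreal)
    finally show ?thesis .
  qed
  then show ?thesis using K by (intro that[of "K powr (1 / ?p)"]) auto
qed

section \<open>Equimeasurability of a function and its rearrangement\<close>

lemma rearr_antimono: "s \<le> t \<Longrightarrow> rearr M f t \<le> rearr M f s"
  unfolding rearr_def by (intro Inf_superset_mono) (auto intro: order_trans ennreal_leI)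

lemma rearr_measurable:
  assumes "f \<in> borel_measurable M" shows "rearr M f \<in> borel_measurable borel"
proof (rule borel_measurableI_greater)
  fix s
  have "{t \<in> space borel. s < rearr M f t} = {t \<in> space borel. ennreal t < emeasure M {x \<in> space M. s < f x}}"
    using less_rearr_iff[OF assms] by auto
  also have "\<dots> \<in> sets borel" by measurable
  finally show "{t \<in> space borel. s < rearr M f t} \<in> sets borel" .
qed

text \<open>The whole space is added to the half-lines because no half-line \<open>{a<..}\<close> contains \<open>0\<close>.\<close>

lemma sets_borel_ennreal_generator:
  "sets (borel :: ennreal measure) = sigma_sets UNIV (insert UNIV (range (\<lambda>a. {a<..})))"
proof -
  have "sets (borel :: ennreal measure) = sigma_sets UNIV (range (\<lambda>a. {a<..}))"
    by (subst borel_Ioi) simp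
  also have "\<dots> = sigma_sets UNIV (insert UNIV (range (\<lambda>a. {a<..})))"
    by (rule sigma_sets_eqI) (auto intro: sigma_sets.Basic sigma_sets_top)
  finally show ?thesis .
qed

text \<open>By \<open>less_rearr_iff\<close> the set where the rearrangement exceeds \<open>s\<close> is the interval from \<open>0\<close> to the measure of
  \<open>{f > s}\<close>, so both distributions agree on half-lines.\<close>

lemma distr_rearr:
  assumes "prob_space M" and f [measurable]: "f \<in> borel_measurable M"
  shows "distr M borel f = distr (restrict_space lborel {0<..<1}) borel (rearr M f)"
proof (rule measure_eqI_generator_eq)
  interpret prob_space M by fact
  let ?E = "insert UNIV (range (\<lambda>a::ennreal. {a<..}))" and ?L = "restrict_space lborel {0<..<1::real}"
  have meas: "rearr M f \<in> borel_measurable ?L"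
    using rearr_measurable[OF f] by (intro measurable_restrict_space1) simp
  have "{a<..} \<inter> {b<..} = {max a b<..}" for a b :: ennreal by auto
  then show "Int_stable ?E" by (auto simp: Int_stable_def)
  show "?E \<subseteq> Pow UNIV" by auto
  show "sets (distr M borel f) = sigma_sets UNIV ?E" "sets (distr ?L borel (rearr M f)) = sigma_sets UNIV ?E"
    by (simp_all add: sets_borel_ennreal_generator)
  show "range (\<lambda>_::nat. UNIV) \<subseteq> ?E" "(\<Union>i::nat. UNIV) = (UNIV :: ennreal set)" by auto
  show "emeasure (distr M borel f) UNIV \<noteq> \<infinity>"
    by (simp add: emeasure_distr emeasure_space_1)
  fix A assume "A \<in> ?E"
  then consider "A = UNIV" | s where "A = {s<..}" by auto
  then show "emeasure (distr M borel f) A = emeasure (distr ?L borel (rearr M f)) A"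
  proof cases
    case 1
    then show ?thesis
      using meas by (simp add: emeasure_distr emeasure_space_1 emeasure_restrict_space space_restrict_space)
  next
    case 2
    define d where "d = measure M {x \<in> space M. s < f x}"
    have d: "emeasure M {x \<in> space M. s < f x} = ennreal d" "0 \<le> d" "d \<le> 1"
      by (simp_all add: d_def emeasure_eq_measure)
    have "emeasure (distr ?L borel (rearr M f)) A = emeasure ?L (rearr M f -` {s<..} \<inter> {0<..<1})"
      using meas 2 by (simp add: emeasure_distr space_restrict_space)
    also have "rearr M f -` {s<..} \<inter> {0<..<1} = {0<..<d}"
      using d by (auto simp: less_rearr_iff ennreal_less_iff)
    also have "emeasure ?L {0<..<d} = ennreal d"
      using d by (subst emeasure_restrict_space) auto
    also have "\<dots> = emeasure (distr M borel f) A"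
      using 2 d by (simp add: emeasure_distr vimage_def Int_def conj_commute)
    finally show ?thesis ..
  qed
qed

lemma nn_integral_rearr:
  assumes "prob_space M" and f: "f \<in> borel_measurable M" and \<Phi> [measurable]: "\<Phi> \<in> borel_measurable borel"
  shows "(\<integral>\<^sup>+ x. \<Phi> (f x) \<partial>M) = (\<integral>\<^sup>+ t\<in>{0<..<1}. \<Phi> (rearr M f t) \<partial>lborel)"
proof -
  have meas: "rearr M f \<in> borel_measurable (restrict_space lborel {0<..<1})"
    using rearr_measurable[OF f] by (intro measurable_restrict_space1) simp
  have "(\<integral>\<^sup>+ x. \<Phi> (f x) \<partial>M) = (\<integral>\<^sup>+ y. \<Phi> y \<partial>distr M borel f)"
    using f by (simp add: nn_integral_distr)
  also have "\<dots> = (\<integral>\<^sup>+ t. \<Phi> (rearr M f t) \<partial>restrict_space lborel {0<..<1})"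
    unfolding distr_rearr[OF assms(1) f] using meas by (simp add: nn_integral_distr)
  also have "\<dots> = (\<integral>\<^sup>+ t\<in>{0<..<1}. \<Phi> (rearr M f t) \<partial>lborel)"
    by (rule nn_integral_restrict_space) simp
  finally show ?thesis .
qed

section \<open>Fourier coefficients of square integrable functions\<close>

lemma prob_space_torus: "prob_space torus"
  by (rule prob_spaceI) (simp add: emeasure_restrict_space)

lemma space_torus: "space torus = {-1/2..1/2}"
  by simp

lemma borel_measurable_torus: "f \<in> borel_measurable borel \<Longrightarrow> f \<in> borel_measurable torus"
  for f :: "real \<Rightarrow> 'a::topological_space"
  by (intro measurable_restrict_space1 measurable_completion) simp

definition character :: "int \<Rightarrow> real \<Rightarrow> complex" where
  "character n x = exp (- 2 * of_real pi * \<i> * of_int n * of_real x)"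

lemma character_measurable: "character n \<in> borel_measurable torus"
  unfolding character_def
  by (intro borel_measurable_torus borel_measurable_continuous_onI continuous_intros)

lemma cnj_measurable [measurable]:
  "g \<in> borel_measurable M \<Longrightarrow> (\<lambda>x. cnj (g x)) \<in> borel_measurable M"
  by (rule measurable_compose[of g M borel]) (auto intro!: borel_measurable_continuous_onI continuous_intros)

lemma norm_character [simp]: "norm (character n x) = 1"
  by (simp add: character_def norm_exp_eq_Re)

lemma character_mult_cnj: "character n x * cnj (character m x) = character (n - m) x"
  by (simp add: character_def exp_cnj algebra_simps flip: exp_add)

lemma integrable_torus_bounded:
  fixes f :: "real \<Rightarrow> complex"
  assumes "f \<in> borel_measurable torus" "\<And>x. norm (f x) \<le> K"
  shows "integrable torus f"
proof -
  interpret prob_space torus by (rule prob_space_torus)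
  show ?thesis using assms by (intro integrable_const_bound[of _ K]) auto
qed

lemma integral_character: "(\<integral>x. character n x \<partial>torus) = (if n = 0 then 1 else 0)"
proof (cases "n = 0")
  case True
  interpret prob_space torus by (rule prob_space_torus)
  from True show ?thesis using prob_space by (simp add: character_def)
next
  case False
  define c where "c = - 2 * of_real pi * \<i> * of_int n"
  have c: "c \<noteq> 0" using False by (simp add: c_def)
  have h: "(character n has_integral exp (c * of_real (1/2)) / c - exp (c * of_real (-1/2)) / c) {-1/2..1/2}"
  proof (rule fundamental_theorem_of_calculus)
    fix x :: real
    show "((\<lambda>x. exp (c * of_real x) / c) has_vector_derivative character n x) (at x within {-1/2..1/2})"
      unfolding character_def c_def[symmetric] using c
      by (auto intro!: derivative_eq_intros has_vector_derivative_real_field)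
  qed simp
  have eq: "exp (c * of_real (1/2)) = exp (c * of_real (-1/2))"
  proof -
    have "exp c = 1"
      using exp_integer_2pi[of "of_int (- n)"] by (simp add: c_def mult_ac)
    moreover have "exp (c * of_real (1/2)) = exp (c * of_real (-1/2)) * exp c"
      by (simp add: algebra_simps flip: exp_add)
    ultimately show ?thesis by simp
  qed
  have "integral {-1/2..1/2} (character n) = 0"
    using integral_unique[OF h] unfolding eq diff_self .
  moreover have "integrable torus (character n)"
    by (rule integrable_torus_bounded[OF character_measurable, of _ 1]) simp
  ultimately show ?thesis using False by (simp add: lebesgue_integral_eq_integral)
qed

lemma fourier_coeff_character: "fourier_coeff f n = (\<integral>x. f x * character n x \<partial>torus)"
  by (simp add: fourier_coeff_def character_def)

text \<open>Expand the square in \<open>0 \<le> \<integral> \<bar>f - P\<bar>\<^sup>2\<close>, where \<open>P\<close> is the partial Fourier sum over \<open>E\<close>.\<close>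

lemma bessel_inequality:
  assumes f [measurable]: "f \<in> borel_measurable torus" and bound: "\<And>x. norm (f x) \<le> K" and E: "finite E"
  shows "(\<Sum>n\<in>E. (norm (fourier_coeff f n))\<^sup>2) \<le> (\<integral>x. (norm (f x))\<^sup>2 \<partial>torus)"
proof -
  note [measurable] = character_measurable
  define c where "c n = fourier_coeff f n" for n
  define S where "S = (\<Sum>n\<in>E. (norm (c n))\<^sup>2)"
  define P where "P x = (\<Sum>n\<in>E. c n * cnj (character n x))" for x
  have [measurable]: "P \<in> borel_measurable torus" unfolding P_def by measurable
  have P_bound: "norm (P x) \<le> (\<Sum>n\<in>E. norm (c n))" for x
    unfolding P_def by (rule norm_sum[THEN order_trans]) (simp add: norm_mult)
  have int: "integrable torus (\<lambda>x. g x * h x)"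
    if "g \<in> borel_measurable torus" "h \<in> borel_measurable torus" "\<And>x. norm (g x) \<le> A" "\<And>x. norm (h x) \<le> B"
    for g h :: "real \<Rightarrow> complex" and A B
    using that by (intro integrable_torus_bounded[of _ "A * B"] borel_measurable_times)
      (auto simp: norm_mult intro!: mult_mono order_trans[OF norm_ge_zero])
  have fc: "integrable torus (\<lambda>x. f x * character n x)" for n
    by (rule int[of f _ K 1]) (rule f character_measurable bound | simp)+
  have fP: "(\<integral>x. f x * cnj (P x) \<partial>torus) = of_real S"
  proof -
    have "(\<integral>x. f x * cnj (P x) \<partial>torus) = (\<integral>x. (\<Sum>n\<in>E. cnj (c n) * (f x * character n x)) \<partial>torus)"
      by (simp add: P_def sum_distrib_left mult_ac)
    also have "\<dots> = (\<Sum>n\<in>E. cnj (c n) * c n)"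
      unfolding c_def fourier_coeff_character
      by (subst Bochner_Integration.integral_sum)
        (simp_all only: integral_mult_right_zero integrable_mult_right fc)
    also have "\<dots> = of_real S" by (simp add: S_def complex_norm_square mult.commute del: of_real_power)
    finally show ?thesis .
  qed
  have PP: "(\<integral>x. P x * cnj (P x) \<partial>torus) = of_real S"
  proof -
    have "P x * cnj (P x) = (\<Sum>n\<in>E. \<Sum>m\<in>E. c n * cnj (c m) * character (m - n) x)" for x
      unfolding P_def cnj_sum sum_product character_mult_cnj[symmetric]
      by (intro sum.cong refl) (simp add: mult_ac)
    then have "(\<integral>x. P x * cnj (P x) \<partial>torus)
        = (\<integral>x. (\<Sum>n\<in>E. \<Sum>m\<in>E. c n * cnj (c m) * character (m - n) x) \<partial>torus)" by simp
    also have "\<dots> = (\<Sum>n\<in>E. \<Sum>m\<in>E. c n * cnj (c m) * (\<integral>x. character (m - n) x \<partial>torus))"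
    proof -
      have ic: "integrable torus (\<lambda>x. z * character k x)" for z k
        by (intro integrable_mult_right integrable_torus_bounded[OF character_measurable, of _ 1]) simp
      show ?thesis
        by (subst Bochner_Integration.integral_sum, intro Bochner_Integration.integrable_sum ic,
            subst Bochner_Integration.integral_sum, rule ic, simp only: integral_mult_right_zero)
    qed
    also have "\<dots> = (\<Sum>n\<in>E. \<Sum>m\<in>E. if n = m then c n * cnj (c m) else 0)"
      unfolding integral_character by (intro sum.cong refl) auto
    also have "\<dots> = of_real S"
      using E by (simp add: S_def complex_norm_square del: of_real_power)
    finally show ?thesis .
  qed
  have Pf: "(\<integral>x. P x * cnj (f x) \<partial>torus) = of_real S"
  proof -
    have "P x * cnj (f x) = cnj (f x * cnj (P x))" for x by (simp add: mult.commute)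
    then have "(\<integral>x. P x * cnj (f x) \<partial>torus) = cnj (\<integral>x. f x * cnj (P x) \<partial>torus)"
      by (simp only: Bochner_Integration.integral_cnj)
    then show ?thesis by (simp only: fP complex_cnj_complex_of_real)
  qed
  have ff: "(\<integral>x. f x * cnj (f x) \<partial>torus) = of_real (\<integral>x. (norm (f x))\<^sup>2 \<partial>torus)"
    by (simp add: complex_norm_square[symmetric] del: of_real_power)
  have i: "integrable torus (\<lambda>x. f x * cnj (f x))" "integrable torus (\<lambda>x. f x * cnj (P x))"
    "integrable torus (\<lambda>x. P x * cnj (f x))" "integrable torus (\<lambda>x. P x * cnj (P x))"
    by (rule int, measurable, (simp, rule bound P_bound)+ | rule int, measurable, rule bound P_bound, simp, rule bound P_bound)+
  have "of_real (\<integral>x. (norm (f x - P x))\<^sup>2 \<partial>torus) = (\<integral>x. (f x - P x) * cnj (f x - P x) \<partial>torus)"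
    by (simp add: complex_norm_square[symmetric] del: of_real_power complex_cnj_diff)
  also have "\<dots> = (\<integral>x. f x * cnj (f x) - f x * cnj (P x) - P x * cnj (f x) + P x * cnj (P x) \<partial>torus)"
    by (simp add: algebra_simps)
  also have "\<dots> = of_real (\<integral>x. (norm (f x))\<^sup>2 \<partial>torus) - of_real S - of_real S + of_real S"
    by (simp only: Bochner_Integration.integral_add Bochner_Integration.integral_diff
        Bochner_Integration.integrable_add Bochner_Integration.integrable_diff i ff fP Pf PP)
  finally have "complex_of_real (\<integral>x. (norm (f x - P x))\<^sup>2 \<partial>torus)
      = of_real ((\<integral>x. (norm (f x))\<^sup>2 \<partial>torus) - S)" by simp
  then have "(\<integral>x. (norm (f x - P x))\<^sup>2 \<partial>torus) = (\<integral>x. (norm (f x))\<^sup>2 \<partial>torus) - S"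
    by (simp only: of_real_eq_iff)
  moreover have "0 \<le> (\<integral>x. (norm (f x - P x))\<^sup>2 \<partial>torus)"
    by (rule Bochner_Integration.integral_nonneg) simp
  ultimately show ?thesis by (simp add: S_def c_def)
qed

section \<open>From the Lorentz norm to the Theta norm of the Fourier coefficients\<close>

lemma fun_rearr_measurable:
  "f \<in> borel_measurable torus \<Longrightarrow> fun_rearr f \<in> borel_measurable borel"
  unfolding fun_rearr_def by (intro rearr_measurable) measurable

lemma fun_rearr_antimono: "s \<le> t \<Longrightarrow> fun_rearr f t \<le> fun_rearr f s"
  unfolding fun_rearr_def by (rule rearr_antimono)

lemma nn_integral_fun_rearr:
  assumes f: "f \<in> borel_measurable torus" and \<Phi>: "\<Phi> \<in> borel_measurable borel"
  shows "(\<integral>\<^sup>+ x. \<Phi> (ennreal (norm (f x))) \<partial>torus) = (\<integral>\<^sup>+ t\<in>{0<..<1}. \<Phi> (fun_rearr f t) \<partial>lborel)"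
proof -
  have "(\<lambda>x. ennreal (norm (f x))) \<in> borel_measurable torus" using f by measurable
  then show ?thesis
    unfolding fun_rearr_def by (rule nn_integral_rearr[OF prob_space_torus _ \<Phi>])
qed

lemma mult_fun_rearr_le:
  assumes "0 < t" shows "ennreal t * fun_rearr f t \<le> (\<integral>\<^sup>+ u\<in>{0<..<t}. fun_rearr f u \<partial>lborel)"
proof -
  have "ennreal t * fun_rearr f t = (\<integral>\<^sup>+ u\<in>{0<..<t}. fun_rearr f t \<partial>lborel)"
    using assms by (simp add: nn_integral_cmult_indicator mult.commute)
  also have "\<dots> \<le> (\<integral>\<^sup>+ u\<in>{0<..<t}. fun_rearr f u \<partial>lborel)"
    by (intro nn_integral_mono) (auto split: split_indicator intro: fun_rearr_antimono)
  finally show ?thesis .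
qed

lemma ennreal_inverse_cancel: "0 < t \<Longrightarrow> ennreal (1 / t) * (ennreal t * x) = x"
  by (simp flip: mult.assoc ennreal_mult)

lemma ennreal_inverse_cancel': "0 < t \<Longrightarrow> ennreal t * (ennreal (1 / t) * x) = x"
  by (simp flip: mult.assoc ennreal_mult)

lemma fun_rearr_le_max_rearr:
  assumes "0 < t" shows "fun_rearr f t \<le> max_rearr f t"
  using mult_left_mono[OF mult_fun_rearr_le[OF assms], of "ennreal (1 / t)" f] assms
  by (simp add: max_rearr_def ennreal_inverse_cancel)

text \<open>On \<open>(s, t)\<close> the rearrangement is at most \<open>f\<^sup>*(s)\<close>, hence at most its average over \<open>(0, s)\<close>, so extending the
  interval cannot raise the average.\<close>

lemma max_rearr_antimono:
  assumes f: "f \<in> borel_measurable torus" and st: "0 < s" "s \<le> t"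
  shows "max_rearr f t \<le> max_rearr f s"
proof -
  note [measurable] = fun_rearr_measurable[OF f]
  let ?R = "\<lambda>t. \<integral>\<^sup>+ u\<in>{0<..<t}. fun_rearr f u \<partial>lborel"
  have "?R t \<le> (\<integral>\<^sup>+ u. fun_rearr f u * indicator {0<..<s} u + fun_rearr f s * indicator {s..<t} u \<partial>lborel)"
    by (intro nn_integral_mono) (auto split: split_indicator intro: fun_rearr_antimono)
  also have "\<dots> = ?R s + fun_rearr f s * ennreal (t - s)"
    using st by (subst nn_integral_add) (auto simp: nn_integral_cmult_indicator)
  also have "\<dots> \<le> ?R s + max_rearr f s * ennreal (t - s)"
    using st by (intro add_left_mono mult_right_mono fun_rearr_le_max_rearr) auto
  also have "?R s = max_rearr f s * ennreal s"
    using st by (simp add: max_rearr_def mult.commute[of _ "ennreal s"] ennreal_inverse_cancel')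
  also have "max_rearr f s * ennreal s + max_rearr f s * ennreal (t - s) = max_rearr f s * ennreal t"
    using st by (simp flip: distrib_left ennreal_plus)
  finally have "ennreal (1 / t) * ?R t \<le> ennreal (1 / t) * (ennreal t * max_rearr f s)"
    by (intro mult_left_mono) (simp_all add: mult.commute)
  then show ?thesis
    using st ennreal_inverse_cancel[of t] by (simp add: max_rearr_def)
qed

text \<open>Integrability makes the splitting height in the estimate of the Fourier coefficients a real number.\<close>

lemma fun_rearr_finite:
  assumes f: "integrable torus f" and t: "0 < t" "t \<le> 1"
  shows "fun_rearr f t < top"
proof -
  have "ennreal t * fun_rearr f t \<le> (\<integral>\<^sup>+ u\<in>{0<..<t}. fun_rearr f u \<partial>lborel)"
    using t by (intro mult_fun_rearr_le)
  also have "\<dots> \<le> (\<integral>\<^sup>+ u\<in>{0<..<1}. fun_rearr f u \<partial>lborel)"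
    using t by (intro nn_integral_mono) (auto split: split_indicator)
  also have "\<dots> = (\<integral>\<^sup>+ x. ennreal (norm (f x)) \<partial>torus)"
    using f by (intro nn_integral_fun_rearr[of f "\<lambda>y. y", symmetric]) auto
  also have "\<dots> < top" using f by (simp add: integrable_iff_bounded)
  finally show ?thesis using t by (auto simp: ennreal_mult_less_top)
qed

text \<open>The integrand \<open>t\<^sup>1\<^sup>/\<^sup>2 f\<^sup>*\<^sup>*(t)\<close> of the Lorentz norm, sampled at \<open>t = 2\<^sup>-\<^sup>i\<close>.\<close>

definition lorentz_sample :: "(real \<Rightarrow> complex) \<Rightarrow> nat \<Rightarrow> ennreal" where
  "lorentz_sample f i = ennreal (sqrt (1 / 2 ^ i)) * max_rearr f (1 / 2 ^ i)"

lemma lorentz_sample_square: "(lorentz_sample f i)\<^sup>2 = ennreal (1 / 2 ^ i) * (max_rearr f (1 / 2 ^ i))\<^sup>2"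
  by (simp add: lorentz_sample_def power_mult_distrib ennreal_power)

lemma fun_rearr_tail_square:
  assumes f: "f \<in> borel_measurable torus"
  shows "(\<integral>\<^sup>+ t\<in>{1 / 2 ^ m<..<1}. (fun_rearr f t)\<^sup>2 \<partial>lborel) \<le> (\<Sum>i<m. (lorentz_sample f (Suc i))\<^sup>2)"
proof -
  note [measurable] = fun_rearr_measurable[OF f]
  have "(\<integral>\<^sup>+ t\<in>{1 / 2 ^ m<..1}. (fun_rearr f t)\<^sup>2 \<partial>lborel) \<le> (\<Sum>i<m. (lorentz_sample f (Suc i))\<^sup>2)"
  proof (induction m)
    case (Suc m)
    define s where "s = 1 / (2::real) ^ Suc m"
    have s: "1 / 2 ^ m = 2 * s" "0 < s" by (simp_all add: s_def)
    have "(\<integral>\<^sup>+ t\<in>{s<..1}. (fun_rearr f t)\<^sup>2 \<partial>lborel)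
        \<le> (\<integral>\<^sup>+ t. (fun_rearr f t)\<^sup>2 * indicator {1 / 2 ^ m<..1} t + (fun_rearr f s)\<^sup>2 * indicator {s<..2 * s} t \<partial>lborel)"
      unfolding s(1)
      by (intro nn_integral_mono)
        (auto split: split_indicator intro!: power_mono_ennreal fun_rearr_antimono)
    also have "\<dots> = (\<integral>\<^sup>+ t\<in>{1 / 2 ^ m<..1}. (fun_rearr f t)\<^sup>2 \<partial>lborel) + (fun_rearr f s)\<^sup>2 * ennreal s"
      using s(2) by (subst nn_integral_add) (auto simp: nn_integral_cmult_indicator)
    also have "\<dots> \<le> (\<Sum>i<m. (lorentz_sample f (Suc i))\<^sup>2) + (max_rearr f s)\<^sup>2 * ennreal s"
      using s by (intro add_mono Suc.IH mult_right_mono power_mono_ennreal fun_rearr_le_max_rearr) auto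
    also have "\<dots> = (\<Sum>i<Suc m. (lorentz_sample f (Suc i))\<^sup>2)"
      by (simp add: lorentz_sample_square mult.commute s_def)
    finally show ?case unfolding s_def .
  qed simp
  moreover have "(\<integral>\<^sup>+ t\<in>{1 / 2 ^ m<..<1}. (fun_rearr f t)\<^sup>2 \<partial>lborel) \<le> (\<integral>\<^sup>+ t\<in>{1 / 2 ^ m<..1}. (fun_rearr f t)\<^sup>2 \<partial>lborel)"
    by (intro nn_integral_mono) (auto split: split_indicator)
  ultimately show ?thesis by (rule order_trans[rotated])
qed

lemma norm_fourier_coeff_le:
  assumes "integrable torus f"
  shows "ennreal (norm (fourier_coeff f n)) \<le> (\<integral>\<^sup>+ x. ennreal (norm (f x)) \<partial>torus)"
proof -
  have [measurable]: "f \<in> borel_measurable torus" using assms by auto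
  note [measurable] = character_measurable
  have "integrable torus (\<lambda>x. f x * character n x)"
    using assms by (rule Bochner_Integration.integrable_bound) (measurable, auto simp: norm_mult)
  then have "ennreal (norm (fourier_coeff f n)) \<le> (\<integral>\<^sup>+ x. ennreal (norm (f x * character n x)) \<partial>torus)"
    unfolding fourier_coeff_character by (rule integral_norm_bound_ennreal)
  then show ?thesis by (simp add: norm_mult)
qed

lemma fourier_coeff_add:
  assumes "integrable torus f" "integrable torus g"
  shows "fourier_coeff (\<lambda>x. f x + g x) n = fourier_coeff f n + fourier_coeff g n"
proof -
  note [measurable] = character_measurable
  have i: "integrable torus (\<lambda>x. h x * character n x)" if h: "integrable torus h" for h :: "real \<Rightarrow> complex"
  proof (rule Bochner_Integration.integrable_bound[OF h])
    have [measurable]: "h \<in> borel_measurable torus" using h by auto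
    show "(\<lambda>x. h x * character n x) \<in> borel_measurable torus" by measurable
  qed (auto simp: norm_mult)
  show ?thesis
    unfolding fourier_coeff_character distrib_right
    by (rule Bochner_Integration.integral_add[OF i[OF assms(1)] i[OF assms(2)]])
qed

text \<open>Split \<open>f\<close> at the height \<open>L = f\<^sup>*(2\<^sup>-\<^sup>m)\<close>. The part above \<open>L\<close> lives on a set of measure at most \<open>2\<^sup>-\<^sup>m\<close>, and its at
  most \<open>2\<^sup>m\<close> coefficients are bounded by its \<open>L\<^sup>1\<close> norm. The part below \<open>L\<close> is treated by Bessel's
  inequality. Equimeasurability turns both norms into integrals of \<open>f\<^sup>*\<close>.\<close>

lemma sum_fourier_coeff_square_le:
  assumes int: "integrable torus f" and E: "finite E" "card E \<le> 2 ^ m"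
  shows "(\<Sum>n\<in>E. (ennreal (norm (fourier_coeff f n)))\<^sup>2) \<le> 6 * (\<Sum>i<Suc m. (lorentz_sample f i)\<^sup>2)"
proof -
  have f [measurable]: "f \<in> borel_measurable torus" using int by auto
  note [measurable] = fun_rearr_measurable[OF f]
  define \<tau> where "\<tau> = 1 / (2::real) ^ m"
  have \<tau>: "0 < \<tau>" "\<tau> \<le> 1" by (simp_all add: \<tau>_def divide_le_eq)
  define L where "L = fun_rearr f \<tau>"
  have "L < top" unfolding L_def by (rule fun_rearr_finite[OF int \<tau>])
  then obtain l where l: "L = ennreal l" "0 \<le> l" by (cases L) auto
  define f0 where "f0 x = (if norm (f x) \<le> l then f x else 0)" for x
  define f1 where "f1 x = (if norm (f x) \<le> l then 0 else f x)" for x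
  have [measurable]: "f0 \<in> borel_measurable torus" "f1 \<in> borel_measurable torus"
    unfolding f0_def f1_def by measurable
  have f0: "norm (f0 x) \<le> l" for x using l by (simp add: f0_def)
  have int0: "integrable torus f0" by (rule integrable_torus_bounded[of _ l]) (measurable, rule f0)
  have int1: "integrable torus f1"
    using int by (rule Bochner_Integration.integrable_bound) (measurable, auto simp: f1_def)
  have split: "fourier_coeff f n = fourier_coeff f0 n + fourier_coeff f1 n" for n
  proof -
    have "f = (\<lambda>x. f0 x + f1 x)" by (auto simp: f0_def f1_def)
    then show ?thesis using fourier_coeff_add[OF int0 int1, of n] by simp
  qed
  let ?a = "lorentz_sample f"
  \<comment> \<open>The part above the height \<open>L\<close>, in \<open>L\<^sup>1\<close>.\<close>
  define J where "J = (\<integral>\<^sup>+ x. ennreal (norm (f1 x)) \<partial>torus)"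
  have "J = (\<integral>\<^sup>+ x. (\<lambda>y. if y \<le> L then 0 else y) (ennreal (norm (f x))) \<partial>torus)"
    unfolding J_def by (intro nn_integral_cong) (auto simp: f1_def l)
  also have "\<dots> = (\<integral>\<^sup>+ t\<in>{0<..<1}. (if fun_rearr f t \<le> L then 0 else fun_rearr f t) \<partial>lborel)"
    by (rule nn_integral_fun_rearr[OF f]) measurable
  also have "\<dots> \<le> (\<integral>\<^sup>+ t\<in>{0<..<\<tau>}. fun_rearr f t \<partial>lborel)"
    using fun_rearr_antimono[of \<tau> _ f]
    by (intro nn_integral_mono) (auto simp: L_def not_less split: split_indicator)
  finally have "ennreal (1 / \<tau>) * J \<le> max_rearr f \<tau>"
    unfolding max_rearr_def by (rule mult_left_mono) simp
  then have "(ennreal (1 / \<tau>) * J)\<^sup>2 \<le> (max_rearr f \<tau>)\<^sup>2" by (rule power_mono_ennreal)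
  then have "ennreal \<tau> * (ennreal (1 / \<tau>) * J)\<^sup>2 \<le> (?a m)\<^sup>2"
    unfolding lorentz_sample_square \<tau>_def[symmetric] by (rule mult_left_mono) simp
  also have "ennreal \<tau> * (ennreal (1 / \<tau>) * J)\<^sup>2 = ennreal (1 / \<tau>) * J\<^sup>2"
    using \<tau> by (simp add: power2_eq_square mult_ac ennreal_inverse_cancel' flip: mult.assoc[of "ennreal \<tau>"] ennreal_mult)
  finally have J: "ennreal (1 / \<tau>) * J\<^sup>2 \<le> (?a m)\<^sup>2" .
  have "(\<Sum>n\<in>E. (ennreal (norm (fourier_coeff f1 n)))\<^sup>2) \<le> (\<Sum>n\<in>E. J\<^sup>2)"
    unfolding J_def by (intro sum_mono power_mono_ennreal norm_fourier_coeff_le int1)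
  also have "\<dots> = ennreal (real (card E)) * J\<^sup>2" by (simp add: ennreal_of_nat_eq_real_of_nat)
  also have "\<dots> \<le> ennreal (1 / \<tau>) * J\<^sup>2"
    using of_nat_mono[OF E(2), where 'a = real]
    by (intro mult_right_mono ennreal_leI) (auto simp: \<tau>_def)
  also note J
  finally have part1: "(\<Sum>n\<in>E. (ennreal (norm (fourier_coeff f1 n)))\<^sup>2) \<le> (?a m)\<^sup>2" .
  \<comment> \<open>The part below the height \<open>L\<close>, in \<open>L\<^sup>2\<close>.\<close>
  have "(\<Sum>n\<in>E. (ennreal (norm (fourier_coeff f0 n)))\<^sup>2) = ennreal (\<Sum>n\<in>E. (norm (fourier_coeff f0 n))\<^sup>2)"
    by (simp add: ennreal_power)
  also have "\<dots> \<le> ennreal (\<integral>x. (norm (f0 x))\<^sup>2 \<partial>torus)"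
    by (intro ennreal_leI bessel_inequality[OF _ f0 E(1)]) measurable
  also have "\<dots> = (\<integral>\<^sup>+ x. ennreal ((norm (f0 x))\<^sup>2) \<partial>torus)"
  proof (rule nn_integral_eq_integral[symmetric])
    interpret prob_space torus by (rule prob_space_torus)
    show "integrable torus (\<lambda>x. (norm (f0 x))\<^sup>2)"
      by (rule integrable_const_bound[of _ "l\<^sup>2"]) ((auto intro!: power_mono f0)[1], measurable)
  qed simp
  also have "\<dots> = (\<integral>\<^sup>+ x. (\<lambda>y. if y \<le> L then y\<^sup>2 else 0) (ennreal (norm (f x))) \<partial>torus)"
    by (intro nn_integral_cong) (auto simp: f0_def l ennreal_power)
  also have "\<dots> = (\<integral>\<^sup>+ t\<in>{0<..<1}. (if fun_rearr f t \<le> L then (fun_rearr f t)\<^sup>2 else 0) \<partial>lborel)"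
    by (rule nn_integral_fun_rearr[OF f]) measurable
  also have "\<dots> \<le> (\<integral>\<^sup>+ t. L\<^sup>2 * indicator {0<..\<tau>} t + (fun_rearr f t)\<^sup>2 * indicator {\<tau><..<1} t \<partial>lborel)"
    by (intro nn_integral_mono) (auto split: split_indicator intro: power_mono_ennreal)
  also have "\<dots> = L\<^sup>2 * ennreal \<tau> + (\<integral>\<^sup>+ t\<in>{\<tau><..<1}. (fun_rearr f t)\<^sup>2 \<partial>lborel)"
    using \<tau> by (subst nn_integral_add) (auto simp: nn_integral_cmult_indicator)
  also have "\<dots> \<le> (?a m)\<^sup>2 + (\<Sum>i<m. (?a (Suc i))\<^sup>2)"
  proof (rule add_mono)
    have "L\<^sup>2 * ennreal \<tau> \<le> (max_rearr f \<tau>)\<^sup>2 * ennreal \<tau>"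
      unfolding L_def using \<tau> by (intro mult_right_mono power_mono_ennreal fun_rearr_le_max_rearr) auto
    then show "L\<^sup>2 * ennreal \<tau> \<le> (?a m)\<^sup>2"
      by (simp add: lorentz_sample_square \<tau>_def mult.commute)
  qed (unfold \<tau>_def, rule fun_rearr_tail_square[OF f])
  finally have part0: "(\<Sum>n\<in>E. (ennreal (norm (fourier_coeff f0 n)))\<^sup>2) \<le> (?a m)\<^sup>2 + (\<Sum>i<m. (?a (Suc i))\<^sup>2)" .
  let ?S = "\<Sum>i<Suc m. (?a i)\<^sup>2"
  have S: "(?a m)\<^sup>2 \<le> ?S" by (intro member_le_sum) auto
  have S': "(\<Sum>i<m. (?a (Suc i))\<^sup>2) \<le> ?S" unfolding sum.lessThan_Suc_shift by simp
  have "(\<Sum>n\<in>E. (ennreal (norm (fourier_coeff f n)))\<^sup>2)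
      \<le> (\<Sum>n\<in>E. 2 * (ennreal (norm (fourier_coeff f0 n)))\<^sup>2 + 2 * (ennreal (norm (fourier_coeff f1 n)))\<^sup>2)"
  proof (rule sum_mono)
    fix n
    have "(norm (fourier_coeff f n))\<^sup>2 \<le> (norm (fourier_coeff f0 n) + norm (fourier_coeff f1 n))\<^sup>2"
      unfolding split by (intro power_mono norm_triangle_ineq) auto
    also have "\<dots> \<le> 2 * (norm (fourier_coeff f0 n))\<^sup>2 + 2 * (norm (fourier_coeff f1 n))\<^sup>2"
      using zero_le_power2[of "norm (fourier_coeff f0 n) - norm (fourier_coeff f1 n)"]
      by (simp add: power2_eq_square algebra_simps)
    finally show "(ennreal (norm (fourier_coeff f n)))\<^sup>2
      \<le> 2 * (ennreal (norm (fourier_coeff f0 n)))\<^sup>2 + 2 * (ennreal (norm (fourier_coeff f1 n)))\<^sup>2"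
      by (simp add: ennreal_power ennreal_mult'[symmetric] flip: ennreal_plus ennreal_numeral)
  qed
  also have "\<dots> \<le> 2 * ((?a m)\<^sup>2 + (\<Sum>i<m. (?a (Suc i))\<^sup>2)) + 2 * (?a m)\<^sup>2"
    unfolding sum.distrib sum_distrib_left[symmetric] by (intro add_mono mult_left_mono part0 part1) auto
  also have "\<dots> \<le> 2 * (?S + ?S) + 2 * ?S"
    by (intro add_mono mult_left_mono S S') auto
  also have "\<dots> = 6 * ?S" by (simp only: mult_2[symmetric] mult.assoc[symmetric] distrib_right[symmetric]) simp
  finally show ?thesis .
qed

lemma dyadic_mean_fourier_coeff_le:
  assumes "integrable torus f"
  shows "dyadic_mean (\<lambda>n. ennreal (norm (fourier_coeff f n))) m \<le> ennreal (sqrt 6) * quadratic_mean (lorentz_sample f) m"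
proof -
  have "top_l2 (2 ^ m) (\<lambda>n. ennreal (norm (fourier_coeff f n))) \<le> epowr (6 * (\<Sum>i<Suc m. (lorentz_sample f i)\<^sup>2)) (1 / 2)"
    unfolding top_l2_eq_SUP
    by (intro SUP_least epowr_mono sum_fourier_coeff_square_le assms) auto
  also have "\<dots> = ennreal (sqrt 6) * epowr (\<Sum>i<Suc m. (lorentz_sample f i)\<^sup>2) (1 / 2)"
    using epowr_ennreal[of 6 "1/2"] by (subst epowr_mult) (simp_all add: powr_half_sqrt)
  finally show ?thesis
    unfolding dyadic_mean_def quadratic_mean_def mult.left_commute[of "ennreal (sqrt 6)"]
    by (rule mult_left_mono) simp
qed

lemma max_rearr_measurable:
  assumes "f \<in> borel_measurable torus" shows "max_rearr f \<in> borel_measurable borel"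
proof -
  note [measurable] = fun_rearr_measurable[OF assms]
  have "(\<lambda>t. ennreal (1 / t) * (\<integral>\<^sup>+ u. fun_rearr f u * (if 0 < u \<and> u < t then 1 else 0) \<partial>lborel)) \<in> borel_measurable borel"
    by measurable
  moreover have "max_rearr f = (\<lambda>t. ennreal (1 / t) * (\<integral>\<^sup>+ u. fun_rearr f u * (if 0 < u \<and> u < t then 1 else 0) \<partial>lborel))"
    by (auto simp: fun_eq_iff max_rearr_def indicator_def of_bool_def intro!: arg_cong2[of _ _ _ _ times] nn_integral_cong)
  ultimately show ?thesis by simp
qed

lemma sum_dyadic_integrals_le:
  fixes G :: "real \<Rightarrow> ennreal"
  assumes [measurable]: "G \<in> borel_measurable borel"
  shows "(\<Sum>i<m. \<integral>\<^sup>+ t\<in>{1 / 2 ^ Suc i<..<1 / 2 ^ i}. G t \<partial>lborel) \<le> (\<integral>\<^sup>+ t\<in>{1 / 2 ^ m<..<1}. G t \<partial>lborel)"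
proof (induction m)
  case (Suc m)
  define s where "s = 1 / (2::real) ^ Suc m"
  have s: "1 / 2 ^ m = 2 * s" "0 < s" by (simp_all add: s_def)
  have "2 * s \<le> 1" unfolding s(1)[symmetric] by (simp add: divide_le_eq)
  have "(\<Sum>i<Suc m. \<integral>\<^sup>+ t\<in>{1 / 2 ^ Suc i<..<1 / 2 ^ i}. G t \<partial>lborel)
      \<le> (\<integral>\<^sup>+ t\<in>{1 / 2 ^ m<..<1}. G t \<partial>lborel) + (\<integral>\<^sup>+ t\<in>{s<..<1 / 2 ^ m}. G t \<partial>lborel)"
    unfolding sum.lessThan_Suc s_def by (intro add_right_mono Suc.IH)
  also have "\<dots> = (\<integral>\<^sup>+ t. G t * indicator {1 / 2 ^ m<..<1} t + G t * indicator {s<..<1 / 2 ^ m} t \<partial>lborel)"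
    by (intro nn_integral_add[symmetric]) measurable
  also have "\<dots> \<le> (\<integral>\<^sup>+ t\<in>{s<..<1}. G t \<partial>lborel)"
    unfolding s(1) using s(2) \<open>2 * s \<le> 1\<close>
    by (intro nn_integral_mono) (auto split: split_indicator)
  finally show ?case unfolding s_def .
qed simp

text \<open>As \<open>f\<^sup>*\<^sup>*\<close> is non-increasing, the sample at \<open>2\<^sup>-\<^sup>i\<close> is at most twice the integrand anywhere on
  \<open>(2\<^sup>-\<^sup>i\<^sup>-\<^sup>1, 2\<^sup>-\<^sup>i)\<close>, an interval of \<open>dt / t\<close>-measure at least \<open>1/2\<close>.\<close>

lemma seq_norm_lorentz_sample_le:
  assumes p: "2 < p" and f: "f \<in> borel_measurable torus"
  shows "seq_norm p (lorentz_sample f) \<le> 4 * lorentz_norm 2 p f"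
proof -
  note [measurable] = max_rearr_measurable[OF f]
  define F where "F t = ennreal (t powr (1 / 2)) * max_rearr f t" for t
  have [measurable]: "F \<in> borel_measurable borel" unfolding F_def by measurable
  have sample: "lorentz_sample f i \<le> 2 * F t" if t: "1 / 2 ^ Suc i < t" "t < 1 / 2 ^ i" for i t
  proof -
    have t0: "0 < t" using t(1) by (rule less_trans[rotated]) simp
    have "1 / 2 ^ i \<le> 4 * t" using t(1) t0 by simp
    then have "sqrt (1 / 2 ^ i) \<le> sqrt (4 * t)" by (rule real_sqrt_le_mono)
    then have "sqrt (1 / 2 ^ i) \<le> 2 * t powr (1 / 2)"
      using t0 by (simp add: real_sqrt_mult powr_half_sqrt)
    then have "lorentz_sample f i \<le> ennreal (2 * t powr (1 / 2)) * max_rearr f t"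
      unfolding lorentz_sample_def using t t0
      by (intro mult_mono ennreal_leI max_rearr_antimono f) auto
    then show ?thesis by (simp add: F_def ennreal_mult mult.assoc)
  qed
  show ?thesis
  proof (cases "p = \<infinity>")
    case True
    have "lorentz_sample f i \<le> 4 * (SUP t\<in>{0<..<1}. F t)" for i
    proof -
      let ?t = "3 / 4 / 2 ^ i :: real"
      have t: "1 / 2 ^ Suc i < ?t" "?t < 1 / 2 ^ i" "0 < ?t" by (simp_all add: divide_simps)
      have "?t < 1" using t(2) by (rule less_le_trans) (simp add: divide_le_eq)
      have "lorentz_sample f i \<le> 2 * F ?t" by (rule sample[OF t(1,2)])
      also have "\<dots> \<le> 4 * (SUP t\<in>{0<..<1}. F t)"
        using t(3) \<open>?t < 1\<close> by (intro mult_mono SUP_upper) auto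
      finally show ?thesis .
    qed
    with True show ?thesis
      by (auto simp: seq_norm_def lorentz_norm_def F_def intro!: SUP_least)
  next
    case False
    let ?p = "enn2real p"
    have p2: "2 < ?p" using enn2real_gt_2[OF p False] .
    define G where "G t = epowr (F t) ?p * ennreal (1 / t)" for t
    have [measurable]: "G \<in> borel_measurable borel" unfolding G_def by measurable
    have step: "epowr (lorentz_sample f i) ?p \<le> epowr 4 ?p * (\<integral>\<^sup>+ t\<in>{1 / 2 ^ Suc i<..<1 / 2 ^ i}. G t \<partial>lborel)" for i
    proof -
      let ?J = "{1 / 2 ^ Suc i<..<1 / 2 ^ i :: real}"
      let ?s = "epowr (lorentz_sample f i) ?p"
      have "?s * ennreal (2 ^ i) \<le> epowr 2 ?p * G t" if t: "t \<in> ?J" for t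
      proof -
        have t': "1 / 2 ^ Suc i < t" "t < 1 / 2 ^ i" using t by auto
        have t0: "0 < t" using t'(1) by (rule less_trans[rotated]) simp
        have "?s \<le> epowr (2 * F t) ?p"
          using sample[OF t'] p2 by (intro epowr_mono) auto
        moreover have "2 ^ i \<le> 1 / t"
          using t' t0 by (simp add: field_simps)
        ultimately have "?s * ennreal (2 ^ i) \<le> epowr (2 * F t) ?p * ennreal (1 / t)"
          by (intro mult_mono ennreal_leI) auto
        then show ?thesis using p2 by (simp add: G_def epowr_mult mult.assoc)
      qed
      then have "(\<integral>\<^sup>+ t\<in>?J. ?s * ennreal (2 ^ i) \<partial>lborel) \<le> (\<integral>\<^sup>+ t. epowr 2 ?p * (G t * indicator ?J t) \<partial>lborel)"
        by (intro nn_integral_mono) (auto split: split_indicator)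
      also have "\<dots> = epowr 2 ?p * (\<integral>\<^sup>+ t\<in>?J. G t \<partial>lborel)"
        by (rule nn_integral_cmult) measurable
      also have "(\<integral>\<^sup>+ t\<in>?J. ?s * ennreal (2 ^ i) \<partial>lborel) = ?s * ennreal (1 / 2)"
      proof -
        have "(\<integral>\<^sup>+ t\<in>?J. ?s * ennreal (2 ^ i) \<partial>lborel) = ?s * ennreal (2 ^ i) * emeasure lborel ?J"
          by (rule nn_integral_cmult_indicator) simp
        also have "emeasure lborel ?J = ennreal (1 / 2 ^ Suc i)"
          by (subst emeasure_lborel_Ioo) (auto simp: divide_simps intro!: arg_cong[of _ _ ennreal])
        finally show ?thesis
          by (simp add: mult.assoc flip: ennreal_mult del: ennreal_half)
      qed
      finally have le: "2 * (?s * ennreal (1 / 2)) \<le> 2 * (epowr 2 ?p * (\<integral>\<^sup>+ t\<in>?J. G t \<partial>lborel))"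
        by (rule mult_left_mono) simp
      have "(2::real) powr 1 \<le> 2 powr ?p" using p2 by (intro powr_mono) auto
      then have two: "(2::ennreal) \<le> epowr 2 ?p"
        using epowr_ennreal[of 2 ?p] ennreal_leI[of 2 "2 powr ?p"] by simp
      have "?s = 2 * (?s * ennreal (1 / 2))"
        using ennreal_mult[of 2 "1/2"] by (simp add: mult.left_commute[of 2])
      also note le
      also have "2 * (epowr 2 ?p * (\<integral>\<^sup>+ t\<in>?J. G t \<partial>lborel))
          \<le> epowr 2 ?p * (epowr 2 ?p * (\<integral>\<^sup>+ t\<in>?J. G t \<partial>lborel))"
        using two by (rule mult_right_mono) simp
      also have "\<dots> = epowr 4 ?p * (\<integral>\<^sup>+ t\<in>?J. G t \<partial>lborel)"
        using epowr_mult[of ?p 2 2] p2 by (simp flip: mult.assoc)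
      finally show ?thesis .
    qed
    have "(\<Sum>i<m. epowr (lorentz_sample f i) ?p) \<le> epowr 4 ?p * (\<integral>\<^sup>+ t\<in>{0<..<1}. G t \<partial>lborel)" for m
    proof -
      have "(\<Sum>i<m. epowr (lorentz_sample f i) ?p)
          \<le> epowr 4 ?p * (\<Sum>i<m. \<integral>\<^sup>+ t\<in>{1 / 2 ^ Suc i<..<1 / 2 ^ i}. G t \<partial>lborel)"
        unfolding sum_distrib_left by (intro sum_mono step)
      also have "\<dots> \<le> epowr 4 ?p * (\<integral>\<^sup>+ t\<in>{1 / 2 ^ m<..<1}. G t \<partial>lborel)"
        by (intro mult_left_mono sum_dyadic_integrals_le) auto
      also have "\<dots> \<le> epowr 4 ?p * (\<integral>\<^sup>+ t\<in>{0<..<1}. G t \<partial>lborel)"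
        by (intro mult_left_mono nn_integral_mono) (auto split: split_indicator intro: less_trans[of 0 "1 / 2 ^ m"])
      finally show ?thesis .
    qed
    then have "(\<Sum>i. epowr (lorentz_sample f i) ?p) \<le> epowr 4 ?p * (\<integral>\<^sup>+ t\<in>{0<..<1}. G t \<partial>lborel)"
      by (intro suminf_le_const) auto
    then have "seq_norm p (lorentz_sample f) \<le> epowr (epowr 4 ?p * (\<integral>\<^sup>+ t\<in>{0<..<1}. G t \<partial>lborel)) (1 / ?p)"
      using False p2 by (auto simp: seq_norm_def intro!: epowr_mono)
    also have "\<dots> = 4 * lorentz_norm 2 p f"
      using False p2 by (simp add: epowr_mult epowr_epowr lorentz_norm_def G_def F_def)
    finally show ?thesis .
  qed
qed

theorem fourier_bounded_Theta:
  assumes p: "2 < p" shows "fourier_bounded (Theta_norm p) (lorentz_norm 2 p)"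
proof -
  obtain C where C: "0 < C" "\<And>a. seq_norm p (quadratic_mean a) \<le> ennreal C * seq_norm p a"
    using hardy_seq_norm[OF p] by blast
  define K where "K = sqrt 5 * (sqrt 6 * (C * 4))"
  have "Theta_norm p (\<lambda>n. ennreal (norm (fourier_coeff f n))) \<le> ennreal K * lorentz_norm 2 p f"
    if f: "integrable torus f" for f
  proof -
    have meas: "f \<in> borel_measurable torus" using f by (rule borel_measurable_integrable)
    have "Theta_norm p (\<lambda>n. ennreal (norm (fourier_coeff f n)))
        \<le> ennreal (sqrt 5) * seq_norm p (dyadic_mean (\<lambda>n. ennreal (norm (fourier_coeff f n))))"
      by (rule Theta_norm_le_dyadic[OF p])
    also have "\<dots> \<le> ennreal (sqrt 5) * seq_norm p (\<lambda>m. ennreal (sqrt 6) * quadratic_mean (lorentz_sample f) m)"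
      by (intro mult_left_mono seq_norm_mono dyadic_mean_fourier_coeff_le f) auto
    also have "\<dots> \<le> ennreal (sqrt 5) * (ennreal (sqrt 6) * (ennreal C * (4 * lorentz_norm 2 p f)))"
      unfolding seq_norm_cmult[OF p]
      by (intro mult_left_mono order_trans[OF C(2)] seq_norm_lorentz_sample_le p meas) auto
    also have "\<dots> = ennreal K * lorentz_norm 2 p f"
      using C by (simp add: K_def ennreal_mult mult.assoc)
    finally show ?thesis .
  qed
  moreover have "0 < K" using C by (simp add: K_def)
  ultimately show ?thesis unfolding fourier_bounded_def by blast
qed

section \<open>The weighted norm dominates the Lorentz norm\<close>

text \<open>The rearrangement is at most \<open>(f\<^sup>* - L) + L\<close>, and the excess \<open>f\<^sup>* - L\<close> (truncated subtraction) has the same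
  integral as \<open>\<bar>f\<bar> - L\<close>. The choice of \<open>L\<close> is free.\<close>

lemma nn_integral_fun_rearr_threshold:
  assumes f: "f \<in> borel_measurable torus" and t: "0 < t" "t \<le> 1"
  shows "(\<integral>\<^sup>+ u\<in>{0<..<t}. fun_rearr f u \<partial>lborel)
    \<le> (\<integral>\<^sup>+ x. (ennreal (norm (f x)) - L) \<partial>torus) + L * ennreal t"
proof -
  note [measurable] = fun_rearr_measurable[OF f]
  have "(\<integral>\<^sup>+ u\<in>{0<..<t}. fun_rearr f u \<partial>lborel)
      \<le> (\<integral>\<^sup>+ u. (fun_rearr f u - L) * indicator {0<..<1} u + L * indicator {0<..<t} u \<partial>lborel)"
    using t by (intro nn_integral_mono) (auto split: split_indicator simp: diff_add_self_ennreal)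
  also have "\<dots> = (\<integral>\<^sup>+ u\<in>{0<..<1}. (fun_rearr f u - L) \<partial>lborel) + L * ennreal t"
    using t by (subst nn_integral_add) (auto simp: nn_integral_cmult_indicator)
  also have "(\<integral>\<^sup>+ u\<in>{0<..<1}. (fun_rearr f u - L) \<partial>lborel) = (\<integral>\<^sup>+ x. (ennreal (norm (f x)) - L) \<partial>torus)"
    by (rule nn_integral_fun_rearr[OF f, of "\<lambda>y. y - L", symmetric]) measurable
  finally show ?thesis .
qed

text \<open>Above the threshold \<open>L\<close> one has \<open>y = y\<^sup>p y\<^sup>1\<^sup>-\<^sup>p \<le> y\<^sup>p L\<^sup>1\<^sup>-\<^sup>p\<close>.\<close>

lemma threshold_le:
  fixes y L p :: real
  assumes "0 \<le> y" "0 < L" "1 < p" shows "y \<le> L + y powr p * L powr (1 - p)"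
proof (cases "y \<le> L")
  case False
  then have "y = y powr p * y powr (1 - p)" using assms by (simp flip: powr_add)
  also have "\<dots> \<le> y powr p * L powr (1 - p)"
    using False assms by (intro mult_left_mono powr_mono2') auto
  finally show ?thesis using assms by simp
qed (use assms in \<open>auto simp: add_increasing2\<close>)

lemma AE_torus_nonzero: "AE x in torus. x \<noteq> 0"
proof -
  have "AE x in lebesgue. x \<noteq> (0::real)"
    by (rule AE_completion) (rule AE_lborel_singleton)
  then show ?thesis by (subst AE_restrict_space_iff) auto
qed

lemma nn_integral_torus:
  assumes "g \<in> borel_measurable borel"
  shows "(\<integral>\<^sup>+ x. g x \<partial>torus) = (\<integral>\<^sup>+ x\<in>{-1/2..1/2}. g x \<partial>lborel)"
  by (subst nn_integral_restrict_space) (simp_all add: nn_integral_completion)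

lemma nn_integral_inverse_sqrt:
  assumes "0 < t"
  shows "(\<integral>\<^sup>+ x\<in>{x. \<bar>x\<bar> < t}. ennreal (\<bar>x\<bar> powr (- (1 / 2))) \<partial>torus) \<le> ennreal (4 * sqrt t)"
proof -
  let ?g = "\<lambda>x::real. ennreal (\<bar>x\<bar> powr (- (1 / 2)))"
  have pos: "(\<integral>\<^sup>+ x. ?g x * indicator {0..t} x \<partial>lborel) = ennreal (2 * sqrt t)"
  proof -
    have "(\<integral>\<^sup>+ x. ?g x * indicator {0..t} x \<partial>lborel)
        = (\<integral>\<^sup>+ x. ennreal (x powr (- (1 / 2))) * indicator {0..t} x \<partial>lborel)"
      by (intro nn_integral_cong) (auto split: split_indicator)
    also have "\<dots> = ennreal (t powr (- (1 / 2) + 1) / (- (1 / 2) + 1))"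
      using assms by (intro nn_integral_has_integral_lebesgue' has_integral_powr_from_0) auto
    finally show ?thesis using assms by (simp add: powr_half_sqrt mult.commute)
  qed
  have neg: "(\<integral>\<^sup>+ x. ?g x * indicator {-t..0} x \<partial>lborel) = ennreal (2 * sqrt t)"
  proof -
    have "(\<integral>\<^sup>+ x. ?g x * indicator {-t..0} x \<partial>lborel)
        = ennreal \<bar>-1\<bar> * (\<integral>\<^sup>+ x. ?g (0 + (-1) * x) * indicator {-t..0} (0 + (-1) * x) \<partial>lborel)"
      by (rule nn_integral_real_affine) auto
    also have "\<dots> = (\<integral>\<^sup>+ x. ?g x * indicator {0..t} x \<partial>lborel)"
      by (auto intro!: nn_integral_cong split: split_indicator)
    finally show ?thesis using pos by simp
  qed
  have "(\<integral>\<^sup>+ x\<in>{x. \<bar>x\<bar> < t}. ?g x \<partial>torus) = (\<integral>\<^sup>+ x\<in>{-1/2..1/2}. ?g x * indicator {x. \<bar>x\<bar> < t} x \<partial>lborel)"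
    by (rule nn_integral_torus) measurable
  also have "\<dots> \<le> (\<integral>\<^sup>+ x. ?g x * indicator {0..t} x + ?g x * indicator {-t..0} x \<partial>lborel)"
    by (intro nn_integral_mono) (auto split: split_indicator)
  also have "\<dots> = ennreal (2 * sqrt t) + ennreal (2 * sqrt t)"
    by (subst nn_integral_add) (simp_all add: pos neg)
  also have "\<dots> = ennreal (4 * sqrt t)"
    using assms by (simp flip: ennreal_plus)
  finally show ?thesis .
qed

definition lorentz_fun :: "(real \<Rightarrow> complex) \<Rightarrow> real \<Rightarrow> ennreal" where
  "lorentz_fun f t = ennreal (t powr (1 / 2)) * max_rearr f t"

text \<open>The threshold is \<open>k \<bar>x\<bar>\<^sup>-\<^sup>1\<^sup>/\<^sup>2\<close> for \<open>\<bar>x\<bar> < t\<close> and the constant \<open>k t\<^sup>-\<^sup>1\<^sup>/\<^sup>2\<close> elsewhere. The first has integral at most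
  \<open>4 k t\<^sup>1\<^sup>/\<^sup>2\<close>, the second contributes \<open>k t\<^sup>1\<^sup>/\<^sup>2\<close>, and \<open>g\<close> bounds the excess over the threshold.\<close>

lemma lorentz_fun_le:
  assumes f: "f \<in> borel_measurable torus" and t: "0 < t" "t \<le> 1" and k: "0 < k"
    and bound: "AE x in torus. ennreal (norm (f x)) \<le> ennreal (k * (if \<bar>x\<bar> < t then \<bar>x\<bar> else t) powr (- (1 / 2))) + g x"
    and g: "g \<in> borel_measurable torus"
  shows "lorentz_fun f t \<le> ennreal (5 * k) + ennreal (1 / sqrt t) * (\<integral>\<^sup>+ x. g x \<partial>torus)"
proof -
  let ?L = "ennreal (k * t powr (- (1 / 2)))"
  note [measurable] = g
  have abs [measurable]: "(\<lambda>x. ennreal (\<bar>x\<bar> powr (- (1 / 2)))) \<in> borel_measurable torus"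
    by (rule borel_measurable_torus) measurable
  have ind [measurable]: "(\<lambda>x. indicator {x. \<bar>x\<bar> < t} x :: ennreal) \<in> borel_measurable torus"
    by (rule borel_measurable_torus) measurable
  have "(\<integral>\<^sup>+ x. (ennreal (norm (f x)) - ?L) \<partial>torus)
      \<le> (\<integral>\<^sup>+ x. ennreal k * (ennreal (\<bar>x\<bar> powr (- (1 / 2))) * indicator {x. \<bar>x\<bar> < t} x) + g x \<partial>torus)"
  proof (rule nn_integral_mono_AE, use bound in eventually_elim)
    fix x assume *: "ennreal (norm (f x)) \<le> ennreal (k * (if \<bar>x\<bar> < t then \<bar>x\<bar> else t) powr (- (1 / 2))) + g x"
    show "ennreal (norm (f x)) - ?L \<le> ennreal k * (ennreal (\<bar>x\<bar> powr (- (1 / 2))) * indicator {x. \<bar>x\<bar> < t} x) + g x"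
    proof (cases "\<bar>x\<bar> < t")
      case True
      with * k have "ennreal (norm (f x)) \<le> ennreal k * (ennreal (\<bar>x\<bar> powr (- (1 / 2))) * indicator {x. \<bar>x\<bar> < t} x) + g x"
        by (simp add: ennreal_mult)
      then show ?thesis by (rule order_trans[OF diff_le_self_ennreal])
    next
      case False
      with * show ?thesis by (simp add: ennreal_minus_le_iff)
    qed
  qed
  also have "\<dots> = ennreal k * (\<integral>\<^sup>+ x\<in>{x. \<bar>x\<bar> < t}. ennreal (\<bar>x\<bar> powr (- (1 / 2))) \<partial>torus) + (\<integral>\<^sup>+ x. g x \<partial>torus)"
    by (subst nn_integral_add, measurable, subst nn_integral_cmult, measurable)
  also have "\<dots> \<le> ennreal k * ennreal (4 * sqrt t) + (\<integral>\<^sup>+ x. g x \<partial>torus)"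
    using t by (intro add_right_mono mult_left_mono nn_integral_inverse_sqrt) auto
  finally have "(\<integral>\<^sup>+ u\<in>{0<..<t}. fun_rearr f u \<partial>lborel)
      \<le> ennreal k * ennreal (4 * sqrt t) + (\<integral>\<^sup>+ x. g x \<partial>torus) + ?L * ennreal t"
    using nn_integral_fun_rearr_threshold[OF f t, of ?L] by (meson add_right_mono order_trans)
  also have "?L * ennreal t = ennreal k * ennreal (sqrt t)"
    using t k powr_mult_base[of t "- (1 / 2)"]
    by (simp add: powr_half_sqrt mult_ac flip: ennreal_mult)
  also have "ennreal k * ennreal (4 * sqrt t) + (\<integral>\<^sup>+ x. g x \<partial>torus) + ennreal k * ennreal (sqrt t)
      = ennreal (5 * k * sqrt t) + (\<integral>\<^sup>+ x. g x \<partial>torus)"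
  proof -
    have "ennreal k * ennreal (4 * sqrt t) + ennreal k * ennreal (sqrt t) = ennreal (5 * k * sqrt t)"
      using t k by (simp add: algebra_simps flip: ennreal_mult ennreal_plus)
    then show ?thesis by (simp add: add_ac)
  qed
  finally have R: "(\<integral>\<^sup>+ u\<in>{0<..<t}. fun_rearr f u \<partial>lborel) \<le> ennreal (5 * k * sqrt t) + (\<integral>\<^sup>+ x. g x \<partial>torus)" .
  have "lorentz_fun f t = ennreal (1 / sqrt t) * (\<integral>\<^sup>+ u\<in>{0<..<t}. fun_rearr f u \<partial>lborel)"
  proof -
    have "t powr (1 / 2) * (1 / t) = sqrt t * (1 / (sqrt t * sqrt t))"
      using t by (simp add: powr_half_sqrt)
    also have "\<dots> = 1 / sqrt t"
      using t by (simp del: real_sqrt_mult_self)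
    finally have "ennreal (t powr (1 / 2)) * ennreal (1 / t) = ennreal (1 / sqrt t)"
      using t by (simp flip: ennreal_mult)
    then show ?thesis by (simp add: lorentz_fun_def max_rearr_def flip: mult.assoc)
  qed
  also have "\<dots> \<le> ennreal (1 / sqrt t) * (ennreal (5 * k * sqrt t) + (\<integral>\<^sup>+ x. g x \<partial>torus))"
    using R by (rule mult_left_mono) simp
  also have "\<dots> = ennreal (5 * k) + ennreal (1 / sqrt t) * (\<integral>\<^sup>+ x. g x \<partial>torus)"
    using t k by (simp add: distrib_left flip: ennreal_mult)
  finally show ?thesis .
qed

text \<open>The inner integral in Tonelli's theorem. The integrand behaves like \<open>t\<^sup>q\<^sup>/\<^sup>2\<^sup>-\<^sup>2\<close> for \<open>t < a\<close>, integrable at \<open>0\<close>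
  because \<open>q > 2\<close>, and like \<open>t\<^sup>-\<^sup>3\<^sup>/\<^sup>2\<close> for \<open>t > a\<close>.\<close>

lemma weight_integral_le:
  assumes q: "2 < q" and a: "0 \<le> a"
  shows "(\<integral>\<^sup>+ t\<in>{0<..<1}. ennreal (t powr (- (3 / 2)) * min a t powr ((q - 1) / 2)) \<partial>lborel)
    \<le> ennreal ((2 / (q - 2) + 2) * a powr (q / 2 - 1))"
proof (cases "a = 0")
  case True
  have "min a t powr ((q - 1) / 2) = 0" if "0 < t" for t using True that by simp
  then have "(\<integral>\<^sup>+ t\<in>{0<..<1}. ennreal (t powr (- (3 / 2)) * min a t powr ((q - 1) / 2)) \<partial>lborel)
      = (\<integral>\<^sup>+ t. 0 \<partial>(lborel :: real measure))"
    by (intro nn_integral_cong) (auto split: split_indicator)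
  then show ?thesis by simp
next
  case False
  then have a: "0 < a" using a by simp
  let ?I = "\<lambda>t. ennreal (t powr (q / 2 - 2)) * indicator {0..a} t"
  let ?J = "\<lambda>t. ennreal (t powr (- (3 / 2))) * indicator {a..} t"
  have "(\<integral>\<^sup>+ t\<in>{0<..<1}. ennreal (t powr (- (3 / 2)) * min a t powr ((q - 1) / 2)) \<partial>lborel)
      \<le> (\<integral>\<^sup>+ t. ?I t + ennreal (a powr ((q - 1) / 2)) * ?J t \<partial>lborel)"
  proof (rule nn_integral_mono)
    fix t :: real
    consider "t \<le> 0 \<or> 1 \<le> t" | "0 < t" "t < 1" "t < a" | "0 < t" "a \<le> t" by linarith
    then show "ennreal (t powr (- (3 / 2)) * min a t powr ((q - 1) / 2)) * indicator {0<..<1} t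
        \<le> ?I t + ennreal (a powr ((q - 1) / 2)) * ?J t"
    proof cases
      case 2
      have "- (3 / 2) + (q - 1) / 2 = q / 2 - 2" by (simp add: diff_divide_distrib)
      then have "t powr (- (3 / 2)) * min a t powr ((q - 1) / 2) = t powr (q / 2 - 2)"
        using 2 by (simp flip: powr_add)
      with 2 show ?thesis by simp
    next
      case 3
      then have "ennreal (t powr (- (3 / 2)) * min a t powr ((q - 1) / 2)) = ennreal (a powr ((q - 1) / 2)) * ?J t"
        by (simp add: ennreal_mult'' mult.commute)
      then show ?thesis by (auto split: split_indicator simp: add_increasing)
    qed auto
  qed
  also have "\<dots> = (\<integral>\<^sup>+ t. ?I t \<partial>lborel) + ennreal (a powr ((q - 1) / 2)) * (\<integral>\<^sup>+ t. ?J t \<partial>lborel)"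
    by (subst nn_integral_add, measurable, subst nn_integral_cmult, measurable)
  also have "(\<integral>\<^sup>+ t. ?I t \<partial>lborel) = ennreal (a powr (q / 2 - 2 + 1) / (q / 2 - 2 + 1))"
    using q a by (intro nn_integral_has_integral_lebesgue' has_integral_powr_from_0) auto
  also have "(\<integral>\<^sup>+ t. ?J t \<partial>lborel) = ennreal (- (a powr (- (3 / 2) + 1)) / (- (3 / 2) + 1))"
    using a by (intro nn_integral_has_integral_lebesgue' has_integral_powr_to_inf) auto
  also have "ennreal (a powr (q / 2 - 2 + 1) / (q / 2 - 2 + 1)) = ennreal (2 / (q - 2) * a powr (q / 2 - 1))"
  proof -
    have "q / 2 - 2 + 1 = (q - 2) / 2" "q / 2 - 1 = (q - 2) / 2" by simp_all
    moreover have "x / ((q - 2) / 2) = 2 / (q - 2) * x" for x by simp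
    ultimately show ?thesis by (simp only:)
  qed
  also have "ennreal (- (a powr (- (3 / 2) + 1)) / (- (3 / 2) + 1)) = ennreal (2 * a powr (- (1 / 2)))"
    by simp
  also have "ennreal (a powr ((q - 1) / 2)) * ennreal (2 * a powr (- (1 / 2))) = ennreal (2 * a powr (q / 2 - 1))"
  proof -
    have "(q - 1) / 2 + - (1 / 2) = q / 2 - 1" by (simp add: diff_divide_distrib)
    then have "a powr ((q - 1) / 2) * a powr (- (1 / 2)) = a powr (q / 2 - 1)" by (simp flip: powr_add)
    then show ?thesis by (simp add: mult_ac flip: ennreal_mult)
  qed
  also have "ennreal (2 / (q - 2) * a powr (q / 2 - 1)) + ennreal (2 * a powr (q / 2 - 1))
      = ennreal ((2 / (q - 2) + 2) * a powr (q / 2 - 1))"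
    using q by (simp add: distrib_right flip: ennreal_plus)
  finally show ?thesis .
qed

text \<open>The optimal choice is \<open>k = H\<^sup>1\<^sup>/\<^sup>q\<close>, which makes both terms multiples of \<open>k\<close>.\<close>

lemma epowr_le_of_thresholds:
  assumes q: "1 < q" and le: "\<And>k. 0 < k \<Longrightarrow> F \<le> ennreal (5 * k) + ennreal (k powr (1 - q)) * H"
  shows "epowr F q \<le> epowr 6 q * H"
proof (cases H)
  case (real h)
  show ?thesis
  proof (cases "h = 0")
    case True
    have "F \<le> 0"
    proof (rule ennreal_le_epsilon)
      fix e :: real assume "0 < e"
      then show "F \<le> 0 + ennreal e" using le[of "e / 5"] real True by simp
    qed
    then show ?thesis by simp
  next
    case False
    then have h: "0 < h" using real by simp
    define k where "k = h powr (1 / q)"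
    have k: "0 < k" using h by (simp add: k_def)
    have "1 / q * (1 - q) + 1 = 1 / q" using q by (simp add: field_simps)
    then have "k powr (1 - q) * h = k"
      unfolding k_def powr_powr using h powr_add[of h "1 / q * (1 - q)" 1] by simp
    then have "F \<le> ennreal (5 * k) + ennreal k"
      using le[OF k] real k by (simp flip: ennreal_mult)
    also have "\<dots> = 6 * ennreal k" using k by (simp flip: ennreal_plus ennreal_mult ennreal_numeral)
    finally have "epowr F q \<le> epowr (6 * ennreal k) q" using q by (intro epowr_mono) auto
    also have "\<dots> = epowr 6 q * H"
      using q h real by (simp add: epowr_mult epowr_ennreal k_def powr_powr)
    finally show ?thesis .
  qed
qed (simp add: ennreal_mult_top)

lemma AE_le_of_esssup_le:
  assumes "esssup torus h \<le> c" shows "AE x in torus. h x \<le> (c::ennreal)"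
  using esssup_AE[where M = torus and f = h] assms by (auto elim!: eventually_mono intro: order_trans)

text \<open>Here \<open>\<bar>f\<bar>\<close> stays below the threshold almost everywhere, so nothing exceeds it.\<close>

lemma lorentz_le_weighted_infinity:
  assumes f: "f \<in> borel_measurable torus"
  shows "lorentz_norm 2 \<infinity> f \<le> 5 * weighted_Lp_norm \<infinity> f"
proof (cases "weighted_Lp_norm \<infinity> f")
  case (real w)
  have AE: "AE x in torus. \<bar>x\<bar> powr (1 / 2) * norm (f x) \<le> w"
  proof -
    have "esssup torus (\<lambda>x. ennreal (norm (of_real (\<bar>x\<bar> powr (1 / 2)) * f x))) \<le> ennreal w"
      using real(2) by (simp add: weighted_Lp_norm_def Lp_norm_def inv_sharp_def)
    then have "AE x in torus. ennreal (norm (of_real (\<bar>x\<bar> powr (1 / 2)) * f x)) \<le> ennreal w"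
      by (rule AE_le_of_esssup_le)
    then show ?thesis
      by eventually_elim (use real(1) in \<open>simp add: norm_mult\<close>)
  qed
  have "lorentz_fun f t \<le> 5 * ennreal w" if t: "0 < t" "t < 1" for t
  proof (rule ennreal_le_epsilon)
    fix e :: real assume e: "0 < e"
    \<comment> \<open>The summand \<open>e / 5\<close> keeps the threshold positive when \<open>w = 0\<close>.\<close>
    let ?k = "w + e / 5"
    have k: "0 < ?k" using e real by (simp add: add_nonneg_pos)
    have "lorentz_fun f t \<le> ennreal (5 * ?k) + ennreal (1 / sqrt t) * (\<integral>\<^sup>+ x. 0 \<partial>torus)"
    proof (rule lorentz_fun_le[OF f])
      show "AE x in torus. ennreal (norm (f x)) \<le> ennreal (?k * (if \<bar>x\<bar> < t then \<bar>x\<bar> else t) powr (- (1 / 2))) + 0"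
        using AE AE_torus_nonzero
      proof eventually_elim
        fix x :: real assume x: "\<bar>x\<bar> powr (1 / 2) * norm (f x) \<le> w" "x \<noteq> 0"
        let ?m = "if \<bar>x\<bar> < t then \<bar>x\<bar> else t"
        have m: "0 < ?m" "?m \<le> \<bar>x\<bar>" using x t by auto
        have "norm (f x) = (\<bar>x\<bar> powr (1 / 2) * norm (f x)) * \<bar>x\<bar> powr (- (1 / 2))"
          using x by (simp add: mult.commute[of _ "norm (f x)"] mult.assoc flip: powr_add)
        also have "\<dots> \<le> ?k * ?m powr (- (1 / 2))"
          using x m e k by (intro mult_mono powr_mono2') auto
        finally show "ennreal (norm (f x)) \<le> ennreal (?k * ?m powr (- (1 / 2))) + 0"
          unfolding add_0_right by (rule ennreal_leI)
      qed
    qed (use t k in auto)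
    also have "\<dots> = 5 * ennreal w + ennreal e"
      using real(1) e by (simp add: distrib_left flip: ennreal_plus ennreal_mult ennreal_numeral)
    finally show "lorentz_fun f t \<le> 5 * ennreal w + ennreal e" .
  qed
  then show ?thesis
    using real by (auto simp: lorentz_norm_def lorentz_fun_def intro!: SUP_least)
qed (simp add: ennreal_mult_top)

lemma inv_sharp_mult:
  assumes p: "2 < p" "p \<noteq> \<infinity>" shows "inv_sharp p * enn2real p = enn2real p / 2 - 1"
proof -
  let ?q = "enn2real p"
  have q: "2 < ?q" using p by (rule enn2real_gt_2)
  have "enn2real (1 / p) = 1 / ?q"
    using q p(2) by (cases p) (auto simp: divide_ennreal simp flip: ennreal_1)
  moreover have "1 / ?q \<le> 1 / 2" using q by (intro divide_left_mono) auto
  ultimately have "inv_sharp p = 1 / 2 - 1 / ?q" by (simp add: inv_sharp_def)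
  then show ?thesis using q by (simp add: left_diff_distrib)
qed

text \<open>The excess over the threshold with constant \<open>k\<close> is at most \<open>k\<^sup>1\<^sup>-\<^sup>q \<bar>f\<bar>\<^sup>q min(\<bar>x\<bar>, t)\<^sup>(\<^sup>q\<^sup>-\<^sup>1\<^sup>)\<^sup>/\<^sup>2\<close>. After optimising \<open>k\<close>, the
  \<open>q\<close>-th power of the Lorentz integrand is bounded by a single integral over the torus, and exchanging
  the integrations produces the weight \<open>\<bar>x\<bar>\<^sup>q\<^sup>/\<^sup>2\<^sup>-\<^sup>1\<close>.\<close>

lemma lorentz_le_weighted_finite:
  assumes f: "f \<in> borel_measurable torus" and p: "2 < p" "p \<noteq> \<infinity>"
  defines "q \<equiv> enn2real p"
  shows "lorentz_norm 2 p f \<le> ennreal (6 * (2 / (q - 2) + 2) powr (1 / q)) * weighted_Lp_norm p f"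
proof -
  have q: "2 < q" unfolding q_def using p by (rule enn2real_gt_2)
  define C where "C = 2 / (q - 2) + 2"
  have C: "0 < C" using q by (simp add: C_def add_pos_pos)
  note [measurable] = f
  define a :: "real \<Rightarrow> real" where "a x = \<bar>x\<bar>" for x
  have [measurable]: "a \<in> borel_measurable torus"
    unfolding a_def by (rule borel_measurable_torus) measurable
  define U where "U x = ennreal (norm (f x) powr q)" for x
  have [measurable]: "U \<in> borel_measurable torus" unfolding U_def by measurable
  define k0 where "k0 t x = min (a x) t powr ((q - 1) / 2)" for t x
  define H where "H t = ennreal (1 / sqrt t) * (\<integral>\<^sup>+ x. U x * ennreal (k0 t x) \<partial>torus)" for t
  have H: "epowr (lorentz_fun f t) q \<le> epowr 6 q * H t" if t: "0 < t" "t < 1" for t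
  proof (rule epowr_le_of_thresholds)
    have [measurable]: "k0 t \<in> borel_measurable torus" unfolding k0_def by measurable
    fix k :: real assume k: "0 < k"
    have "lorentz_fun f t \<le> ennreal (5 * k) + ennreal (1 / sqrt t) * (\<integral>\<^sup>+ x. ennreal (k powr (1 - q)) * (U x * ennreal (k0 t x)) \<partial>torus)"
    proof (rule lorentz_fun_le[OF f])
      show "AE x in torus. ennreal (norm (f x)) \<le> ennreal (k * (if \<bar>x\<bar> < t then \<bar>x\<bar> else t) powr (- (1 / 2)))
          + ennreal (k powr (1 - q)) * (U x * ennreal (k0 t x))"
        using AE_torus_nonzero
      proof eventually_elim
        fix x :: real assume x: "x \<noteq> 0"
        let ?m = "if \<bar>x\<bar> < t then \<bar>x\<bar> else t"
        let ?L = "k * ?m powr (- (1 / 2))"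
        have m: "0 < ?m" using x t by simp
        have L: "0 < ?L" using m k by simp
        have "?L powr (1 - q) = k powr (1 - q) * ?m powr (- (1 / 2) * (1 - q))"
          using m k by (subst powr_mult) (auto simp: powr_powr)
        also have "- (1 / 2) * (1 - q) = (q - 1) / 2" by (simp add: field_simps)
        also have "?m powr ((q - 1) / 2) = k0 t x" by (auto simp: a_def k0_def min_def)
        finally have Lq: "?L powr (1 - q) = k powr (1 - q) * k0 t x" .
        have "norm (f x) \<le> ?L + norm (f x) powr q * ?L powr (1 - q)"
          using q L by (intro threshold_le) auto
        then have "norm (f x) \<le> ?L + k powr (1 - q) * (norm (f x) powr q * k0 t x)"
          unfolding Lq by (simp add: mult_ac)
        then have "ennreal (norm (f x)) \<le> ennreal (?L + k powr (1 - q) * (norm (f x) powr q * k0 t x))"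
          by (rule ennreal_leI)
        also have "\<dots> = ennreal ?L + ennreal (k powr (1 - q)) * (U x * ennreal (k0 t x))"
          using L by (simp add: ennreal_mult U_def k0_def)
        finally show "ennreal (norm (f x)) \<le> ennreal ?L + ennreal (k powr (1 - q)) * (U x * ennreal (k0 t x))" .
      qed
      show "(\<lambda>x. ennreal (k powr (1 - q)) * (U x * ennreal (k0 t x))) \<in> borel_measurable torus" by measurable
    qed (use t k in auto)
    also have "(\<integral>\<^sup>+ x. ennreal (k powr (1 - q)) * (U x * ennreal (k0 t x)) \<partial>torus)
        = ennreal (k powr (1 - q)) * (\<integral>\<^sup>+ x. U x * ennreal (k0 t x) \<partial>torus)"
      by (rule nn_integral_cmult) measurable
    finally show "lorentz_fun f t \<le> ennreal (5 * k) + ennreal (k powr (1 - q)) * H t"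
      by (simp add: H_def mult.left_commute)
  qed (use q in simp)
  define S where "S t x = U x * (ennreal (t powr (- (3 / 2)) * k0 t x) * indicator {0<..<1} t)" for t x
  interpret T: prob_space torus by (rule prob_space_torus)
  interpret P: pair_sigma_finite torus "lborel :: real measure"
    by standard
  have "(\<integral>\<^sup>+ t\<in>{0<..<1}. epowr (lorentz_fun f t) q * ennreal (1 / t) \<partial>lborel)
      \<le> (\<integral>\<^sup>+ t. epowr 6 q * (\<integral>\<^sup>+ x. S t x \<partial>torus) \<partial>lborel)"
  proof (rule nn_integral_mono)
    fix t :: real
    show "epowr (lorentz_fun f t) q * ennreal (1 / t) * indicator {0<..<1} t \<le> epowr 6 q * (\<integral>\<^sup>+ x. S t x \<partial>torus)"
    proof (cases "t \<in> {0<..<1}")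
      case True
      then have t: "0 < t" "t < 1" by auto
      have [measurable]: "k0 t \<in> borel_measurable torus" unfolding k0_def by measurable
      have "t powr (- (3 / 2)) = t powr (- (1 / 2)) * t powr (- 1)"
        by (subst powr_add[symmetric]) simp
      also have "\<dots> = 1 / sqrt t * (1 / t)"
        using t by (simp add: powr_minus_divide powr_half_sqrt)
      finally have t32: "t powr (- (3 / 2)) = 1 / sqrt t * (1 / t)" .
      have "(\<integral>\<^sup>+ x. S t x \<partial>torus) = (\<integral>\<^sup>+ x. ennreal (1 / sqrt t * (1 / t)) * (U x * ennreal (k0 t x)) \<partial>torus)"
      proof (rule nn_integral_cong)
        fix x
        have "ennreal (t powr (- (3 / 2)) * k0 t x) = ennreal (1 / sqrt t * (1 / t)) * ennreal (k0 t x)"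
          unfolding t32 using t by (intro ennreal_mult) (auto simp: k0_def)
        then show "S t x = ennreal (1 / sqrt t * (1 / t)) * (U x * ennreal (k0 t x))"
          unfolding S_def using True by (simp add: mult_ac)
      qed
      also have "\<dots> = ennreal (1 / sqrt t * (1 / t)) * (\<integral>\<^sup>+ x. U x * ennreal (k0 t x) \<partial>torus)"
        by (rule nn_integral_cmult) measurable
      also have "\<dots> = H t * ennreal (1 / t)"
        using t ennreal_mult[of "1 / sqrt t" "1 / t"] by (simp add: H_def mult_ac)
      finally have "epowr 6 q * (\<integral>\<^sup>+ x. S t x \<partial>torus) = epowr 6 q * H t * ennreal (1 / t)"
        by (simp add: mult.assoc)
      with H[OF t] t show ?thesis by (simp add: mult_right_mono)
    qed simp
  qed
  also have "\<dots> = epowr 6 q * (\<integral>\<^sup>+ t. (\<integral>\<^sup>+ x. S t x \<partial>torus) \<partial>lborel)"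
    unfolding S_def k0_def by (rule nn_integral_cmult) measurable
  also have "(\<integral>\<^sup>+ t. (\<integral>\<^sup>+ x. S t x \<partial>torus) \<partial>lborel) = (\<integral>\<^sup>+ x. (\<integral>\<^sup>+ t. S t x \<partial>lborel) \<partial>torus)"
    by (rule P.Fubini') (unfold S_def k0_def, measurable)
  also have "\<dots> \<le> (\<integral>\<^sup>+ x. ennreal C * epowr (ennreal (norm (of_real (\<bar>x\<bar> powr inv_sharp p) * f x))) q \<partial>torus)"
  proof (rule nn_integral_mono)
    fix x :: real
    have "(\<integral>\<^sup>+ t. S t x \<partial>lborel) = U x * (\<integral>\<^sup>+ t\<in>{0<..<1}. ennreal (t powr (- (3 / 2)) * min (a x) t powr ((q - 1) / 2)) \<partial>lborel)"
      unfolding S_def k0_def by (rule nn_integral_cmult) measurable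
    also have "\<dots> \<le> U x * ennreal (C * a x powr (q / 2 - 1))"
      unfolding C_def using q by (intro mult_left_mono weight_integral_le) (auto simp: a_def)
    also have "\<dots> = ennreal C * epowr (ennreal (norm (of_real (\<bar>x\<bar> powr inv_sharp p) * f x))) q"
    proof -
      have "inv_sharp p * q = q / 2 - 1" unfolding q_def by (rule inv_sharp_mult[OF p])
      then show ?thesis
        using C by (simp add: U_def a_def norm_mult epowr_ennreal powr_mult powr_powr mult_ac flip: ennreal_mult)
    qed
    finally show "(\<integral>\<^sup>+ t. S t x \<partial>lborel) \<le> ennreal C * epowr (ennreal (norm (of_real (\<bar>x\<bar> powr inv_sharp p) * f x))) q" .
  qed
  also have "\<dots> = ennreal C * (\<integral>\<^sup>+ x. epowr (ennreal (norm (of_real (\<bar>x\<bar> powr inv_sharp p) * f x))) q \<partial>torus)"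
    unfolding a_def[symmetric] by (rule nn_integral_cmult) measurable
  finally have "(\<integral>\<^sup>+ t\<in>{0<..<1}. epowr (lorentz_fun f t) q * ennreal (1 / t) \<partial>lborel)
      \<le> epowr 6 q * (ennreal C * (\<integral>\<^sup>+ x. epowr (ennreal (norm (of_real (\<bar>x\<bar> powr inv_sharp p) * f x))) q \<partial>torus))"
    by (simp add: mult_left_mono)
  then have "lorentz_norm 2 p f
      \<le> epowr (epowr 6 q * (ennreal C * (\<integral>\<^sup>+ x. epowr (ennreal (norm (of_real (\<bar>x\<bar> powr inv_sharp p) * f x))) q \<partial>torus))) (1 / q)"
    using p q by (auto simp: lorentz_norm_def lorentz_fun_def q_def[symmetric] intro!: epowr_mono)
  also have "\<dots> = 6 * (ennreal (C powr (1 / q)) * weighted_Lp_norm p f)"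
    using p q C by (simp add: epowr_mult epowr_epowr epowr_ennreal weighted_Lp_norm_def Lp_norm_def q_def[symmetric])
  also have "\<dots> = ennreal (6 * C powr (1 / q)) * weighted_Lp_norm p f"
    by (simp add: ennreal_mult mult.assoc)
  finally show ?thesis unfolding C_def .
qed

theorem lorentz_le_weighted:
  assumes p: "2 < p"
  obtains C :: real where "0 < C"
    "\<And>f. f \<in> borel_measurable torus \<Longrightarrow> lorentz_norm 2 p f \<le> ennreal C * weighted_Lp_norm p f"
proof (cases "p = \<infinity>")
  case True
  then show ?thesis using lorentz_le_weighted_infinity by (intro that[of 5]) auto
next
  case False
  let ?q = "enn2real p"
  have "0 < 2 / (?q - 2) + 2" using enn2real_gt_2[OF p False] by (simp add: add_pos_pos)
  then have "0 < 6 * (2 / (?q - 2) + 2) powr (1 / ?q)" by simp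
  then show ?thesis by (rule that) (rule lorentz_le_weighted_finite[OF _ p False])
qed

section \<open>Random signs\<close>

text \<open>A choice of signs on \<open>J\<close> is encoded by the subset on which the sign is positive, so that averages over signs are finite sums over \<open>Pow J\<close>.\<close>

definition rsign :: "'j set \<Rightarrow> 'j \<Rightarrow> complex" where
  "rsign A j = (if j \<in> A then 1 else - 1)"

lemma sum_Pow_insert:
  fixes g :: "'j set \<Rightarrow> 'a::comm_monoid_add"
  assumes "finite J" "j \<notin> J"
  shows "(\<Sum>A\<in>Pow (insert j J). g A) = (\<Sum>A\<in>Pow J. g A + g (insert j A))"
proof -
  have "inj_on (insert j) (Pow J)" using assms(2) by (intro inj_onI) (metis PowD insert_ident subsetD)
  moreover have "Pow J \<inter> insert j ` Pow J = {}" using assms(2) by auto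
  ultimately show ?thesis
    using assms(1) by (simp add: Pow_insert sum.union_disjoint sum.reindex sum.distrib)
qed

text \<open>With \<open>c = Re (u \<cdot> cnj z)\<close> one has \<open>\<bar>u \<plusminus> z\<bar>\<^sup>2 = \<bar>u\<bar>\<^sup>2 + \<bar>z\<bar>\<^sup>2 \<plusminus> 2 c\<close> and \<open>c\<^sup>2 \<le> \<bar>u\<bar>\<^sup>2 \<bar>z\<bar>\<^sup>2\<close>.\<close>

lemma norm_plus_minus_moments:
  fixes u z :: complex
  shows "norm (u - z) ^ 2 + norm (u + z) ^ 2 = 2 * norm u ^ 2 + 2 * norm z ^ 2"
    and "norm (u - z) ^ 4 + norm (u + z) ^ 4 \<le> 2 * norm u ^ 4 + 12 * (norm u ^ 2 * norm z ^ 2) + 2 * norm z ^ 4"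
proof -
  define a b c where "a = norm u ^ 2" and "b = norm z ^ 2" and "c = Re u * Re z + Im u * Im z"
  have plus: "norm (u + z) ^ 2 = a + b + 2 * c" and minus: "norm (u - z) ^ 2 = a + b - 2 * c"
    unfolding a_def b_def c_def cmod_power2 by (simp_all add: power2_eq_square algebra_simps)
  show "norm (u - z) ^ 2 + norm (u + z) ^ 2 = 2 * norm u ^ 2 + 2 * norm z ^ 2"
    unfolding plus minus by (simp add: a_def b_def)
  have "a * b - c ^ 2 = (Re u * Im z - Im u * Re z) ^ 2"
    unfolding a_def b_def c_def cmod_power2 by (simp add: power2_eq_square algebra_simps)
  then have c: "c ^ 2 \<le> a * b" by (smt (verit) zero_le_power2)
  have "norm (u - z) ^ 4 + norm (u + z) ^ 4 = (a + b - 2 * c) ^ 2 + (a + b + 2 * c) ^ 2"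
    unfolding plus[symmetric] minus[symmetric] by simp
  also have "\<dots> = 2 * a ^ 2 + 4 * (a * b) + 2 * b ^ 2 + 8 * c ^ 2"
    by (simp add: power2_eq_square algebra_simps)
  also have "\<dots> \<le> 2 * a ^ 2 + 12 * (a * b) + 2 * b ^ 2" using c by linarith
  finally show "norm (u - z) ^ 4 + norm (u + z) ^ 4 \<le> 2 * norm u ^ 4 + 12 * (norm u ^ 2 * norm z ^ 2) + 2 * norm z ^ 4"
    by (simp add: a_def b_def)
qed

text \<open>Second and fourth moments of a random sign sum, by adding one summand at a time.\<close>

lemma rsign_moments:
  fixes z :: "'j \<Rightarrow> complex"
  assumes "finite J"
  shows "(\<Sum>A\<in>Pow J. norm (\<Sum>j\<in>J. rsign A j * z j) ^ 2) = 2 ^ card J * (\<Sum>j\<in>J. norm (z j) ^ 2)"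
    and "(\<Sum>A\<in>Pow J. norm (\<Sum>j\<in>J. rsign A j * z j) ^ 4) \<le> 2 ^ card J * (3 * (\<Sum>j\<in>J. norm (z j) ^ 2) ^ 2)"
  using assms
proof (induction J)
  case (insert j J)
  let ?S = "\<lambda>A. \<Sum>i\<in>J. rsign A i * z i"
  let ?s = "\<Sum>i\<in>J. norm (z i) ^ 2" and ?N = "2 ^ card J :: real"
  have minus: "(\<Sum>i\<in>insert j J. rsign A i * z i) = ?S A - z j"
    and plus: "(\<Sum>i\<in>insert j J. rsign (insert j A) i * z i) = ?S A + z j" if "A \<in> Pow J" for A
  proof -
    have "j \<notin> A" using that insert.hyps by auto
    then show "(\<Sum>i\<in>insert j J. rsign A i * z i) = ?S A - z j"
      using insert.hyps by (simp add: rsign_def)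
    have "(\<Sum>i\<in>J. rsign (insert j A) i * z i) = ?S A"
      by (rule sum.cong) (use insert.hyps in \<open>auto simp: rsign_def\<close>)
    then show "(\<Sum>i\<in>insert j J. rsign (insert j A) i * z i) = ?S A + z j"
      using insert.hyps by (simp add: rsign_def)
  qed
  have N: "(\<Sum>A\<in>Pow J. c) = ?N * c" for c :: real using insert.hyps by (simp add: card_Pow)
  have "(\<Sum>A\<in>Pow (insert j J). norm (\<Sum>i\<in>insert j J. rsign A i * z i) ^ 2)
      = (\<Sum>A\<in>Pow J. norm (?S A - z j) ^ 2 + norm (?S A + z j) ^ 2)"
    unfolding sum_Pow_insert[OF insert.hyps] by (rule sum.cong) (simp_all only: minus plus)
  also have "\<dots> = 2 * (\<Sum>A\<in>Pow J. norm (?S A) ^ 2) + ?N * (2 * norm (z j) ^ 2)"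
    unfolding norm_plus_minus_moments sum.distrib N by (simp add: sum_distrib_left)
  also have "\<dots> = 2 ^ card (insert j J) * (\<Sum>i\<in>insert j J. norm (z i) ^ 2)"
    unfolding insert.IH using insert.hyps by (simp add: algebra_simps)
  finally show "(\<Sum>A\<in>Pow (insert j J). norm (\<Sum>i\<in>insert j J. rsign A i * z i) ^ 2)
      = 2 ^ card (insert j J) * (\<Sum>i\<in>insert j J. norm (z i) ^ 2)" .
  have ring: "2 * (n * (3 * s ^ 2)) + 12 * (n * s * b) + n * (6 * b ^ 2) = 2 * n * (3 * (b + s) ^ 2)"
    for n s b :: real by (simp add: power2_eq_square algebra_simps)
  have "(\<Sum>A\<in>Pow (insert j J). norm (\<Sum>i\<in>insert j J. rsign A i * z i) ^ 4)
      = (\<Sum>A\<in>Pow J. norm (?S A - z j) ^ 4 + norm (?S A + z j) ^ 4)"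
    unfolding sum_Pow_insert[OF insert.hyps] by (rule sum.cong) (simp_all only: minus plus)
  also have "\<dots> \<le> (\<Sum>A\<in>Pow J. 2 * norm (?S A) ^ 4 + 12 * (norm (?S A) ^ 2 * norm (z j) ^ 2) + 2 * norm (z j) ^ 4)"
    by (intro sum_mono norm_plus_minus_moments)
  also have "\<dots> = 2 * (\<Sum>A\<in>Pow J. norm (?S A) ^ 4) + 12 * ((\<Sum>A\<in>Pow J. norm (?S A) ^ 2) * norm (z j) ^ 2)
      + ?N * (2 * norm (z j) ^ 4)"
    unfolding sum.distrib N by (simp add: sum_distrib_left sum_distrib_right)
  also have "\<dots> \<le> 2 * (?N * (3 * ?s ^ 2)) + 12 * (?N * ?s * norm (z j) ^ 2) + ?N * (2 * norm (z j) ^ 4)"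
    unfolding insert.IH(1) by (intro add_right_mono mult_left_mono insert.IH(2)) simp
  also have "\<dots> \<le> 2 * (?N * (3 * ?s ^ 2)) + 12 * (?N * ?s * norm (z j) ^ 2) + ?N * (6 * norm (z j) ^ 4)"
    by (intro add_left_mono mult_left_mono mult_right_mono) auto
  also have "\<dots> = 2 * ?N * (3 * (norm (z j) ^ 2 + ?s) ^ 2)"
    using ring[of ?N ?s "norm (z j) ^ 2"] by simp
  also have "\<dots> = 2 ^ card (insert j J) * (3 * (\<Sum>i\<in>insert j J. norm (z i) ^ 2) ^ 2)"
    using insert.hyps by simp
  finally show "(\<Sum>A\<in>Pow (insert j J). norm (\<Sum>i\<in>insert j J. rsign A i * z i) ^ 4)
      \<le> 2 ^ card (insert j J) * (3 * (\<Sum>i\<in>insert j J. norm (z i) ^ 2) ^ 2)" .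
qed auto

text \<open>The first moment is bounded below by the second and fourth: \<open>t\<^sup>2 - 4/27 t\<^sup>4 \<le> t\<close> for \<open>t \<ge> 0\<close>, applied to the
  sign sums divided by their root mean square, gives \<open>1 - 3 \<cdot> 4/27 = 5/9\<close>.\<close>

lemma khinchin:
  fixes z :: "'j \<Rightarrow> complex"
  assumes J: "finite J"
  shows "2 ^ card J * (5 / 9 * sqrt (\<Sum>j\<in>J. norm (z j) ^ 2)) \<le> (\<Sum>A\<in>Pow J. norm (\<Sum>j\<in>J. rsign A j * z j))"
proof (cases "(\<Sum>j\<in>J. norm (z j) ^ 2) = 0")
  case False
  define s where "s = sqrt (\<Sum>j\<in>J. norm (z j) ^ 2)"
  have s: "0 < s" "s ^ 2 = (\<Sum>j\<in>J. norm (z j) ^ 2)"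
    using False by (auto simp: s_def sum_nonneg less_le)
  let ?S = "\<lambda>A. norm (\<Sum>j\<in>J. rsign A j * z j)" and ?N = "2 ^ card J :: real"
  have "t ^ 2 - 4 / 27 * t ^ 4 \<le> t" if "0 \<le> t" for t :: real
  proof -
    have "0 \<le> t * ((t - 3 / 2) ^ 2 * (4 / 27 * (t + 3)))" using that by simp
    then show ?thesis by (simp add: power2_eq_square power4_eq_xxxx algebra_simps)
  qed
  then have "(\<Sum>A\<in>Pow J. (?S A / s) ^ 2 - 4 / 27 * (?S A / s) ^ 4) \<le> (\<Sum>A\<in>Pow J. ?S A / s)"
    using s by (intro sum_mono) auto
  moreover have "(\<Sum>A\<in>Pow J. (?S A / s) ^ 2 - 4 / 27 * (?S A / s) ^ 4)
      = (\<Sum>A\<in>Pow J. ?S A ^ 2) / s ^ 2 - 4 / 27 * ((\<Sum>A\<in>Pow J. ?S A ^ 4) / s ^ 4)"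
    by (simp add: sum_subtractf power_divide sum_divide_distrib sum_distrib_left)
  moreover have "(\<Sum>A\<in>Pow J. ?S A ^ 2) / s ^ 2 = ?N"
    unfolding rsign_moments(1)[OF J] s(2)[symmetric] using s(1) by simp
  moreover have "(\<Sum>A\<in>Pow J. ?S A ^ 4) / s ^ 4 \<le> 3 * ?N"
  proof -
    have "(\<Sum>A\<in>Pow J. ?S A ^ 4) \<le> ?N * (3 * (s ^ 2) ^ 2)"
      using rsign_moments(2)[OF J] unfolding s(2) .
    then show ?thesis using s(1) by (simp add: divide_le_eq mult_ac)
  qed
  ultimately have "5 / 9 * ?N \<le> (\<Sum>A\<in>Pow J. ?S A / s)" by linarith
  then have "5 / 9 * ?N * s \<le> (\<Sum>A\<in>Pow J. ?S A)"
    using s(1) by (simp add: le_divide_eq flip: sum_divide_distrib)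
  then show ?thesis by (simp add: s_def mult_ac)
qed (simp add: sum_nonneg)

section \<open>Transport of energy from frequencies to annuli\<close>

lemma assign_with_multiplicities:
  assumes "finite M" "M \<noteq> {}" "finite U" "(\<Sum>m\<in>M. r m) \<le> card U"
  shows "\<exists>\<phi>. (\<forall>u\<in>U. \<phi> u \<in> M) \<and> (\<forall>m\<in>M. r m \<le> card {u \<in> U. \<phi> u = m})"
  using assms
proof (induction M arbitrary: U rule: finite_ne_induct)
  case (singleton m)
  then show ?case by (intro exI[of _ "\<lambda>_. m"]) auto
next
  case (insert m M)
  then have "r m \<le> card U" by simp
  then obtain V where V: "V \<subseteq> U" "card V = r m" "finite V"
    by (rule obtain_subset_with_card_n)
  have "(\<Sum>m\<in>M. r m) \<le> card (U - V)"
    using insert.prems insert.hyps V by (simp add: card_Diff_subset)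
  then obtain \<phi> where \<phi>: "\<forall>u\<in>U - V. \<phi> u \<in> M" "\<forall>m\<in>M. r m \<le> card {u \<in> U - V. \<phi> u = m}"
    using insert.IH[of "U - V"] insert.prems by auto
  let ?\<psi> = "\<lambda>u. if u \<in> V then m else \<phi> u"
  have "r k \<le> card {u \<in> U. ?\<psi> u = k}" if "k \<in> insert m M" for k
  proof (cases "k = m")
    case True
    have "card V \<le> card {u \<in> U. ?\<psi> u = m}" using V insert.prems by (intro card_mono) auto
    with V True show ?thesis by simp
  next
    case False
    then have "r k \<le> card {u \<in> U - V. \<phi> u = k}" using that \<phi> by auto
    also have "\<dots> \<le> card {u \<in> U. ?\<psi> u = k}" using insert.prems by (intro card_mono) auto
    finally show ?thesis .
  qed
  then show ?case using \<phi> by (intro exI[of _ ?\<psi>]) auto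
qed

text \<open>Each \<open>u\<close> in \<open>U\<close> carries the average energy \<open>T / L\<close>, and \<open>m\<close> demands \<open>d\<^sub>m\<close>, that is \<open>L d\<^sub>m / T\<close> elements rounded up.
  The rounding costs at most one element for each \<open>m\<close>, which is why \<open>U\<close> has twice as many elements as \<open>M\<close>.\<close>

lemma block_transport:
  fixes d :: "nat \<Rightarrow> real" and L :: nat
  assumes M: "finite M" "card M = L" "M \<noteq> {}" and U: "finite U" "card U = 2 * L" and d: "\<And>m. 0 \<le> d m"
  shows "\<exists>\<phi>. (\<forall>u\<in>U. \<phi> u \<in> M) \<and> (\<forall>m\<in>M. d m \<le> real (card {u \<in> U. \<phi> u = m}) * ((\<Sum>m\<in>M. d m) / real L))"
proof -
  define T where "T = (\<Sum>m\<in>M. d m)"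
  have L: "0 < L" using M card_gt_0_iff[of M] by simp
  have T: "0 \<le> T" unfolding T_def by (intro sum_nonneg d)
  define r where "r m = nat \<lceil>real L * d m / T\<rceil>" for m
  have nonneg: "0 \<le> real L * d m / T" for m using d T by simp
  have r: "real L * d m / T \<le> real (r m)" "real (r m) \<le> real L * d m / T + 1" for m
  proof -
    have "real (r m) = of_int \<lceil>real L * d m / T\<rceil>"
      unfolding r_def using nonneg[of m] by simp
    then show "real L * d m / T \<le> real (r m)" "real (r m) \<le> real L * d m / T + 1" by linarith+
  qed
  have "real (\<Sum>m\<in>M. r m) \<le> (\<Sum>m\<in>M. real L * d m / T + 1)"
    unfolding of_nat_sum by (intro sum_mono r)
  also have "\<dots> = real L * (T / T) + real L"
    using M by (simp add: sum.distrib T_def flip: sum_divide_distrib sum_distrib_left)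
  also have "\<dots> \<le> 2 * real L" by simp
  finally have "(\<Sum>m\<in>M. r m) \<le> card U" using U by linarith
  then obtain \<phi> where \<phi>: "\<forall>u\<in>U. \<phi> u \<in> M" "\<forall>m\<in>M. r m \<le> card {u \<in> U. \<phi> u = m}"
    using assign_with_multiplicities[OF M(1,3) U(1), of r] by auto
  have "d m \<le> real (card {u \<in> U. \<phi> u = m}) * (T / real L)" if m: "m \<in> M" for m
  proof (cases "T = 0")
    case True
    then have "d m = 0" using d m M(1) sum_nonneg_eq_0_iff[of M d] by (simp add: T_def)
    then show ?thesis using T by simp
  next
    case False
    then have "0 < T" using T by simp
    have "d m = real L * d m / T * (T / real L)" using \<open>0 < T\<close> L by simp
    also have "\<dots> \<le> real (card {u \<in> U. \<phi> u = m}) * (T / real L)"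
      using r(1)[of m] \<phi>(2) m T by (intro mult_right_mono) (auto intro: order_trans)
    finally show ?thesis .
  qed
  with \<phi> show ?thesis unfolding T_def by blast
qed

text \<open>The frequency scales are cut into blocks \<open>2\<^sup>k \<le> m + 1 < 2\<^sup>k\<^sup>+\<^sup>1\<close>, and the energy of a block is spread evenly
  over the annuli \<open>2 \<cdot> 2\<^sup>k \<le> l < 4 \<cdot> 2\<^sup>k\<close>. Spreading keeps \<open>v\<^sub>l\<close> below the average of the energies up to \<open>l\<close>, whereas
  leaving \<open>d\<^sub>m\<close> on one annulus would not. The factor between the block lengths provides the spare
  annuli needed for rounding; it is available since scales in frequency grow by the factor \<open>16 = 2\<^sup>4\<close> and
  an annulus is usable for \<open>m\<close> as soon as \<open>l \<le> 4 m + 3\<close>.\<close>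

lemma energy_transport:
  fixes d :: "nat \<Rightarrow> real"
  assumes d: "\<And>m. 0 \<le> d m"
  obtains v :: "nat \<Rightarrow> real" and \<phi> :: "nat \<Rightarrow> nat" where
    "\<And>l. 0 \<le> v l" "\<And>l. 2 \<le> l \<Longrightarrow> v l \<le> 4 * ((\<Sum>m<l. d m) / real l)" "\<And>l. 2 \<le> l \<Longrightarrow> l \<le> 4 * \<phi> l + 3"
    "\<And>m. d m \<le> (\<Sum>l\<in>{l\<in>{2..<4 * (m + 1)}. \<phi> l = m}. v l)"
proof -
  define M where "M k = {2 ^ k - 1..<2 ^ Suc k - 1 :: nat}" for k
  define U where "U k = {2 * 2 ^ k..<4 * 2 ^ k :: nat}" for k
  define T where "T k = (\<Sum>m\<in>M k. d m)" for k
  have "\<exists>\<phi>. (\<forall>u\<in>U k. \<phi> u \<in> M k) \<and>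
      (\<forall>m\<in>M k. d m \<le> real (card {u \<in> U k. \<phi> u = m}) * (T k / real (2 ^ k)))" for k
    unfolding T_def
  proof (rule block_transport)
    show "card (M k) = 2 ^ k" "card (U k) = 2 * 2 ^ k" by (simp_all add: M_def U_def)
    then show "M k \<noteq> {}" by (metis card.empty power_not_zero zero_neq_numeral)
  qed (simp_all add: M_def U_def d)
  then obtain \<Phi> where "\<forall>k. (\<forall>u\<in>U k. \<Phi> k u \<in> M k) \<and>
      (\<forall>m\<in>M k. d m \<le> real (card {u \<in> U k. \<Phi> k u = m}) * (T k / real (2 ^ k)))"
    using choice[of "\<lambda>k \<phi>. (\<forall>u\<in>U k. \<phi> u \<in> M k) \<and>
      (\<forall>m\<in>M k. d m \<le> real (card {u \<in> U k. \<phi> u = m}) * (T k / real (2 ^ k)))"] by blast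
  then have \<Phi>: "\<And>k u. u \<in> U k \<Longrightarrow> \<Phi> k u \<in> M k"
    "\<And>k m. m \<in> M k \<Longrightarrow> d m \<le> real (card {u \<in> U k. \<Phi> k u = m}) * (T k / real (2 ^ k))"
    by blast+
  have "\<exists>k. l \<in> U k" if "2 \<le> l" for l
  proof -
    have "1 \<le> l div 2" using that by simp
    then obtain k where "2 ^ k \<le> l div 2" "l div 2 < 2 ^ Suc k" by (rule ex_dyadic_block)
    then have "l \<in> U k" by (auto simp: U_def)
    then show ?thesis ..
  qed
  then obtain \<kappa> where \<kappa>: "\<And>l. 2 \<le> l \<Longrightarrow> l \<in> U (\<kappa> l)" by metis
  have unique: "k = k'" if "l \<in> U k" "l \<in> U k'" for l k k'
  proof (rule ccontr)
    have less: False if "l \<in> U i" "l \<in> U j" "i < j" for i j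
    proof -
      have "(2::nat) ^ Suc i \<le> 2 ^ j" using that by (intro power_increasing) auto
      then show False using that by (simp add: U_def)
    qed
    assume "k \<noteq> k'"
    then show False using less[of k k'] less[of k' k] that by (cases "k < k'") auto
  qed
  have ge2: "2 \<le> l" if "l \<in> U k" for l k
    using that unfolding U_def by (simp add: le_trans[of 2 "2 * 2 ^ k" l])
  have \<kappa>_eq: "\<kappa> l = k" if "l \<in> U k" for l k
    using unique[OF \<kappa>[OF ge2[OF that]] that] .
  define \<phi> where "\<phi> l = \<Phi> (\<kappa> l) l" for l
  define v where "v l = T (\<kappa> l) / real (2 ^ \<kappa> l)" for l
  have T0: "0 \<le> T k" for k unfolding T_def by (intro sum_nonneg d)
  show ?thesis
  proof (rule that)
    show "0 \<le> v l" for l using T0 by (simp add: v_def)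
    fix l :: nat assume l: "2 \<le> l"
    define k where "k = \<kappa> l"
    have lU: "2 * 2 ^ k \<le> l" "l < 4 * 2 ^ k" using \<kappa>[OF l] by (auto simp: U_def k_def)
    have "T k \<le> (\<Sum>m<l. d m)"
      unfolding T_def M_def using lU d by (intro sum_mono2) auto
    moreover have "real l \<le> 4 * 2 ^ k"
      using of_nat_mono[OF less_imp_le[OF lU(2)], where 'a = real] by simp
    ultimately have "T k * real l \<le> (\<Sum>m<l. d m) * (4 * 2 ^ k)"
      using T0 by (intro mult_mono) (auto intro: sum_nonneg d)
    then show "v l \<le> 4 * ((\<Sum>m<l. d m) / real l)"
      using l by (simp add: v_def k_def[symmetric] divide_le_eq le_divide_eq mult_ac)
    have "\<phi> l \<in> M k" unfolding \<phi>_def k_def by (intro \<Phi>(1) \<kappa> l)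
    then show "l \<le> 4 * \<phi> l + 3" using lU by (auto simp: M_def)
  next
    fix m :: nat
    obtain k where k: "2 ^ k \<le> m + 1" "m + 1 < 2 ^ Suc k" by (rule ex_dyadic_block[of "m + 1"]) auto
    then have m: "m \<in> M k" by (auto simp: M_def)
    have sub: "{u \<in> U k. \<Phi> k u = m} \<subseteq> {l\<in>{2..<4 * (m + 1)}. \<phi> l = m}"
      using k ge2[of _ k] by (auto simp: \<phi>_def \<kappa>_eq) (auto simp: U_def)
    have "d m \<le> real (card {u \<in> U k. \<Phi> k u = m}) * (T k / real (2 ^ k))" by (rule \<Phi>(2)[OF m])
    also have "\<dots> = (\<Sum>l\<in>{u \<in> U k. \<Phi> k u = m}. T k / real (2 ^ k))" by simp
    also have "\<dots> = (\<Sum>l\<in>{u \<in> U k. \<Phi> k u = m}. v l)"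
      by (rule sum.cong) (auto simp: v_def \<kappa>_eq)
    also have "\<dots> \<le> (\<Sum>l\<in>{l\<in>{2..<4 * (m + 1)}. \<phi> l = m}. v l)"
      using sub T0 by (intro sum_mono2) (auto simp: v_def)
    finally show "d m \<le> (\<Sum>l\<in>{l\<in>{2..<4 * (m + 1)}. \<phi> l = m}. v l)" .
  qed
qed

section \<open>Test functions\<close>

lemma norm_character_diff: "norm (character n x - character n y) \<le> 2 * pi * \<bar>of_int n\<bar> * \<bar>x - y\<bar>"
proof -
  define t where "t = - 2 * pi * of_int n * (x - y)"
  have "character n x = character n y * exp (\<i> * of_real t)"
    by (simp add: character_def t_def algebra_simps flip: exp_add)
  then have "character n x - character n y = character n y * (exp (\<i> * of_real t) - 1)"
    by (simp add: algebra_simps)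
  then have "norm (character n x - character n y) = 2 * \<bar>sin (t / 2)\<bar>"
    by (simp only: norm_mult norm_character dist_exp_i_1, simp?)
  also have "\<dots> \<le> 2 * \<bar>t / 2\<bar>" using abs_sin_x_le_abs_x[of "t / 2"] by simp
  also have "\<dots> = 2 * pi * \<bar>of_int n\<bar> * \<bar>x - y\<bar>" by (simp add: t_def abs_mult)
  finally show ?thesis .
qed

lemma indicator_Ico_measurable: "(indicator {a..<b} :: real \<Rightarrow> real) \<in> borel_measurable torus"
  by (rule borel_measurable_torus) measurable

lemma integral_indicator_Ico:
  assumes "-1/2 \<le> a" "a \<le> b" "b \<le> 1/2"
  shows "(\<integral>x. indicator {a..<b} x \<partial>torus) = b - a"
proof -
  have sub: "{a..<b} \<subseteq> {-1/2..1/2}" using assms by auto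
  have "(\<integral>x. indicator {a..<b} x \<partial>torus) = measure torus ({a..<b} \<inter> space torus)"
    by (rule Bochner_Integration.integral_indicator)
  also have "{a..<b} \<inter> space torus = {a..<b}" unfolding space_torus using sub by blast
  also have "measure torus {a..<b} = measure lebesgue {a..<b}"
    by (rule measure_restrict_space[OF _ sub]) simp
  also have "\<dots> = b - a" using assms by simp
  finally show ?thesis .
qed

text \<open>On an interval this short the character is within \<open>1/2\<close> of its value at the left endpoint, since
  \<open>2 \<pi> / 16 \<le> 1/2\<close>.\<close>

lemma integral_cell_character_ge:
  assumes a: "-1/2 \<le> a" "0 < e" "a + e \<le> 1/2" and n: "\<bar>of_int n\<bar> * e \<le> 1 / 16"
  shows "e / 2 \<le> norm (\<integral>x. of_real (indicator {a..<a + e} x) * character n x \<partial>torus)"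
proof -
  let ?I = "\<lambda>x. indicator {a..<a + e} x :: real"
  note [measurable] = indicator_Ico_measurable character_measurable
  have i1: "integrable torus (\<lambda>x. of_real (?I x) * character n x)"
    by (rule integrable_torus_bounded[of _ 1], measurable) (simp add: norm_mult indicator_def)
  have i2: "integrable torus (\<lambda>x. of_real (?I x) * character n a)"
    by (rule integrable_torus_bounded[of _ 1], measurable) (simp add: norm_mult indicator_def)
  interpret prob_space torus by (rule prob_space_torus)
  have iI: "integrable torus ?I"
    by (rule integrable_const_bound[of _ 1]) (simp, measurable)
  have const: "(\<integral>x. of_real (?I x) * character n a \<partial>torus) = of_real e * character n a"
  proof -
    have "(\<integral>x. complex_of_real (?I x) \<partial>torus) = of_real (a + e - a)"
      using integral_indicator_Ico[of a "a + e"] a by (simp only: integral_complex_of_real, simp?)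
    then show ?thesis by (simp only: integral_mult_left_zero, simp?)
  qed
  have "norm ((\<integral>x. of_real (?I x) * character n x \<partial>torus) - of_real e * character n a)
      = norm (\<integral>x. of_real (?I x) * character n x - of_real (?I x) * character n a \<partial>torus)"
    unfolding const[symmetric] by (simp only: Bochner_Integration.integral_diff[OF i1 i2])
  also have "\<dots> \<le> (\<integral>x. norm (of_real (?I x) * character n x - of_real (?I x) * character n a) \<partial>torus)"
    by (rule integral_norm_bound)
  also have "\<dots> \<le> (\<integral>x. 1 / 2 * ?I x \<partial>torus)"
  proof (rule integral_mono)
    show "integrable torus (\<lambda>x. norm (of_real (?I x) * character n x - of_real (?I x) * character n a))"
      by (rule integrable_norm[OF Bochner_Integration.integrable_diff[OF i1 i2]])
    show "integrable torus (\<lambda>x. 1 / 2 * ?I x)" by (rule integrable_mult_right[OF iI])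
    fix x
    have "norm (character n x - character n a) \<le> 1 / 2" if "x \<in> {a..<a + e}"
    proof -
      have "norm (character n x - character n a) \<le> 2 * pi * (\<bar>of_int n\<bar> * \<bar>x - a\<bar>)"
        using norm_character_diff[of n x a] by (simp add: mult.assoc)
      also have "\<dots> \<le> 2 * pi * (\<bar>of_int n\<bar> * e)"
        using that by (intro mult_left_mono) auto
      also have "\<dots> \<le> 2 * pi * (1 / 16)" using n by (intro mult_left_mono) auto
      also have "\<dots> \<le> 1 / 2" using pi_less_4 by simp
      finally show ?thesis .
    qed
    then show "norm (of_real (?I x) * character n x - of_real (?I x) * character n a) \<le> 1 / 2 * ?I x"
      by (auto simp: indicator_def)
  qed
  also have "\<dots> = 1 / 2 * e"
    using integral_indicator_Ico[of a "a + e"] a by (simp only: integral_mult_right_zero, simp?)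
  finally have "norm ((\<integral>x. of_real (?I x) * character n x \<partial>torus) - of_real e * character n a) \<le> 1 / 2 * e" .
  moreover have "norm (of_real e * character n a) = e" using a by (simp add: norm_mult)
  ultimately show ?thesis
    using norm_triangle_ineq2[of "of_real e * character n a" "of_real e * character n a - (\<integral>x. of_real (?I x) * character n x \<partial>torus)"]
    by (simp add: norm_minus_commute)
qed

definition annulus :: "nat \<Rightarrow> real set" where
  "annulus l = {1 / 2 ^ Suc l..<1 / 2 ^ l}"

text \<open>Short enough for \<open>integral_cell_character_ge\<close> at all frequencies \<open>\<bar>n\<bar> < 16\<^sup>m\<^sup>+\<^sup>1\<close>; a power of \<open>2\<close>, so that cells
  fit exactly into the annuli.\<close>

definition cell_length :: "nat \<Rightarrow> real" where
  "cell_length m = 1 / 2 ^ (4 * m + 8)"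

definition cell_count :: "nat \<Rightarrow> nat \<Rightarrow> nat" where
  "cell_count m l = 2 ^ (4 * m + 7 - l)"

definition cell :: "nat \<Rightarrow> nat \<Rightarrow> nat \<Rightarrow> real set" where
  "cell m l i = {1 / 2 ^ Suc l + real i * cell_length m..<1 / 2 ^ Suc l + real i * cell_length m + cell_length m}"

lemma cell_length_pos: "0 < cell_length m"
  by (simp add: cell_length_def)

lemma cell_count_length:
  assumes "l \<le> 4 * m + 3" shows "real (cell_count m l) * cell_length m = 1 / 2 ^ Suc l"
proof -
  have "4 * m + 8 = (4 * m + 7 - l) + Suc l" using assms by simp
  then have "(2::real) ^ (4 * m + 8) = 2 ^ (4 * m + 7 - l) * 2 ^ Suc l" by (metis power_add)
  then show ?thesis unfolding cell_length_def cell_count_def by simp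
qed

lemma annulus_unique: "x \<in> annulus l \<Longrightarrow> x \<in> annulus k \<Longrightarrow> l = k"
proof -
  have less: False if "x \<in> annulus l" "x \<in> annulus k" "l < k" for l k
  proof -
    have "(2::real) ^ Suc l \<le> 2 ^ k" using that(3) by (intro power_increasing) auto
    then have "1 / (2::real) ^ k \<le> 1 / 2 ^ Suc l" by (intro divide_left_mono) auto
    then show False using that(1,2) unfolding annulus_def by (simp only: atLeastLessThan_iff) linarith
  qed
  show "x \<in> annulus l \<Longrightarrow> x \<in> annulus k \<Longrightarrow> l = k"
    using less[of l k] less[of k l] by (cases l k rule: linorder_cases) auto
qed

lemma sum_indicator_cells:
  assumes "l \<le> 4 * m + 3"
  shows "(\<Sum>i<cell_count m l. indicator (cell m l i) x) = (indicator (annulus l) x :: real)"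
proof -
  have "(\<Sum>i<K. indicator {a + real i * e..<a + real i * e + e} x) = (indicator {a..<a + real K * e} x :: real)"
    if "0 \<le> e" for K a e
  proof (induction K)
    case (Suc K)
    have glue: "indicator {a..<c} x = (indicator {a..<b} x + indicator {b..<c} x :: real)"
      if "a \<le> b" "b \<le> c" for a b c :: real
      using that by (auto simp: indicator_def)
    have eq: "a + real (Suc K) * e = a + real K * e + e" by (simp add: algebra_simps)
    show ?case
      unfolding sum.lessThan_Suc Suc.IH eq by (rule glue[symmetric]) (use that in simp_all)
  qed simp
  from this[OF less_imp_le[OF cell_length_pos], of "1 / 2 ^ Suc l" m "cell_count m l"]
  show ?thesis unfolding cell_def cell_count_length[OF assms] annulus_def by simp
qed

text \<open>The constant value on the annulus \<open>l\<close> for which \<open>\<bar>x\<bar> \<cdot> \<bar>f(x)\<bar>\<^sup>2\<close> is comparable to \<open>v\<^sub>l\<close>.\<close>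

definition profile :: "(nat \<Rightarrow> real) \<Rightarrow> nat \<Rightarrow> real" where
  "profile v l = sqrt (2 ^ l * v l)"

definition cells :: "(nat \<Rightarrow> nat) \<Rightarrow> nat \<Rightarrow> (nat \<times> nat) set" where
  "cells \<phi> L = Sigma {2..<L} (\<lambda>l. {..<cell_count (\<phi> l) l})"

text \<open>Only the annuli \<open>2 \<le> l < L\<close> and only positive \<open>x\<close> are used, which makes the family of signs finite and
  every test function bounded.\<close>

definition test_fun :: "(nat \<Rightarrow> real) \<Rightarrow> (nat \<Rightarrow> nat) \<Rightarrow> nat \<Rightarrow> (nat \<times> nat) set \<Rightarrow> real \<Rightarrow> complex" where
  "test_fun v \<phi> L A x = (\<Sum>(l, i)\<in>cells \<phi> L.
     rsign A (l, i) * (of_real (profile v l) * of_real (indicator (cell (\<phi> l) l i) x)))"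

lemma finite_cells: "finite (cells \<phi> L)"
  by (simp add: cells_def)

lemma test_fun_measurable: "test_fun v \<phi> L A \<in> borel_measurable torus"
proof -
  note [measurable] = indicator_Ico_measurable
  show ?thesis unfolding test_fun_def cell_def case_prod_unfold by measurable
qed

lemma norm_test_fun_le:
  assumes v: "\<And>l. 0 \<le> v l" and \<phi>: "\<And>l. 2 \<le> l \<Longrightarrow> l \<le> 4 * \<phi> l + 3"
  shows "norm (test_fun v \<phi> L A x) \<le> (\<Sum>l\<in>{2..<L}. profile v l * indicator (annulus l) x)"
proof -
  have "norm (test_fun v \<phi> L A x) \<le> (\<Sum>(l, i)\<in>cells \<phi> L. profile v l * indicator (cell (\<phi> l) l i) x)"
    unfolding test_fun_def
    by (rule order_trans[OF norm_sum], rule sum_mono)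
      (auto simp: norm_mult rsign_def profile_def v indicator_def)
  also have "\<dots> = (\<Sum>l\<in>{2..<L}. \<Sum>i<cell_count (\<phi> l) l. profile v l * indicator (cell (\<phi> l) l i) x)"
    unfolding cells_def by (subst sum.Sigma[symmetric]) auto
  also have "\<dots> = (\<Sum>l\<in>{2..<L}. profile v l * indicator (annulus l) x)"
    unfolding sum_distrib_left[symmetric] by (intro sum.cong refl) (simp add: sum_indicator_cells \<phi>)
  finally show ?thesis .
qed

lemma sum_profile_cases:
  obtains "(\<Sum>l\<in>{2..<L}. profile v l * indicator (annulus l) x) = 0"
  | l where "l \<in> {2..<L}" "x \<in> annulus l" "(\<Sum>l\<in>{2..<L}. profile v l * indicator (annulus l) x) = profile v l"
proof (cases "\<exists>l\<in>{2..<L}. x \<in> annulus l")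
  case True
  then obtain l where l: "l \<in> {2..<L}" "x \<in> annulus l" by auto
  have "(\<Sum>l\<in>{2..<L}. profile v l * indicator (annulus l) x) = (\<Sum>k\<in>{2..<L}. if k = l then profile v l else 0)"
    by (intro sum.cong refl) (use l annulus_unique[of x] in \<open>auto simp: indicator_def\<close>)
  also have "\<dots> = profile v l" using l by simp
  finally show ?thesis using l that by blast
next
  case False
  then have "(\<Sum>l\<in>{2..<L}. profile v l * indicator (annulus l) x) = 0" by (intro sum.neutral) (auto simp: indicator_def)
  then show ?thesis using that by blast
qed

lemma integrable_test_fun:
  assumes v: "\<And>l. 0 \<le> v l" and \<phi>: "\<And>l. 2 \<le> l \<Longrightarrow> l \<le> 4 * \<phi> l + 3"
  shows "integrable torus (test_fun v \<phi> L A)"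
proof (rule integrable_torus_bounded[OF test_fun_measurable])
  fix x
  have "(\<Sum>l\<in>{2..<L}. profile v l * indicator (annulus l) x) \<le> (\<Sum>l\<in>{2..<L}. profile v l * 1)"
    by (intro sum_mono mult_left_mono) (auto simp: profile_def v)
  then show "norm (test_fun v \<phi> L A x) \<le> (\<Sum>l\<in>{2..<L}. profile v l)"
    using norm_test_fun_le[of v \<phi> L A x, OF v \<phi>] by simp
qed

lemma annulus_weight_le:
  assumes q: "2 < q" and s: "s * q = q / 2 - 1" and x: "x \<in> annulus l" and v: "0 \<le> v l"
  shows "(\<bar>x\<bar> powr s * profile v l) powr q \<le> 2 ^ Suc l * sqrt (v l) powr q"
proof -
  have "0 < 1 / (2::real) ^ Suc l" by simp
  then have x0: "0 < x" and xl: "x \<le> 1 / 2 ^ l" using x unfolding annulus_def by (simp_all only: atLeastLessThan_iff) linarith+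
  define N where "N = (2::real) ^ l"
  have N: "0 < N" by (simp add: N_def)
  have inv: "(1 / N) powr r = N powr (- r)" for r using N by (simp add: powr_divide powr_minus_divide)
  have "(\<bar>x\<bar> powr s * profile v l) powr q = x powr (q / 2 - 1) * (N powr (q / 2) * sqrt (v l) powr q)"
    using x0 v N s
    by (simp add: profile_def real_sqrt_mult powr_mult powr_powr powr_half_sqrt[symmetric] flip: N_def)
  also have "\<dots> \<le> (1 / N) powr (q / 2 - 1) * (N powr (q / 2) * sqrt (v l) powr q)"
    using x0 xl q by (intro mult_right_mono powr_mono2) (auto simp: N_def)
  also have "\<dots> = N powr (- (q / 2 - 1)) * N powr (q / 2) * sqrt (v l) powr q"
    unfolding inv by (simp add: mult.assoc)
  also have "\<dots> = N * sqrt (v l) powr q"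
    using N by (subst powr_add[symmetric]) simp
  also have "\<dots> \<le> 2 ^ Suc l * sqrt (v l) powr q" by (intro mult_right_mono) (auto simp: N_def)
  finally show ?thesis .
qed

lemma emeasure_annulus: "1 \<le> l \<Longrightarrow> emeasure torus (annulus l) = ennreal (1 / 2 ^ Suc l)"
proof -
  assume l: "1 \<le> l"
  have "(2::real) ^ 1 \<le> 2 ^ l" using l by (intro power_increasing) auto
  then have "1 / (2::real) ^ l \<le> 1 / 2" by (intro divide_left_mono) auto
  moreover have "0 < 1 / (2::real) ^ Suc l" by simp
  ultimately have sub: "annulus l \<subseteq> {-1/2..1/2}" unfolding annulus_def
    by (intro subsetI) (simp only: atLeastLessThan_iff atLeastAtMost_iff, linarith)
  have "emeasure torus (annulus l) = emeasure lebesgue (annulus l)"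
    by (rule emeasure_restrict_space[OF _ sub]) simp
  also have "\<dots> = emeasure lborel (annulus l)" by (simp add: annulus_def)
  also have "\<dots> = ennreal (1 / 2 ^ l - 1 / 2 ^ Suc l)"
    unfolding annulus_def by (rule emeasure_lborel_Ico) (simp add: divide_simps)
  also have "1 / 2 ^ l - 1 / 2 ^ Suc l = 1 / (2::real) ^ Suc l" by (simp add: divide_simps)
  finally show ?thesis .
qed

text \<open>Up to constants, the measure \<open>dx / \<bar>x\<bar>\<close> gives every annulus the same mass, and the weight turns
  \<open>\<bar>f\<bar>\<close> into \<open>(\<bar>x\<bar> \<cdot> \<bar>f\<bar>\<^sup>2)\<^sup>1\<^sup>/\<^sup>2\<close> with respect to it.\<close>

lemma weighted_norm_test_fun:
  assumes p: "2 < p" and v: "\<And>l. 0 \<le> v l" and \<phi>: "\<And>l. 2 \<le> l \<Longrightarrow> l \<le> 4 * \<phi> l + 3"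
  shows "weighted_Lp_norm p (test_fun v \<phi> L A) \<le> seq_norm p (\<lambda>l. if 2 \<le> l then ennreal (sqrt (v l)) else 0)"
    (is "_ \<le> seq_norm p ?c")
proof -
  note [measurable] = test_fun_measurable
  let ?f = "test_fun v \<phi> L A"
  define s where "s = inv_sharp p"
  have pos: "0 < x" if "x \<in> annulus l" for x l
  proof -
    have "0 < 1 / (2::real) ^ Suc l" by simp
    then show ?thesis using that unfolding annulus_def by (simp only: atLeastLessThan_iff) linarith
  qed
  have [measurable]: "(\<lambda>x::real. \<bar>x\<bar> powr s) \<in> borel_measurable torus"
    by (rule borel_measurable_torus) measurable
  have meas [measurable]: "(\<lambda>x. ennreal (norm (of_real (\<bar>x\<bar> powr s) * ?f x))) \<in> borel_measurable torus"
    by measurable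
  have norm_le: "norm (of_real (\<bar>x\<bar> powr s) * ?f x) \<le> \<bar>x\<bar> powr s * (\<Sum>l\<in>{2..<L}. profile v l * indicator (annulus l) x)" for x
    using norm_test_fun_le[of v \<phi> L A x, OF v \<phi>] by (simp add: norm_mult mult_left_mono)
  show ?thesis
  proof (cases "p = \<infinity>")
    case True
    have "ennreal (norm (of_real (\<bar>x\<bar> powr s) * ?f x)) \<le> (SUP l. ?c l)" for x
    proof (rule sum_profile_cases[where v = v and L = L and x = x])
      assume "(\<Sum>l\<in>{2..<L}. profile v l * indicator (annulus l) x) = 0"
      then have "norm (of_real (\<bar>x\<bar> powr s) * ?f x) = 0"
        using norm_le[of x] by (intro antisym) simp_all
      then show ?thesis by (simp only:) simp
    next
      fix l assume l: "l \<in> {2..<L}" "x \<in> annulus l"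
        "(\<Sum>l\<in>{2..<L}. profile v l * indicator (annulus l) x) = profile v l"
      have "x < 1 / 2 ^ l" using l(2) by (simp add: annulus_def)
      then have "x * 2 ^ l \<le> 1" by (simp add: divide_simps)
      then have "x * 2 ^ l * v l \<le> 1 * v l" using v by (intro mult_right_mono) auto
      then have "sqrt (x * (2 ^ l * v l)) \<le> sqrt (v l)" by (simp add: mult.assoc)
      moreover have "\<bar>x\<bar> powr s * profile v l = sqrt (x * (2 ^ l * v l))"
        using pos[OF l(2)] True by (simp add: s_def inv_sharp_def profile_def powr_half_sqrt real_sqrt_mult)
      ultimately have "norm (of_real (\<bar>x\<bar> powr s) * ?f x) \<le> sqrt (v l)"
        using norm_le[of x] unfolding l(3) by linarith
      then have "ennreal (norm (of_real (\<bar>x\<bar> powr s) * ?f x)) \<le> ?c l"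
        using l(1) by (simp add: ennreal_leI)
      then show ?thesis by (rule order_trans) (rule SUP_upper, simp)
    qed
    then show ?thesis
      using True meas unfolding weighted_Lp_norm_def Lp_norm_def seq_norm_def s_def[symmetric]
      by (auto intro!: esssup_I)
  next
    case False
    let ?q = "enn2real p"
    have q: "2 < ?q" using enn2real_gt_2[OF p False] .
    have s: "s * ?q = ?q / 2 - 1" unfolding s_def by (rule inv_sharp_mult[OF p False])
    have ann [measurable]: "annulus l \<in> sets torus" if "1 \<le> l" for l
    proof -
      have "emeasure torus (annulus l) \<noteq> 0" unfolding emeasure_annulus[OF that] by simp
      then show ?thesis by (metis emeasure_notin_sets)
    qed
    let ?g = "\<lambda>l. 2 ^ Suc l * sqrt (v l) powr ?q"
    have "(\<integral>\<^sup>+ x. epowr (ennreal (norm (of_real (\<bar>x\<bar> powr s) * ?f x))) ?q \<partial>torus)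
        \<le> (\<integral>\<^sup>+ x. (\<Sum>l\<in>{2..<L}. ennreal (?g l) * indicator (annulus l) x) \<partial>torus)"
    proof (rule nn_integral_mono)
      fix x :: real
      show "epowr (ennreal (norm (of_real (\<bar>x\<bar> powr s) * ?f x))) ?q
          \<le> (\<Sum>l\<in>{2..<L}. ennreal (?g l) * indicator (annulus l) x)"
      proof (rule sum_profile_cases[where v = v and L = L and x = x])
        assume "(\<Sum>l\<in>{2..<L}. profile v l * indicator (annulus l) x) = 0"
        then have "norm (of_real (\<bar>x\<bar> powr s) * ?f x) = 0"
          using norm_le[of x] by (intro antisym) simp_all
        then show ?thesis by (simp only:) simp
      next
        fix l assume l: "l \<in> {2..<L}" "x \<in> annulus l"
          "(\<Sum>l\<in>{2..<L}. profile v l * indicator (annulus l) x) = profile v l"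
        have "norm (of_real (\<bar>x\<bar> powr s) * ?f x) powr ?q \<le> (\<bar>x\<bar> powr s * profile v l) powr ?q"
          using norm_le[of x] q unfolding l(3) by (intro powr_mono2) auto
        also have "\<dots> \<le> ?g l" by (rule annulus_weight_le[OF q s l(2) v])
        finally have "epowr (ennreal (norm (of_real (\<bar>x\<bar> powr s) * ?f x))) ?q \<le> ennreal (?g l) * indicator (annulus l) x"
          using l(2) by (simp add: epowr_ennreal ennreal_leI)
        also have "\<dots> \<le> (\<Sum>l\<in>{2..<L}. ennreal (?g l) * indicator (annulus l) x)"
          using l(1) by (intro member_le_sum) auto
        finally show ?thesis .
      qed
    qed
    also have "\<dots> = (\<Sum>l\<in>{2..<L}. ennreal (?g l) * emeasure torus (annulus l))"
    proof (subst nn_integral_sum)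
      show "(\<lambda>x. ennreal (?g l) * indicator (annulus l) x) \<in> borel_measurable torus" if "l \<in> {2..<L}" for l
        using ann[of l] that by (intro borel_measurable_times_ennreal borel_measurable_indicator borel_measurable_const) auto
      show "(\<Sum>l\<in>{2..<L}. \<integral>\<^sup>+ x. ennreal (?g l) * indicator (annulus l) x \<partial>torus)
          = (\<Sum>l\<in>{2..<L}. ennreal (?g l) * emeasure torus (annulus l))"
        by (intro sum.cong refl nn_integral_cmult_indicator ann) auto
    qed
    also have "\<dots> = (\<Sum>l\<in>{2..<L}. epowr (?c l) ?q)"
    proof (intro sum.cong refl)
      fix l assume l: "l \<in> {2..<L}"
      have "ennreal (?g l) * emeasure torus (annulus l) = ennreal (?g l * (1 / 2 ^ Suc l))"
        using l by (subst emeasure_annulus) (simp, rule ennreal_mult[symmetric], simp_all)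
      also have "?g l * (1 / 2 ^ Suc l) = sqrt (v l) powr ?q" by simp
      finally show "ennreal (?g l) * emeasure torus (annulus l) = epowr (?c l) ?q"
        using l v by (simp add: epowr_ennreal)
    qed
    also have "\<dots> \<le> (\<Sum>l. epowr (?c l) ?q)" by (rule sum_le_suminf) auto
    finally show ?thesis
      using False q unfolding weighted_Lp_norm_def Lp_norm_def seq_norm_def s_def[symmetric]
      by (auto intro!: epowr_mono)
  qed
qed

definition cell_coeff :: "nat \<Rightarrow> nat \<Rightarrow> nat \<Rightarrow> int \<Rightarrow> complex" where
  "cell_coeff m l i n = (\<integral>x. of_real (indicator (cell m l i) x) * character n x \<partial>torus)"

lemma fourier_coeff_test_fun:
  "fourier_coeff (test_fun v \<phi> L A) n
    = (\<Sum>j\<in>cells \<phi> L. rsign A j * (of_real (profile v (fst j)) * cell_coeff (\<phi> (fst j)) (fst j) (snd j) n))"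
proof -
  note [measurable] = indicator_Ico_measurable character_measurable
  let ?h = "\<lambda>j x. of_real (indicator (cell (\<phi> (fst j)) (fst j) (snd j)) x) * character n x"
  have int: "integrable torus (?h j)" for j
    unfolding cell_def by (rule integrable_torus_bounded[of _ 1], measurable) (simp add: norm_mult indicator_def)
  have "test_fun v \<phi> L A x * character n x
      = (\<Sum>j\<in>cells \<phi> L. (rsign A j * of_real (profile v (fst j))) * ?h j x)" for x
    unfolding test_fun_def sum_distrib_right case_prod_unfold by (intro sum.cong refl) (simp add: mult_ac)
  then have "fourier_coeff (test_fun v \<phi> L A) n
      = (\<integral>x. (\<Sum>j\<in>cells \<phi> L. (rsign A j * of_real (profile v (fst j))) * ?h j x) \<partial>torus)"
    unfolding fourier_coeff_character by simp
  also have "\<dots> = (\<Sum>j\<in>cells \<phi> L. \<integral>x. (rsign A j * of_real (profile v (fst j))) * ?h j x \<partial>torus)"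
    by (rule Bochner_Integration.integral_sum) (rule integrable_mult_right[OF int])
  also have "\<dots> = (\<Sum>j\<in>cells \<phi> L. (rsign A j * of_real (profile v (fst j))) * cell_coeff (\<phi> (fst j)) (fst j) (snd j) n)"
    unfolding cell_coeff_def by (simp only: integral_mult_right_zero)
  finally show ?thesis by (simp only: mult.assoc)
qed

lemma norm_cell_coeff_ge:
  assumes l: "2 \<le> l" "l \<le> 4 * m + 3" and i: "i < cell_count m l" and n: "\<bar>n\<bar> < 16 ^ Suc m"
  shows "cell_length m / 2 \<le> norm (cell_coeff m l i n)"
  unfolding cell_coeff_def cell_def
proof (rule integral_cell_character_ge)
  have "0 \<le> 1 / (2::real) ^ Suc l + real i * cell_length m"
    using cell_length_pos[of m] by (intro add_nonneg_nonneg) auto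
  then show "-1/2 \<le> 1 / 2 ^ Suc l + real i * cell_length m" by linarith
  show "0 < cell_length m" by (rule cell_length_pos)
  have "real i * cell_length m + cell_length m = real (Suc i) * cell_length m" by (simp add: algebra_simps)
  also have "\<dots> \<le> real (cell_count m l) * cell_length m"
    using i cell_length_pos[of m] by (intro mult_right_mono) auto
  also have "\<dots> = 1 / 2 ^ Suc l" by (rule cell_count_length[OF l(2)])
  finally have "1 / 2 ^ Suc l + real i * cell_length m + cell_length m \<le> 1 / 2 ^ Suc l + 1 / 2 ^ Suc l" by linarith
  also have "\<dots> = 1 / 2 ^ l" by simp
  also have "\<dots> \<le> 1 / 2"
  proof -
    have "(2::real) ^ 1 \<le> 2 ^ l" using l by (intro power_increasing) auto
    then show ?thesis by (intro divide_left_mono) auto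
  qed
  finally show "1 / 2 ^ Suc l + real i * cell_length m + cell_length m \<le> 1 / 2" .
  have "\<bar>of_int n :: real\<bar> \<le> 16 ^ Suc m" using n by (metis less_imp_le of_int_abs of_int_le_iff of_int_numeral of_int_power)
  then have "\<bar>of_int n\<bar> * cell_length m \<le> 16 ^ Suc m * cell_length m"
    using cell_length_pos[of m] by (intro mult_right_mono) auto
  also have "\<dots> = 1 / 16" by (simp add: cell_length_def power_add power_mult)
  finally show "\<bar>of_int n\<bar> * cell_length m \<le> 1 / 16" .
qed

text \<open>By Khinchin's inequality the mean of \<open>\<bar>f\<^sup>^(n)\<bar>\<close> over all signs is at least \<open>5/9\<close> of the square root of the
  sum of the squared contributions of the cells. Only the annuli with \<open>\<phi>(l) = m\<close> are kept. Each of them has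
  cells of total length \<open>2\<^sup>-\<^sup>l\<^sup>-\<^sup>1\<close> and contributes \<open>cell_length m / 8 \<cdot> v\<^sub>l\<close>.\<close>

lemma sum_fourier_test_fun_ge:
  assumes v: "\<And>l. 0 \<le> v l" and \<phi>: "\<And>l. 2 \<le> l \<Longrightarrow> l \<le> 4 * \<phi> l + 3"
    and L: "4 * (m + 1) \<le> L" and n: "\<bar>n\<bar> < 16 ^ Suc m"
  defines "S \<equiv> Pow (cells \<phi> L)"
  shows "real (card S) * (5 / 9 * sqrt (cell_length m / 8 * (\<Sum>l\<in>{l\<in>{2..<4 * (m + 1)}. \<phi> l = m}. v l)))
    \<le> (\<Sum>A\<in>S. norm (fourier_coeff (test_fun v \<phi> L A) n))"
proof -
  let ?z = "\<lambda>j. of_real (profile v (fst j)) * cell_coeff (\<phi> (fst j)) (fst j) (snd j) n"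
  let ?R = "{l\<in>{2..<4 * (m + 1)}. \<phi> l = m}"
  have "cell_length m / 8 * (\<Sum>l\<in>?R. v l) = (\<Sum>l\<in>?R. \<Sum>i<cell_count m l. 2 ^ l * v l * (cell_length m / 2) ^ 2)"
    unfolding sum_distrib_left
  proof (intro sum.cong refl)
    fix l assume "l \<in> ?R"
    then have l: "l \<le> 4 * m + 3" using \<phi>[of l] by auto
    have "(\<Sum>i<cell_count m l. 2 ^ l * v l * (cell_length m / 2) ^ 2)
        = 2 ^ l * v l * (real (cell_count m l) * cell_length m) * (cell_length m / 4)"
      by (simp add: power2_eq_square)
    also have "\<dots> = cell_length m / 8 * v l"
      unfolding cell_count_length[OF l] by simp
    finally show "cell_length m / 8 * v l = (\<Sum>i<cell_count m l. 2 ^ l * v l * (cell_length m / 2) ^ 2)" ..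
  qed
  also have "\<dots> \<le> (\<Sum>l\<in>?R. \<Sum>i<cell_count m l. norm (?z (l, i)) ^ 2)"
  proof (intro sum_mono)
    fix l i assume l: "l \<in> ?R" and i: "i \<in> {..<cell_count m l}"
    then have "cell_length m / 2 \<le> norm (cell_coeff m l i n)"
      using \<phi>[of l] n by (intro norm_cell_coeff_ge) auto
    then have ineq: "profile v l ^ 2 * (cell_length m / 2) ^ 2 \<le> profile v l ^ 2 * norm (cell_coeff m l i n) ^ 2"
      using cell_length_pos[of m] by (intro mult_left_mono power_mono) auto
    have "2 ^ l * v l = profile v l ^ 2" using v by (simp add: profile_def)
    with ineq show "2 ^ l * v l * (cell_length m / 2) ^ 2 \<le> norm (?z (l, i)) ^ 2"
      using l by (simp add: norm_mult power_mult_distrib)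
  qed
  also have "\<dots> = (\<Sum>j\<in>Sigma ?R (\<lambda>l. {..<cell_count m l}). norm (?z j) ^ 2)"
    by (subst sum.Sigma) (auto simp: case_prod_unfold)
  also have "\<dots> \<le> (\<Sum>j\<in>cells \<phi> L. norm (?z j) ^ 2)"
    using L by (intro sum_mono2 finite_cells) (auto simp: cells_def)
  finally have "sqrt (cell_length m / 8 * (\<Sum>l\<in>?R. v l)) \<le> sqrt (\<Sum>j\<in>cells \<phi> L. norm (?z j) ^ 2)"
    by (rule real_sqrt_le_mono)
  then have "real (card S) * (5 / 9 * sqrt (cell_length m / 8 * (\<Sum>l\<in>?R. v l)))
      \<le> real (card S) * (5 / 9 * sqrt (\<Sum>j\<in>cells \<phi> L. norm (?z j) ^ 2))"
    by (intro mult_left_mono) auto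
  also have "\<dots> = 2 ^ card (cells \<phi> L) * (5 / 9 * sqrt (\<Sum>j\<in>cells \<phi> L. norm (?z j) ^ 2))"
    unfolding S_def by (simp add: card_Pow finite_cells)
  also have "\<dots> \<le> (\<Sum>A\<in>S. norm (\<Sum>j\<in>cells \<phi> L. rsign A j * ?z j))"
    unfolding S_def by (rule khinchin[OF finite_cells])
  finally show ?thesis unfolding fourier_coeff_test_fun .
qed

section \<open>Domination of the Theta norm\<close>

text \<open>Between \<open>16\<^sup>k\<close> and \<open>16\<^sup>k\<^sup>+\<^sup>1\<close> there are \<open>15/16\<close> of the first \<open>16\<^sup>k\<^sup>+\<^sup>1\<close> terms, each at least as large as the last one.\<close>

lemma sum_geometric_rearr_le:
  "(\<Sum>m<Suc k. 16 ^ m * (seq_rearr b (16 ^ m))\<^sup>2) \<le> 2 * (\<Sum>j=1..16 ^ k. (seq_rearr b j)\<^sup>2)"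
proof (induction k)
  case 0
  show ?case by (simp add: mult_2 add_increasing)
next
  case (Suc k)
  have split: "{1..16 ^ Suc k} = {1..16 ^ k} \<union> {16 ^ k + 1..16 ^ Suc k :: nat}" by auto
  have "of_nat (15 * 16 ^ k) * (seq_rearr b (16 ^ Suc k))\<^sup>2
      = (\<Sum>j\<in>{16 ^ k + 1..16 ^ Suc k :: nat}. (seq_rearr b (16 ^ Suc k))\<^sup>2)"
    unfolding sum_constant by (intro arg_cong2[of _ _ _ _ times] arg_cong[of _ _ of_nat]) auto
  also have "\<dots> \<le> (\<Sum>j\<in>{16 ^ k + 1..16 ^ Suc k :: nat}. (seq_rearr b j)\<^sup>2)"
    by (intro sum_mono power_mono_ennreal seq_rearr_antimono) auto
  finally have block: "of_nat (15 * 16 ^ k) * (seq_rearr b (16 ^ Suc k))\<^sup>2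
      \<le> (\<Sum>j\<in>{16 ^ k + 1..16 ^ Suc k :: nat}. (seq_rearr b j)\<^sup>2)" .
  have "(16::ennreal) ^ Suc k = of_nat (16 * 16 ^ k)" by simp
  also have "\<dots> \<le> of_nat (2 * (15 * 16 ^ k))" by (intro of_nat_mono) simp
  also have "\<dots> = 2 * of_nat (15 * 16 ^ k)" by simp
  finally have "16 ^ Suc k * (seq_rearr b (16 ^ Suc k))\<^sup>2 \<le> 2 * of_nat (15 * 16 ^ k) * (seq_rearr b (16 ^ Suc k))\<^sup>2"
    by (rule mult_right_mono) simp
  also have "\<dots> \<le> 2 * (\<Sum>j\<in>{16 ^ k + 1..16 ^ Suc k :: nat}. (seq_rearr b j)\<^sup>2)"
    unfolding mult.assoc[of 2] by (intro mult_left_mono block) simp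
  finally have step: "16 ^ Suc k * (seq_rearr b (16 ^ Suc k))\<^sup>2
      \<le> 2 * (\<Sum>j\<in>{16 ^ k + 1..16 ^ Suc k :: nat}. (seq_rearr b j)\<^sup>2)" .
  have "(\<Sum>m<Suc (Suc k). 16 ^ m * (seq_rearr b (16 ^ m))\<^sup>2)
      \<le> 2 * (\<Sum>j=1..16 ^ k. (seq_rearr b j)\<^sup>2) + 2 * (\<Sum>j\<in>{16 ^ k + 1..16 ^ Suc k :: nat}. (seq_rearr b j)\<^sup>2)"
    unfolding sum.lessThan_Suc[of _ "Suc k"] by (intro add_mono Suc.IH step)
  also have "\<dots> = 2 * (\<Sum>j=1..16 ^ Suc k. (seq_rearr b j)\<^sup>2)"
    unfolding split by (subst sum.union_disjoint) (auto simp: distrib_left)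
  finally show ?case .
qed

text \<open>A sequence on the integers with the same rearrangement as \<open>b\<close>, but decreasing along the enumeration
  \<open>0, -1, 1, -2, \<dots>\<close>. Thus its large terms sit at low frequencies, where the test functions have large
  coefficients.\<close>

definition decreasing_copy :: "(int \<Rightarrow> ennreal) \<Rightarrow> int \<Rightarrow> ennreal" where
  "decreasing_copy b n = seq_rearr b (int_encode n + 1)"

lemma seq_rearr_decreasing_copy:
  assumes j: "1 \<le> j" shows "seq_rearr (decreasing_copy b) j = seq_rearr b j"
proof -
  have "s < seq_rearr (decreasing_copy b) j \<longleftrightarrow> s < seq_rearr b j" for s
  proof
    assume "s < seq_rearr (decreasing_copy b) j"
    then obtain E where E: "finite E" "card E = j" "\<forall>n\<in>E. s < decreasing_copy b n"
      using less_seq_rearr_iff[OF j] by blast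
    have card: "card (int_encode ` E) = j" using E inj_int_encode by (simp add: card_image inj_on_subset)
    have "\<not> int_encode ` E \<subseteq> {..<j - 1}"
    proof
      assume "int_encode ` E \<subseteq> {..<j - 1}"
      then have "card (int_encode ` E) \<le> card {..<j - 1}" by (intro card_mono) auto
      then show False using card j by simp
    qed
    then obtain n where n: "n \<in> E" "j - 1 \<le> int_encode n" by (auto simp: subset_iff not_less)
    then have "s < seq_rearr b (int_encode n + 1)" using E(3) by (auto simp: decreasing_copy_def)
    also have "\<dots> \<le> seq_rearr b j" using n(2) j by (intro seq_rearr_antimono) auto
    finally show "s < seq_rearr b j" .
  next
    assume s: "s < seq_rearr b j"
    have "s < decreasing_copy b n" if "n \<in> int_decode ` {..<j}" for n
    proof -
      have "int_encode n < j" using that by auto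
      then have "seq_rearr b j \<le> seq_rearr b (int_encode n + 1)" by (intro seq_rearr_antimono) auto
      with s show ?thesis by (simp add: decreasing_copy_def)
    qed
    moreover have "card (int_decode ` {..<j}) = j"
      using inj_int_decode[of "{..<j}"] by (simp add: card_image)
    ultimately show "s < seq_rearr (decreasing_copy b) j"
      unfolding less_seq_rearr_iff[OF j] by (intro exI[of _ "int_decode ` {..<j}"]) auto
  qed
  then show ?thesis by (metis less_irrefl linorder_less_linear)
qed

lemma abs_le_int_encode: "nat \<bar>n\<bar> \<le> int_encode n"
  by (cases "0 \<le> n") (auto simp: int_encode_def sum_encode_def nat_le_iff)

lemma (in ri_sequence_norm) sum_le:
  "finite S \<Longrightarrow> \<rho> (\<lambda>i. \<Sum>a\<in>S. g a i) \<le> (\<Sum>a\<in>S. \<rho> (g a))"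
proof (induction S rule: finite_induct)
  case empty
  show ?case using zero_iff[of "\<lambda>_. 0"] by simp
next
  case (insert a S)
  have "\<rho> (\<lambda>i. \<Sum>a\<in>insert a S. g a i) \<le> \<rho> (g a) + \<rho> (\<lambda>i. \<Sum>a\<in>S. g a i)"
    using insert.hyps triangle[of "g a"] by simp
  also have "\<dots> \<le> (\<Sum>a\<in>insert a S. \<rho> (g a))"
    using insert by (simp add: add_left_mono)
  finally show ?case .
qed

text \<open>Test functions are built for the energies \<open>d\<^sub>m = 16\<^sup>m (b\<^sup>*(16\<^sup>m))\<^sup>2\<close>. Their weighted norms are controlled by the
  dyadic form of the Theta norm, because the average of \<open>d\<close> up to \<open>l\<close> is at most a multiple of the square of
  \<open>dyadic_mean b (4 (l - 1))\<close>, and the mean of the absolute values of their coefficients dominates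
  \<open>decreasing_copy b\<close> on \<open>\<bar>n\<bar> + 1 < 16\<^sup>M\<close>. The triangle inequality bounds the norm of the mean.\<close>

lemma ri_norm_le_Theta_norm:
  fixes X :: "(int \<Rightarrow> ennreal) \<Rightarrow> ennreal" and b :: "int \<Rightarrow> ennreal"
  assumes p: "2 < p" and X: "ri_sequence_norm X" and K: "0 < K"
    and bound: "\<And>f. integrable torus f \<Longrightarrow>
        X (\<lambda>n. ennreal (norm (fourier_coeff f n))) \<le> ennreal K * weighted_Lp_norm p f"
    and fin: "Theta_norm p b < top"
  shows "X b \<le> ennreal (1200 * K) * Theta_norm p b"
proof -
  interpret X: ri_sequence_norm X by (rule X)
  let ?\<Theta> = "Theta_norm p b"
  have "seq_rearr b 1 = dyadic_mean b 0" by (simp add: dyadic_mean_def top_l2_def)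
  also have "\<dots> \<le> seq_norm p (dyadic_mean b)" by (rule seq_norm_upper[OF p])
  also have "\<dots> \<le> 2 * ?\<Theta>" by (rule dyadic_le_Theta_norm[OF p])
  also have "\<dots> < top" using fin by (simp add: ennreal_mult_less_top)
  finally have top1: "seq_rearr b 1 < top" .
  define \<beta> where "\<beta> m = enn2real (seq_rearr b (16 ^ m))" for m
  have \<beta>: "ennreal (\<beta> m) = seq_rearr b (16 ^ m)" for m
    unfolding \<beta>_def using le_less_trans[OF seq_rearr_antimono[of 1 "16 ^ m" b] top1] by simp
  have \<beta>0: "0 \<le> \<beta> m" for m by (simp add: \<beta>_def)
  define d where "d m = 16 ^ m * (\<beta> m)\<^sup>2" for m
  have d0: "0 \<le> d m" for m by (simp add: d_def)
  have sum_d: "ennreal (\<Sum>m<Suc k. d m) \<le> 2 * (top_l2 (2 ^ (4 * k)) b)\<^sup>2" for k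
  proof -
    have "ennreal (d m) = 16 ^ m * (seq_rearr b (16 ^ m))\<^sup>2" for m
      using ennreal_power[of 16 m] by (simp add: d_def ennreal_mult ennreal_power[symmetric] \<beta>0 \<beta>)
    then have "ennreal (\<Sum>m<Suc k. d m) = (\<Sum>m<Suc k. 16 ^ m * (seq_rearr b (16 ^ m))\<^sup>2)"
      by (subst sum_ennreal[symmetric]) (auto simp: d0)
    also have "\<dots> \<le> 2 * (\<Sum>j=1..16 ^ k. (seq_rearr b j)\<^sup>2)" by (rule sum_geometric_rearr_le)
    also have "(16::nat) ^ k = 2 ^ (4 * k)" by (simp add: power_mult)
    finally show ?thesis unfolding top_l2_def by (simp del: epowr_half_square add: epowr_half_square)
  qed
  obtain v \<phi> where v: "\<And>l. 0 \<le> v l" "\<And>l. 2 \<le> l \<Longrightarrow> v l \<le> 4 * ((\<Sum>m<l. d m) / real l)"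
    and \<phi>: "\<And>l. 2 \<le> l \<Longrightarrow> l \<le> 4 * \<phi> l + 3"
    and dv: "\<And>m. d m \<le> (\<Sum>l\<in>{l\<in>{2..<4 * (m + 1)}. \<phi> l = m}. v l)"
    using energy_transport[of d, OF d0] by blast
  let ?c = "\<lambda>l::nat. if 2 \<le> l then ennreal (sqrt (v l)) else 0"
  have c: "?c l \<le> 6 * dyadic_mean b (4 * (l - 1))" if l: "2 \<le> l" for l
  proof -
    define k where "k = l - 1"
    have lk: "l = Suc k" using l by (simp add: k_def)
    have "ennreal (v l) \<le> ennreal (4 / real l * (\<Sum>m<l. d m))"
      using v(2)[OF l] by (intro ennreal_leI) simp
    also have "\<dots> = ennreal (4 / real l) * ennreal (\<Sum>m<Suc k. d m)"
      unfolding lk by (rule ennreal_mult) (simp, rule sum_nonneg, rule d0)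
    also have "\<dots> \<le> ennreal (4 / real l) * (2 * (top_l2 (2 ^ (4 * k)) b)\<^sup>2)"
      by (intro mult_left_mono sum_d) simp
    also have "\<dots> = ennreal (8 / real l) * (top_l2 (2 ^ (4 * k)) b)\<^sup>2"
      using ennreal_mult[of "4 / real l" 2] by (simp add: mult.assoc[symmetric])
    finally have "epowr (ennreal (v l)) (1 / 2) \<le> epowr (ennreal (8 / real l) * (top_l2 (2 ^ (4 * k)) b)\<^sup>2) (1 / 2)"
      by (rule epowr_mono[rotated]) simp
    then have "?c l \<le> ennreal (sqrt (8 / real l)) * top_l2 (2 ^ (4 * k)) b"
      using l v(1) by (simp add: epowr_mult epowr_ennreal powr_half_sqrt)
    also have "\<dots> \<le> ennreal (6 * (1 / sqrt (real (Suc (4 * k))))) * top_l2 (2 ^ (4 * k)) b"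
    proof (intro mult_right_mono ennreal_leI)
      have "8 / real l \<le> 36 / real (Suc (4 * k))"
        using lk by (simp add: divide_simps)
      then have "sqrt (8 / real l) \<le> sqrt (36 / real (Suc (4 * k)))" by (rule real_sqrt_le_mono)
      also have "\<dots> = 6 * (1 / sqrt (real (Suc (4 * k))))"
        using real_sqrt_abs[of 6] by (simp add: real_sqrt_divide)
      finally show "sqrt (8 / real l) \<le> 6 * (1 / sqrt (real (Suc (4 * k))))" .
    qed simp
    also have "\<dots> = 6 * dyadic_mean b (4 * k)"
      unfolding dyadic_mean_def by (subst ennreal_mult) (simp_all add: mult.assoc)
    finally show ?thesis by (simp add: k_def)
  qed
  have "seq_norm p ?c \<le> seq_norm p (\<lambda>i. 6 * dyadic_mean b i)"
    by (rule seq_norm_subsequence_le[OF p, of "\<lambda>l. 4 * (l - 1)" "{2..}"])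
      (use c in \<open>auto simp: inj_on_def\<close>)
  also have "\<dots> \<le> 6 * (2 * ?\<Theta>)"
    unfolding seq_norm_cmult[OF p] by (intro mult_left_mono dyadic_le_Theta_norm[OF p]) simp
  finally have cnorm: "seq_norm p ?c \<le> 12 * ?\<Theta>" by (simp flip: mult.assoc)
  \<comment> \<open>Truncations to finitely many integers, so that finitely many annuli suffice; they are removed by the Fatou property.\<close>
  define bM where "bM M n = (if \<bar>n\<bar> + 1 < 16 ^ M then decreasing_copy b n else 0)" for M :: nat and n
  have trunc: "X (bM M) \<le> ennreal (1200 * K) * ?\<Theta>" for M
  proof -
    define S where "S = Pow (cells \<phi> (4 * M))"
    have S: "finite S" "0 < card S"
      unfolding S_def by (simp_all add: finite_cells card_Pow)
    let ?f = "test_fun v \<phi> (4 * M)"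
    have "bM M n \<le> (\<Sum>A\<in>S. ennreal (100 / real (card S)) * ennreal (norm (fourier_coeff (?f A) n)))" for n
    proof (cases "\<bar>n\<bar> + 1 < 16 ^ M")
      case True
      obtain m where m: "16 ^ m \<le> nat \<bar>n\<bar> + 1" "nat \<bar>n\<bar> + 1 < 16 ^ Suc m"
        using ex_power_ivl1[of 16 "nat \<bar>n\<bar> + 1"] by auto
      have n16: "\<bar>n\<bar> < 16 ^ Suc m"
      proof -
        have "int (nat \<bar>n\<bar> + 1) < int (16 ^ Suc m)" using m(2) by (simp only: of_nat_less_iff)
        then show ?thesis by simp
      qed
      have "int (16 ^ m) \<le> int (nat \<bar>n\<bar> + 1)" using m(1) by (simp only: of_nat_le_iff)
      then have "(16::int) ^ m \<le> \<bar>n\<bar> + 1" by simp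
      from le_less_trans[OF this True] have "m < M" by simp
      then have mM: "4 * (m + 1) \<le> 4 * M" by simp
      have "decreasing_copy b n \<le> seq_rearr b (16 ^ m)"
        unfolding decreasing_copy_def using m(1) abs_le_int_encode[of n] by (intro seq_rearr_antimono) auto
      then have le: "bM M n \<le> ennreal (\<beta> m)" using True by (simp add: bM_def \<beta>)
      \<comment> \<open>The right-hand side is \<open>\<beta> m / \<surd>2048\<close>, and \<open>2048 \<le> 50\<^sup>2\<close>.\<close>
      have "\<beta> m / 50 \<le> sqrt (cell_length m / 8 * d m)"
      proof (rule real_le_rsqrt)
        have eq: "cell_length m / 8 * d m = (\<beta> m)\<^sup>2 / 2048"
          by (simp add: cell_length_def d_def power_add power_mult)
        show "(\<beta> m / 50)\<^sup>2 \<le> cell_length m / 8 * d m"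
          unfolding eq power_divide using zero_le_power2[of "\<beta> m"] by simp
      qed
      also have "\<dots> \<le> sqrt (cell_length m / 8 * (\<Sum>l\<in>{l\<in>{2..<4 * (m + 1)}. \<phi> l = m}. v l))"
        using dv[of m] less_imp_le[OF cell_length_pos[of m]] by (intro real_sqrt_le_mono mult_left_mono) auto
      finally have "real (card S) * (5 / 9 * (\<beta> m / 50))
          \<le> real (card S) * (5 / 9 * sqrt (cell_length m / 8 * (\<Sum>l\<in>{l\<in>{2..<4 * (m + 1)}. \<phi> l = m}. v l)))"
        by (intro mult_left_mono) auto
      also have "\<dots> \<le> (\<Sum>A\<in>S. norm (fourier_coeff (?f A) n))"
        unfolding S_def by (rule sum_fourier_test_fun_ge[OF v(1) \<phi> mM n16])
      finally have "real (card S) * (5 / 9 * (\<beta> m / 50)) \<le> (\<Sum>A\<in>S. norm (fourier_coeff (?f A) n))" .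
      moreover have "real (card S) * (\<beta> m / 100) \<le> real (card S) * (5 / 9 * (\<beta> m / 50))"
        using \<beta>0[of m] by (intro mult_left_mono) auto
      ultimately have le100: "real (card S) * (\<beta> m / 100) \<le> (\<Sum>A\<in>S. norm (fourier_coeff (?f A) n))"
        by linarith
      have eq: "100 / real (card S) * (real (card S) * (\<beta> m / 100)) = \<beta> m"
        using S(2) by (simp del: card_gt_0_iff)
      from le100 have "100 / real (card S) * (real (card S) * (\<beta> m / 100))
          \<le> 100 / real (card S) * (\<Sum>A\<in>S. norm (fourier_coeff (?f A) n))"
        by (rule mult_left_mono) simp
      then have "\<beta> m \<le> (\<Sum>A\<in>S. 100 / real (card S) * norm (fourier_coeff (?f A) n))"
        unfolding eq sum_distrib_left .
      then have "ennreal (\<beta> m) \<le> ennreal (\<Sum>A\<in>S. 100 / real (card S) * norm (fourier_coeff (?f A) n))"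
        by (rule ennreal_leI)
      also have "\<dots> = (\<Sum>A\<in>S. ennreal (100 / real (card S)) * ennreal (norm (fourier_coeff (?f A) n)))"
        by (subst sum_ennreal[symmetric]) (simp, intro sum.cong refl ennreal_mult, simp_all)
      finally show ?thesis using le by (rule order_trans[rotated])
    qed (simp add: bM_def)
    then have "X (bM M) \<le> X (\<lambda>n. \<Sum>A\<in>S. ennreal (100 / real (card S)) * ennreal (norm (fourier_coeff (?f A) n)))"
      by (rule X.lattice)
    also have "\<dots> \<le> (\<Sum>A\<in>S. X (\<lambda>n. ennreal (100 / real (card S)) * ennreal (norm (fourier_coeff (?f A) n))))"
      by (rule X.sum_le[OF S(1)])
    also have "\<dots> \<le> (\<Sum>A\<in>S. ennreal (100 / real (card S)) * (ennreal K * (12 * ?\<Theta>)))"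
    proof (rule sum_mono)
      fix A
      have "X (\<lambda>n. ennreal (norm (fourier_coeff (?f A) n))) \<le> ennreal K * weighted_Lp_norm p (?f A)"
        by (rule bound[OF integrable_test_fun[OF v(1) \<phi>]])
      also have "\<dots> \<le> ennreal K * (12 * ?\<Theta>)"
        by (intro mult_left_mono order_trans[OF weighted_norm_test_fun[OF p v(1) \<phi>] cnorm]) simp_all
      finally show "X (\<lambda>n. ennreal (100 / real (card S)) * ennreal (norm (fourier_coeff (?f A) n)))
          \<le> ennreal (100 / real (card S)) * (ennreal K * (12 * ?\<Theta>))"
        by (subst X.homogeneous) (auto intro: mult_left_mono)
    qed
    also have "\<dots> = ennreal (real (card S)) * ennreal (100 / real (card S)) * (ennreal K * (12 * ?\<Theta>))"
      unfolding sum_constant by (simp add: ennreal_of_nat_eq_real_of_nat mult.assoc)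
    also have "ennreal (real (card S)) * ennreal (100 / real (card S)) = 100"
      using S by (auto simp: card_gt_0_iff simp flip: ennreal_mult)
    also have "100 * (ennreal K * (12 * ?\<Theta>)) = ennreal (1200 * K) * ?\<Theta>"
    proof -
      have "ennreal (1200 * K) = 1200 * ennreal K" using K by (simp add: ennreal_mult)
      moreover have "(100::ennreal) * (y * (12 * x)) = 1200 * y * x" for x y :: ennreal
      proof -
        have "(100::ennreal) * (y * (12 * x)) = (100 * 12) * y * x" by (simp only: mult_ac)
        then show ?thesis by simp
      qed
      ultimately show ?thesis by simp
    qed
    finally show ?thesis .
  qed
  have inc: "incseq (\<lambda>M. bM M n)" for n
  proof (unfold incseq_def, intro allI impI)
    fix M N :: nat assume "M \<le> N"
    then have "(16::int) ^ M \<le> 16 ^ N" by (intro power_increasing) auto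
    then have "\<bar>n\<bar> + 1 < 16 ^ N" if "\<bar>n\<bar> + 1 < 16 ^ M" using that by (rule less_le_trans[rotated])
    then show "bM M n \<le> bM N n" unfolding bM_def by auto
  qed
  have "X b = X (decreasing_copy b)"
    by (rule X.rearrangement_invariant) (simp add: seq_rearr_decreasing_copy)
  also have "decreasing_copy b = (\<lambda>n. SUP M. bM M n)"
  proof (rule ext, rule antisym)
    fix n
    have "nat \<bar>n\<bar> + 1 < 16 ^ (nat \<bar>n\<bar> + 1)"
      by (rule less_le_trans[OF less_exp power_mono]) simp_all
    then have "int (nat \<bar>n\<bar> + 1) < int (16 ^ (nat \<bar>n\<bar> + 1))" by (simp only: of_nat_less_iff)
    then have "bM (nat \<bar>n\<bar> + 1) n = decreasing_copy b n" by (simp add: bM_def)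
    then show "decreasing_copy b n \<le> (SUP M. bM M n)" by (metis SUP_upper UNIV_I)
    show "(SUP M. bM M n) \<le> decreasing_copy b n" by (rule SUP_least) (simp add: bM_def)
  qed
  also have "X (\<lambda>n. SUP M. bM M n) = (SUP M. X (bM M))" by (rule X.Fatou[OF inc])
  also have "\<dots> \<le> ennreal (1200 * K) * ?\<Theta>" by (rule SUP_least) (rule trunc)
  finally show ?thesis .
qed

theorem weighted_imp_norm_dominated:
  assumes p: "2 < p" and X: "ri_sequence_norm X" and bounded: "fourier_bounded X (weighted_Lp_norm p)"
  shows "norm_dominated X (Theta_norm p)"
proof -
  obtain K where K: "0 < K" "\<And>f. integrable torus f \<Longrightarrow>
        X (\<lambda>n. ennreal (norm (fourier_coeff f n))) \<le> ennreal K * weighted_Lp_norm p f"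
    using bounded unfolding fourier_bounded_def by blast
  have "X (\<lambda>n. ennreal (norm (b n))) \<le> ennreal (1200 * K) * Theta_norm p (\<lambda>n. ennreal (norm (b n)))"
    for b :: "int \<Rightarrow> complex"
  proof (cases "Theta_norm p (\<lambda>n. ennreal (norm (b n))) = top")
    case True
    then show ?thesis using K(1) by (simp add: ennreal_mult_top)
  next
    case False
    then show ?thesis
      by (intro ri_norm_le_Theta_norm[OF p X K]) (auto simp: less_top)
  qed
  then show ?thesis unfolding norm_dominated_def using K(1) by (intro exI[of _ "1200 * K"]) auto
qed

theorem lorentz_imp_weighted:
  assumes p: "2 < p" and bounded: "fourier_bounded X (lorentz_norm 2 p)"
  shows "fourier_bounded X (weighted_Lp_norm p)"
proof -
  obtain K where K: "0 < K" "\<And>f. integrable torus f \<Longrightarrow>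
        X (\<lambda>n. ennreal (norm (fourier_coeff f n))) \<le> ennreal K * lorentz_norm 2 p f"
    using bounded unfolding fourier_bounded_def by blast
  obtain C where C: "0 < C"
    "\<And>f. f \<in> borel_measurable torus \<Longrightarrow> lorentz_norm 2 p f \<le> ennreal C * weighted_Lp_norm p f"
    using lorentz_le_weighted[OF p] by blast
  have "X (\<lambda>n. ennreal (norm (fourier_coeff f n))) \<le> ennreal (K * C) * weighted_Lp_norm p f"
    if f: "integrable torus f" for f
  proof -
    have "X (\<lambda>n. ennreal (norm (fourier_coeff f n))) \<le> ennreal K * lorentz_norm 2 p f" by (rule K(2)[OF f])
    also have "\<dots> \<le> ennreal K * (ennreal C * weighted_Lp_norm p f)"
      by (intro mult_left_mono C(2) borel_measurable_integrable f) simp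
    finally show ?thesis using K(1) C(1) by (simp add: ennreal_mult mult.assoc)
  qed
  moreover have "0 < K * C" using K(1) C(1) by simp
  ultimately show ?thesis unfolding fourier_bounded_def by blast
qed

theorem norm_dominated_imp_lorentz:
  assumes p: "2 < p" and dom: "norm_dominated X (Theta_norm p)"
  shows "fourier_bounded X (lorentz_norm 2 p)"
proof -
  obtain C where C: "0 < C" "\<And>b::int \<Rightarrow> complex.
      X (\<lambda>n. ennreal (norm (b n))) \<le> ennreal C * Theta_norm p (\<lambda>n. ennreal (norm (b n)))"
    using dom unfolding norm_dominated_def by blast
  obtain K where K: "0 < K" "\<And>f. integrable torus f \<Longrightarrow>
        Theta_norm p (\<lambda>n. ennreal (norm (fourier_coeff f n))) \<le> ennreal K * lorentz_norm 2 p f"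
    using fourier_bounded_Theta[OF p] unfolding fourier_bounded_def by blast
  have "X (\<lambda>n. ennreal (norm (fourier_coeff f n))) \<le> ennreal (C * K) * lorentz_norm 2 p f"
    if f: "integrable torus f" for f
  proof -
    have "X (\<lambda>n. ennreal (norm (fourier_coeff f n))) \<le> ennreal C * Theta_norm p (\<lambda>n. ennreal (norm (fourier_coeff f n)))"
      by (rule C(2))
    also have "\<dots> \<le> ennreal C * (ennreal K * lorentz_norm 2 p f)"
      by (intro mult_left_mono K(2) f) simp
    finally show ?thesis using K(1) C(1) by (simp add: ennreal_mult mult.assoc)
  qed
  moreover have "0 < C * K" using K(1) C(1) by simp
  ultimately show ?thesis unfolding fourier_bounded_def by blast
qed

theorem theorem6p4:
  fixes p :: ennreal and X :: "(int \<Rightarrow> ennreal) \<Rightarrow> ennreal"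
  assumes "2 < p" and "ri_sequence_norm X"
  shows "(fourier_bounded X (weighted_Lp_norm p) \<longleftrightarrow> fourier_bounded X (lorentz_norm 2 p)) \<and>
    (fourier_bounded X (lorentz_norm 2 p) \<longleftrightarrow> norm_dominated X (Theta_norm p)) \<and>
    (ri_sequence_norm (Theta_norm p :: (int \<Rightarrow> ennreal) \<Rightarrow> ennreal) \<and>
     fourier_bounded (Theta_norm p) (lorentz_norm 2 p) \<and>
     (\<forall>Y. ri_sequence_norm Y \<and> fourier_bounded Y (lorentz_norm 2 p) \<longrightarrow>
          norm_dominated Y (Theta_norm p)))"
  using weighted_imp_norm_dominated lorentz_imp_weighted norm_dominated_imp_lorentz
    Theta_ri_sequence_norm fourier_bounded_Theta assms by blast

end
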